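(* Let $n\ge 2$. Let $f:\mathbb{R}^n\to\mathbb{R}$ satisfy $f\in L^1_2(\mathbb{R}^n)$, $\|f\|_{L^1_2}\neq 0$, $0\le f\le 1$ on $\mathbb{R}^n$, and $$f(v')f(v_*')(1-f(v))(1-f(v_* ))=f(v)f(v_* )(1-f(v'))(1-f(v_*'))\quad\text{for a.e. }(v,v_*,\sigma)\in\mathbb{R}^n\times\mathbb{R}^n\times\mathbb{S}^{n-1},$$ where $v'=\frac{v+v_*}{2}+\frac{|v-v_*|}{2}\sigma$ and $v_*'=\frac{v+v_*}{2}-\frac{|v-v_*|}{2}\sigma$. Let $$M_0=\int_{\mathbb{R}^n}f(v)\,dv,\qquad v_0=\frac{1}{M_0}\int_{\mathbb{R}^n}f(v)v\,dv,\qquad M_2=\int_{\mathbb{R}^n}f(v)|v-v_0|^2\,dv.$$ Then $f$ belongs to one of the following two classes (I), (II), characterized as follows. (I) $f$ satisfies one of the following three conditions, which are equivalent to each other: (I.1) $S(f)>0$, i.e. $mes(\{v\in\mathbb{R}^n: 0<f(v)<1\})>0$; (I.2) $\displaystyle \frac{M_2}{M_0^{(n+2)/n}}>\frac{n}{n+2}\Big(\frac{n}{|\mathbb{S}^{n-1}|}\Big)^{2/n}$; (I.3) there are constants $0<a,b<\infty$ such that $\displaystyle f(v)=\frac{a e^{-b|v-v_0|^2}}{1+a e^{-b|v-v_0|^2}}$ for a.e. $v\in\mathbb{R}^n$. (II) $f$ satisfies one of the following three conditions, which are equivalent to each other: (II.1) $S(f)=0$, i.e. $mes(\{v\in\mathbb{R}^n: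 0<f(v)<1\})=0$; (II.2) $\displaystyle \frac{M_2}{M_0^{(n+2)/n}}=\frac{n}{n+2}\Big(\frac{n}{|\mathbb{S}^{n-1}|}\Big)^{2/n}$; (II.3) there is a constant $0<R<\infty$ such that $f(v)=\mathbf{1}_{\{|v-v_0|\le R\}}$ for a.e. $v\in\mathbb{R}^n$.
   Context: $\mathbb{S}^{n-1}$ is the unit sphere of $\mathbb{R}^n$ with its usual surface measure $d\sigma$, and $|\mathbb{S}^{n-1}|$ is its area; $mes$ is Lebesgue measure; "a.e." on $\mathbb{R}^n\times\mathbb{R}^n\times\mathbb{S}^{n-1}$ is with respect to the product measure $dv\,dv_*\,d\sigma$. $L^1_2(\mathbb{R}^n)=\{f\in L^1(\mathbb{R}^n): \|f\|_{L^1_2}:=\int_{\mathbb{R}^n}(1+|v|^2)|f(v)|\,dv<\infty\}$. The entropy is $S(f)=\int_{\mathbb{R}^n}\{-(1-f(v))\log(1-f(v))-f(v)\log f(v)\}\,dv$, with the convention $0\log 0=0$. Functions that differ on a null set are not distinguished, and functions may be assumed to be Borel. *)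

theory Defs
  imports "HOL-Probability.Probability"
begin

text \<open>Surface measure on the unit sphere \<open>S\<^sup>n\<^sup>-\<^sup>1\<close> of an \<open>n\<close>-dimensional space, given by polar
  coordinates: \<open>\<sigma>(A) = n \<cdot> mes {r s | 0 < r \<le> 1, s \<in> A}\<close> (see \<open>emeasure_sphere_measure\<close> below).
  Its points are those of the sphere itself, not of the ambient space.\<close>

definition sphere_measure :: "'a::euclidean_space measure" where
  "sphere_measure =
     scale_measure (ennreal (real DIM('a)))
       (distr (restrict_space lborel (cball 0 1 - {0}))
              (restrict_space borel (sphere 0 1)) (\<lambda>x. x /\<^sub>R norm x))"

definition sphere_area :: "'a::euclidean_space itself \<Rightarrow> real" where
  "sphere_area _ = measure (sphere_measure :: 'a measure) (sphere 0 1)"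

lemma space_sphere_measure [simp]: "space (sphere_measure :: 'a::euclidean_space measure) = sphere 0 1"
  by (simp add: sphere_measure_def space_restrict_space space_scale_measure)

lemma sets_sphere_measure:
  "sets (sphere_measure :: 'a::euclidean_space measure) = sets (restrict_space borel (sphere 0 1))"
  by (simp add: sphere_measure_def)

lemma emeasure_sphere_measure:
  fixes A :: "'a::euclidean_space set"
  assumes "A \<in> sets sphere_measure"
  shows "emeasure sphere_measure A =
           ennreal (real DIM('a)) * emeasure lborel {r *\<^sub>R s | r s. 0 < r \<and> r \<le> 1 \<and> s \<in> A}"
proof -
  have A: "A \<in> sets (restrict_space borel (sphere 0 1))"
    using assms by (simp add: sets_sphere_measure)
  then have sub: "A \<subseteq> sphere 0 1"
    using sets.sets_into_space[OF A] by (simp add: space_restrict_space)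
  have meas: "(\<lambda>x::'a. x /\<^sub>R norm x)
      \<in> restrict_space lborel (cball 0 1 - {0}) \<rightarrow>\<^sub>M restrict_space borel (sphere 0 1)"
    by (rule measurable_restrict_space2)
      (auto simp: space_restrict_space intro!: measurable_restrict_space1)
  have eq: "(\<lambda>x::'a. x /\<^sub>R norm x) -` A \<inter> space (restrict_space lborel (cball 0 1 - {0}))
      = {r *\<^sub>R s | r s. 0 < r \<and> r \<le> 1 \<and> s \<in> A}" (is "?L = ?R")
  proof (intro equalityI subsetI)
    fix x assume x: "x \<in> ?L"
    then have "x = norm x *\<^sub>R (x /\<^sub>R norm x)" "0 < norm x" "norm x \<le> 1" "x /\<^sub>R norm x \<in> A"
      by (auto simp: space_restrict_space)
    then show "x \<in> ?R" by blast
  next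
    fix x assume "x \<in> ?R"
    then obtain r s where rs: "x = r *\<^sub>R s" "0 < r" "r \<le> 1" "s \<in> A" by blast
    with sub have "norm s = 1" by auto
    with rs show "x \<in> ?L" by (auto simp: space_restrict_space)
  qed
  show ?thesis
    unfolding sphere_measure_def emeasure_scale_measure emeasure_distr[OF meas A] eq
    by (subst emeasure_restrict_space) (auto simp: eq[symmetric] space_restrict_space)
qed

lemma sphere_area_eq:
  "sphere_area TYPE('a::euclidean_space) = real DIM('a) * unit_ball_vol (real DIM('a))"
proof -
  have "{r *\<^sub>R s | r s. 0 < r \<and> r \<le> 1 \<and> s \<in> sphere (0::'a) 1} = cball 0 1 - {0}" (is "?L = ?R")
  proof (intro equalityI subsetI)
    fix x :: 'a assume x: "x \<in> ?R"
    then have "x = norm x *\<^sub>R (x /\<^sub>R norm x)" "0 < norm x" "norm x \<le> 1" "x /\<^sub>R norm x \<in> sphere 0 1"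
      by auto
    then show "x \<in> ?L" by blast
  qed auto
  moreover have "emeasure lborel (cball (0::'a) 1 - {0}) = ennreal (unit_ball_vol (real DIM('a)))"
    by (subst emeasure_Diff) (auto simp: emeasure_cball)
  moreover have "sphere (0::'a) 1 \<in> sets sphere_measure"
    using sets.top[of "sphere_measure :: 'a measure"] by simp
  ultimately show ?thesis
    by (simp add: sphere_area_def measure_def emeasure_sphere_measure ennreal_mult[symmetric])
qed

definition L12_norm :: "('a::euclidean_space \<Rightarrow> real) \<Rightarrow> real" where
  "L12_norm f = (LINT v|lborel. (1 + (norm v)\<^sup>2) * \<bar>f v\<bar>)"

definition L12 :: "('a::euclidean_space \<Rightarrow> real) set" where
  "L12 = {f. integrable lborel f \<and> integrable lborel (\<lambda>v. (1 + (norm v)\<^sup>2) * \<bar>f v\<bar>)}"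

text \<open>The convention \<open>0 log 0 = 0\<close> needs no case distinction, as \<open>0 * ln 0 = 0\<close> in HOL.
  The Bochner integral does not take its default value here: see \<open>entropy_integrable\<close>.\<close>

definition entropy :: "('a::euclidean_space \<Rightarrow> real) \<Rightarrow> real" where
  "entropy f = (LINT v|lborel. - (1 - f v) * ln (1 - f v) - f v * ln (f v))"

lemma entropy_integrable:
  fixes f :: "'a::euclidean_space \<Rightarrow> real"
  assumes f: "f \<in> L12" and bounds: "\<forall>v. 0 \<le> f v \<and> f v \<le> 1"
  shows "integrable lborel (\<lambda>v. - (1 - f v) * ln (1 - f v) - f v * ln (f v))"
    and "0 \<le> entropy f"
proof -
  have nonneg: "0 \<le> - (1 - x) * ln (1 - x) - x * ln x" if "0 \<le> x" "x \<le> 1" for x :: real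
  proof -
    have *: "y * ln y \<le> 0" if "0 \<le> y" "y \<le> 1" for y :: real
      using that by (cases "y = 0") (auto intro!: mult_nonneg_nonpos)
    from *[of x] *[of "1 - x"] that show ?thesis by (simp add: algebra_simps)
  qed
  have young: "- (x * ln x) \<le> x * t + exp (- t)" if "0 \<le> x" for x t :: real
  proof (cases "x = 0")
    case False
    with that have x: "0 < x" by simp
    have "ln (exp (- t) / x) \<le> exp (- t) / x - 1"
      using x by (intro ln_le_minus_one) simp
    then have "x * (- t - ln x) \<le> x * (exp (- t) / x - 1)"
      using x by (intro mult_left_mono) (auto simp: ln_div)
    with x show ?thesis by (simp add: algebra_simps)
  qed simp
  have one: "- ((1 - x) * ln (1 - x)) \<le> x" if "0 \<le> x" "x \<le> 1" for x :: real
  proof (cases "x = 1")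
    case False
    with that have x: "0 < 1 - x" by simp
    have "ln (1 / (1 - x)) \<le> 1 / (1 - x) - 1" using x by (intro ln_le_minus_one) simp
    then have "(1 - x) * (- ln (1 - x)) \<le> (1 - x) * (1 / (1 - x) - 1)"
      using x by (intro mult_left_mono) (auto simp: ln_div)
    with x show ?thesis by (simp add: algebra_simps)
  qed simp
  have bound: "- (1 - f v) * ln (1 - f v) - f v * ln (f v)
      \<le> (1 + (norm v)\<^sup>2) * \<bar>f v\<bar> + exp (- (norm v)\<^sup>2)" for v
    using one[of "f v"] young[of "f v" "(norm v)\<^sup>2"] bounds by (simp add: algebra_simps)
  have gauss1: "(\<integral>\<^sup>+x. ennreal (exp (- x\<^sup>2)) \<partial>lborel) < \<infinity>"
  proof -
    have "integrable lborel (\<lambda>x. sqrt pi * normal_density 0 (1 / sqrt 2) x)"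
      by (intro integrable_mult_right integrable_normal_density) simp
    then have "integrable lborel (\<lambda>x::real. exp (- x\<^sup>2))"
      by (simp add: normal_density_def power_divide)
    then show ?thesis by (simp add: integrable_iff_bounded)
  qed
  have "(\<integral>\<^sup>+v. ennreal (exp (- (norm v)\<^sup>2)) \<partial>(lborel :: 'a measure))
      = (\<integral>\<^sup>+v. (\<Prod>b\<in>Basis. ennreal (exp (- (v \<bullet> b)\<^sup>2))) \<partial>(lborel :: 'a measure))"
  proof (intro nn_integral_cong)
    fix v :: 'a
    have "(norm v)\<^sup>2 = (\<Sum>b\<in>Basis. (v \<bullet> b)\<^sup>2)"
      unfolding power2_norm_eq_inner by (subst euclidean_inner) (simp add: power2_eq_square)
    then show "ennreal (exp (- (norm v)\<^sup>2)) = (\<Prod>b\<in>Basis. ennreal (exp (- (v \<bullet> b)\<^sup>2)))"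
      by (simp add: prod_ennreal exp_sum[symmetric] sum_negf)
  qed
  also have "\<dots> = (\<Prod>b\<in>(Basis :: 'a set). \<integral>\<^sup>+x. ennreal (exp (- x\<^sup>2)) \<partial>lborel)"
    by (rule nn_integral_lborel_prod) auto
  also have "\<dots> < \<infinity>"
    using gauss1 by (simp add: power_less_top_ennreal)
  finally have gauss: "integrable lborel (\<lambda>v::'a. exp (- (norm v)\<^sup>2))"
    by (auto simp: integrable_iff_bounded)
  have [measurable]: "f \<in> borel_measurable borel"
    using f by (auto simp: L12_def dest: borel_measurable_integrable)
  have "integrable lborel (\<lambda>v. (1 + (norm v)\<^sup>2) * \<bar>f v\<bar>)" using f by (simp add: L12_def)
  from Bochner_Integration.integrable_add[OF this gauss]
  show "integrable lborel (\<lambda>v. - (1 - f v) * ln (1 - f v) - f v * ln (f v))"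
  proof (rule Bochner_Integration.integrable_bound)
    show "AE v in lborel. norm (- (1 - f v) * ln (1 - f v) - f v * ln (f v))
        \<le> norm ((1 + (norm v)\<^sup>2) * \<bar>f v\<bar> + exp (- (norm v)\<^sup>2))"
      using nonneg bound bounds
      by (intro AE_I2) (smt (verit, best) real_norm_def)
  qed measurable
  show "0 \<le> entropy f"
    unfolding entropy_def using nonneg bounds by (intro integral_nonneg_AE AE_I2) blast
qed

definition post_v :: "'a::euclidean_space \<Rightarrow> 'a \<Rightarrow> 'a \<Rightarrow> 'a" where
  "post_v v w s = (v + w) /\<^sub>R 2 + (norm (v - w) / 2) *\<^sub>R s"

definition post_w :: "'a::euclidean_space \<Rightarrow> 'a \<Rightarrow> 'a \<Rightarrow> 'a" where
  "post_w v w s = (v + w) /\<^sub>R 2 - (norm (v - w) / 2) *\<^sub>R s"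

definition mass :: "('a::euclidean_space \<Rightarrow> real) \<Rightarrow> real" where
  "mass f = (LINT v|lborel. f v)"

definition mean_velocity :: "('a::euclidean_space \<Rightarrow> real) \<Rightarrow> 'a" where
  "mean_velocity f = (1 / mass f) *\<^sub>R (LINT v|lborel. f v *\<^sub>R v)"

definition second_moment :: "('a::euclidean_space \<Rightarrow> real) \<Rightarrow> real" where
  "second_moment f = (LINT v|lborel. f v * (norm (v - mean_velocity f))\<^sup>2)"

end

theory Submission
  imports Defs
begin

text \<open>For almost every direction \<open>s\<close>, the equation relates the values of \<open>f\<close> at the vertices of almost
  every rectangle \<open>v, v + x, v + u, v + y\<close> with \<open>x = (u + |u| s) / 2\<close> and \<open>y = (u - |u| s) / 2\<close>.

  If \<open>M = {0 < f < 1}\<close> has positive measure, three vertices in \<open>M\<close> force the fourth into \<open>M\<close>. Hence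
  \<open>M\<close> contains a ball up to a null set, this ball grows by a factor \<open>sqrt 2\<close> at each step, and \<open>M\<close> has full
  measure. Then \<open>ln (f / (1 - f))\<close> has equal sums over the two diagonals of almost every rectangle. Its
  averages over small boxes are continuous and satisfy this for all rectangles, which makes them of the form
  \<open>a + b \<bullet> v + c |v|\<^sup>2\<close>; in the limit so is the function itself, and integrability of \<open>f\<close> gives \<open>c < 0\<close>.

  If \<open>M\<close> is a null set, then \<open>f\<close> is the indicator of a set of finite measure such that no rectangle has one
  diagonal inside and the other outside. Passing to essential interiors \<open>U\<close> and \<open>W\<close> of this set and its
  complement makes this exact. \<open>U\<close> turns out to be bounded, and the contact set of its
  closure with the smallest enclosing sphere is shown to be the whole sphere.

  The bathtub principle compares the second moment of \<open>f\<close> with that of the ball of the same mass, which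
  separates the two cases by the ratio of moments.\<close>

subsection \<open>Rectangles with a prescribed direction\<close>

text \<open>The equation holds only almost everywhere, so no single rectangle can be trusted. Fixing
  a direction \<open>s\<close> leaves almost all \<open>v\<close> and \<open>u\<close>, and
  everything then rests on the map \<open>rx s\<close> from a diagonal to a side. It collapses the
  ray opposite to \<open>s\<close>, but on the cone \<open>equator s\<close> its inverse is
  Lipschitz, so vertices rarely fall into a small set. Hence a point can be completed to a rectangle
  whose other three vertices lie in a prescribed set of nearly full density. Openness, boundedness
  and convergence all come from this device.

  If \<open>f\<close> takes only the values 0 and 1, \<open>ln (f / (1 - f))\<close> is useless and
  geometry must replace analysis. The lever is that opposite vertices have equal sums of
  \<open>|v|\<^sup>2\<close>: when one vertex is on the enclosing sphere and its opposite has larger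
  norm than a third vertex, the fourth lies outside the enclosing ball and therefore in
  \<open>W\<close>.

  The critical ratio is that of a ball: the area of the unit sphere is \<open>n\<close> times the
  volume of the unit ball, and the radius cancels.\<close>

lemma expanding_vimage_measure_le:
  fixes f :: "'a::euclidean_space \<Rightarrow> 'a" and E S :: "'a set"
  assumes f[measurable]: "f \<in> borel_measurable borel"
    and E[measurable]: "E \<in> sets borel" and S[measurable]: "S \<in> sets borel"
    and L: "0 < L"
    and expand: "\<And>u w. u \<in> E \<Longrightarrow> w \<in> E \<Longrightarrow> norm (u - w) \<le> L * norm (f u - f w)"
  shows "emeasure lborel {u\<in>E. f u \<in> S} \<le> ennreal ((2 * L) ^ DIM('a)) * emeasure lborel S"
proof -
  let ?C = "(2 * L) ^ DIM('a)"
  have inj: "inj_on f E"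
    using expand L by (intro inj_onI) (metis diff_self mult_zero_right norm_le_zero_iff norm_zero right_minus_eq)
  \<comment> \<open>The bound is built up from null sets and balls to open sets, by a disjoint
    Vitali covering, and to Borel sets, by outer regularity. Null sets are needed because the
    covering misses one. They are handled by the inverse of \<open>f\<close> on \<open>E\<close>,
    which is Lipschitz.\<close>
  have null: "emeasure lborel {u\<in>E. f u \<in> N} = 0" if N: "N \<in> sets borel" "emeasure lborel N = 0" for N
  proof -
    have "negligible N"
      using N by (simp add: negligible_iff_null_sets null_setsI)
    then have nN: "negligible (N \<inter> f ` E)"
      by (rule negligible_subset) auto
    have "negligible (inv_into E f ` (N \<inter> f ` E))"
    proof (rule negligible_locally_Lipschitz_image[OF order_refl nN])
      fix x assume x: "x \<in> N \<inter> f ` E"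
      show "\<exists>T B. open T \<and> x \<in> T \<and> (\<forall>y\<in>N \<inter> f ` E \<inter> T. norm (inv_into E f y - inv_into E f x) \<le> B * norm (y - x))"
      proof (intro exI[of _ UNIV] exI[of _ L] conjI ballI)
        fix y assume "y \<in> N \<inter> f ` E \<inter> UNIV"
        then show "norm (inv_into E f y - inv_into E f x) \<le> L * norm (y - x)"
          using x expand[of "inv_into E f y" "inv_into E f x"]
          by (simp add: inv_into_into f_inv_into_f)
      qed auto
    qed
    then have "negligible {u\<in>E. f u \<in> N}"
      by (rule negligible_subset) (use inj in \<open>force simp: image_iff\<close>)
    moreover have "{u\<in>E. f u \<in> N} \<in> sets borel"
      using N(1) by measurable
    ultimately show ?thesis
      by (simp add: negligible_iff_null_sets null_sets_def)
  qed
  have ball: "emeasure lborel {u\<in>E. f u \<in> ball a r} \<le> ennreal ?C * emeasure lborel (ball a r)" for a r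
  proof (cases "{u\<in>E. f u \<in> ball a r} = {}")
    case False
    then obtain u0 where u0: "u0 \<in> E" "f u0 \<in> ball a r" by auto
    then have r: "0 < r" unfolding mem_ball by (blast intro: le_less_trans[OF zero_le_dist])
    \<comment> \<open>Two values in the ball differ by at most its diameter, so the preimage lies
      within \<open>2 * L * r\<close> of any of its points. This is the origin of the factor
      2.\<close>
    have "{u\<in>E. f u \<in> ball a r} \<subseteq> cball u0 (2 * L * r)"
    proof clarsimp
      fix u assume u: "u \<in> E" "dist a (f u) < r"
      have "norm (f u0 - f u) \<le> 2 * r"
        using u u0 dist_triangle[of "f u0" "f u" a] by (auto simp: dist_norm[symmetric] dist_commute)
      then have "L * norm (f u0 - f u) \<le> L * (2 * r)" using L by (intro mult_left_mono) auto
      then show "dist u0 u \<le> 2 * L * r"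
        using expand[OF u0(1) u(1)] by (simp add: dist_norm mult_ac)
    qed
    then have "emeasure lborel {u\<in>E. f u \<in> ball a r} \<le> emeasure lborel (cball u0 (2 * L * r))"
      by (intro emeasure_mono) auto
    also have "\<dots> = ennreal ?C * emeasure lborel (ball a r)"
      using r L by (simp add: emeasure_cball emeasure_ball ennreal_mult[symmetric] power_mult_distrib mult_ac)
    finally show ?thesis .
  next
    case True
    then show ?thesis by (simp only: emeasure_empty zero_le)
  qed
  have opn: "emeasure lborel {u\<in>E. f u \<in> V} \<le> ennreal ?C * emeasure lborel V" if V: "open V" for V
  proof -
    let ?K = "{i::'a \<times> real. ball (fst i) (snd i) \<subseteq> V}"
    obtain C where C: "countable C" "C \<subseteq> ?K"
      "pairwise (\<lambda>i j. disjnt (ball (fst i) (snd i)) (ball (fst j) (snd j))) C"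
      "negligible (V - (\<Union>i\<in>C. ball (fst i) (snd i)))"
    proof (rule Vitali_covering_theorem_balls[of V ?K fst snd])
      fix x d assume x: "x \<in> V" "(0::real) < d"
      obtain e where e: "0 < e" "ball x e \<subseteq> V" using V x open_contains_ball by blast
      show "\<exists>i. i \<in> ?K \<and> x \<in> ball (fst i) (snd i) \<and> snd i < d"
        using x e by (intro exI[of _ "(x, min e (d/2))"]) auto
    qed
    define N where "N = V - (\<Union>i\<in>C. ball (fst i) (snd i))"
    have N[measurable]: "N \<in> sets borel"
      using V unfolding N_def by (intro sets.Diff borel_open open_UN ballI open_ball)
    have N0: "emeasure lborel N = 0"
      using C(4) N by (auto simp: N_def[symmetric] negligible_iff_null_sets null_sets_def)
    have CV: "ball (fst i) (snd i) \<subseteq> V" if "i \<in> C" for i using C(2) that by auto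
    have "{u\<in>E. f u \<in> V} = {u\<in>E. f u \<in> N} \<union> (\<Union>i\<in>C. {u\<in>E. f u \<in> ball (fst i) (snd i)})"
      using CV unfolding N_def by blast
    then have "emeasure lborel {u\<in>E. f u \<in> V}
        \<le> emeasure lborel {u\<in>E. f u \<in> N} + emeasure lborel (\<Union>i\<in>C. {u\<in>E. f u \<in> ball (fst i) (snd i)})"
      using C(1) by (auto intro!: emeasure_subadditive sets.countable_UN')
    also have "\<dots> = emeasure lborel (\<Union>i\<in>C. {u\<in>E. f u \<in> ball (fst i) (snd i)})"
      using null[OF N N0] by simp
    also have "\<dots> = (\<integral>\<^sup>+ i. emeasure lborel {u\<in>E. f u \<in> ball (fst i) (snd i)} \<partial>count_space C)"
    proof (rule emeasure_UN_countable[OF _ C(1)])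
      have "ball (fst i) (snd i) \<inter> ball (fst j) (snd j) = {}" if "i \<in> C" "j \<in> C" "i \<noteq> j" for i j
        using C(3) that by (simp add: pairwise_def disjnt_def)
      then show "disjoint_family_on (\<lambda>i. {u\<in>E. f u \<in> ball (fst i) (snd i)}) C"
        unfolding disjoint_family_on_def by blast
    qed auto
    also have "\<dots> \<le> (\<integral>\<^sup>+ i. ennreal ?C * emeasure lborel (ball (fst i) (snd i)) \<partial>count_space C)"
      by (intro nn_integral_mono ball)
    also have "\<dots> = ennreal ?C * emeasure lborel (\<Union>i\<in>C. ball (fst i) (snd i))"
      using C(1,3) by (subst emeasure_UN_countable)
        (auto simp: disjoint_family_on_def pairwise_def disjnt_def nn_integral_cmult)
    also have "\<dots> \<le> ennreal ?C * emeasure lborel V"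
      using C(2) V by (intro mult_left_mono emeasure_mono) auto
    finally show ?thesis .
  qed
  show ?thesis
  proof (cases "emeasure lborel S = \<infinity>")
    case True
    then show ?thesis using L by (simp add: ennreal_mult_top)
  next
    case False
    show ?thesis
    proof (rule ennreal_le_epsilon)
      fix e :: real assume e: "0 < e"
      have e': "0 < e / ?C" using e L by simp
      obtain V where V: "open V" "S \<subseteq> V" "V - S \<in> lmeasurable" "emeasure lebesgue (V - S) < ennreal (e / ?C)"
        using sets_lebesgue_outer_open[of S "e / ?C", OF _ e'] S by auto
      have [measurable]: "V \<in> sets borel" using V(1) by auto
      have VS: "emeasure lborel (V - S) < ennreal (e / ?C)" using V S by auto
      have "emeasure lborel {u\<in>E. f u \<in> S} \<le> emeasure lborel {u\<in>E. f u \<in> V}"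
        using V(1,2) by (intro emeasure_mono) auto
      also have "\<dots> \<le> ennreal ?C * emeasure lborel V" by (rule opn[OF V(1)])
      also have "emeasure lborel V \<le> emeasure lborel S + emeasure lborel (V - S)"
        using V(1,2) emeasure_subadditive[of S lborel "V - S"] by (simp add: Un_absorb1)
      also have "\<dots> \<le> emeasure lborel S + ennreal (e / ?C)"
        using VS by (intro add_left_mono) auto
      also have "ennreal ?C * (emeasure lborel S + ennreal (e / ?C)) = ennreal ?C * emeasure lborel S + ennreal e"
        using L e by (simp add: distrib_left ennreal_mult[symmetric])
      finally show "emeasure lborel {u\<in>E. f u \<in> S} \<le> ennreal ?C * emeasure lborel S + ennreal e"
        by (auto simp: mult_left_mono)
    qed
  qed
qed

section \<open>The map from the diagonal of a rectangle to a side, at a fixed direction\<close>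

definition rx :: "'a::euclidean_space \<Rightarrow> 'a \<Rightarrow> 'a" where
  "rx s u = (1/2) *\<^sub>R (u + norm u *\<^sub>R s)"

text \<open>\<open>rx s\<close> collapses the ray opposite to \<open>s\<close>, and
  \<open>rx (- s)\<close> the ray along \<open>s\<close>. The symmetric condition stays away from
  both, so that one cone serves both sides of the rectangle.\<close>

definition equator :: "'a::euclidean_space \<Rightarrow> 'a set" where
  "equator s = {u. \<bar>u \<bullet> s\<bar> < norm u / 2}"

text \<open>In the difference of the images only the change \<open>\<delta>\<close> of the norm
  could cancel the change \<open>a - b\<close> along \<open>s\<close>. On the cone the component
  along \<open>s\<close> is less than half the norm, so \<open>\<delta>\<close> contains at most
  half of \<open>\<bar>a - b\<bar>\<close>, besides the orthogonal change, and that half can be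
  absorbed.\<close>

lemma rx_expand:
  fixes s u w :: "'a::euclidean_space"
  assumes s: "norm s = 1" and u: "u \<in> equator s" and w: "w \<in> equator s"
  shows "norm (u - w) \<le> 10 * norm (rx s u - rx s w)"
proof -
  define a where "a = u \<bullet> s"
  define b where "b = w \<bullet> s"
  define p where "p = u - a *\<^sub>R s"
  define q where "q = w - b *\<^sub>R s"
  define \<delta> where "\<delta> = norm u - norm w"
  define A where "A = \<bar>a - b\<bar>"
  define P where "P = norm (p - q)"
  have ss: "s \<bullet> s = 1" using s by (simp add: norm_eq_1)
  have ps: "p \<bullet> s = 0" "q \<bullet> s = 0" by (auto simp: p_def q_def a_def b_def inner_diff_left ss)
  have upq: "u = a *\<^sub>R s + p" "w = b *\<^sub>R s + q" by (auto simp: p_def q_def)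
  have ab: "\<bar>a\<bar> < norm u / 2" "\<bar>b\<bar> < norm w / 2" using u w by (auto simp: equator_def a_def b_def)
  have pu: "norm p \<le> norm u" "norm q \<le> norm w"
  proof -
    have "u \<bullet> u = a\<^sup>2 + p \<bullet> p" "w \<bullet> w = b\<^sup>2 + q \<bullet> q"
      unfolding upq(1) upq(2) inner_add_left inner_add_right inner_scaleR_left inner_scaleR_right
      using ps ss by (simp_all add: inner_commute[of s p] inner_commute[of s q] power2_eq_square del: dot_square_norm)
    then have "(norm u)\<^sup>2 = a\<^sup>2 + (norm p)\<^sup>2" "(norm w)\<^sup>2 = b\<^sup>2 + (norm q)\<^sup>2"
      by (simp_all only: power2_norm_eq_inner)
    then have "(norm p)\<^sup>2 \<le> (norm u)\<^sup>2" and "(norm q)\<^sup>2 \<le> (norm w)\<^sup>2" by simp_all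
    then show "norm p \<le> norm u" "norm q \<le> norm w" by (auto simp only: power_mono_iff norm_ge_zero pos2)
  qed
  have sq: "(norm u)\<^sup>2 - (norm w)\<^sup>2 = (a - b) * (a + b) + (p - q) \<bullet> (p + q)"
  proof -
    have "(norm u)\<^sup>2 = a * a + p \<bullet> p" "(norm w)\<^sup>2 = b * b + q \<bullet> q"
      unfolding power2_norm_eq_inner upq(1) upq(2) inner_add_left inner_add_right inner_scaleR_left inner_scaleR_right
      using ps ss by (simp_all add: inner_commute[of s p] inner_commute[of s q])
    moreover have "(p - q) \<bullet> (p + q) = p \<bullet> p - q \<bullet> q"
      unfolding inner_diff_left inner_add_right inner_commute[of q p] by linarith
    moreover have "(a - b) * (a + b) = a * a - b * b" by (simp add: algebra_simps)
    ultimately show ?thesis by linarith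
  qed
  have npos: "0 < norm u + norm w" using ab by linarith
  have "\<bar>\<delta>\<bar> * (norm u + norm w) = \<bar>(norm u)\<^sup>2 - (norm w)\<^sup>2\<bar>"
    using npos by (simp add: \<delta>_def power2_eq_square square_diff_square_factored abs_mult mult.commute)
  also have "\<dots> \<le> A * \<bar>a + b\<bar> + P * norm (p + q)"
  proof -
    have "\<bar>(a - b) * (a + b) + (p - q) \<bullet> (p + q)\<bar> \<le> \<bar>(a - b) * (a + b)\<bar> + \<bar>(p - q) \<bullet> (p + q)\<bar>"
      by (rule abs_triangle_ineq)
    then show ?thesis
      unfolding sq A_def P_def using Cauchy_Schwarz_ineq2[of "p - q" "p + q"] by (simp only: abs_mult)
  qed
  also have "\<dots> \<le> A * ((norm u + norm w) / 2) + P * (norm u + norm w)"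
  proof (intro add_mono mult_left_mono)
    show "\<bar>a + b\<bar> \<le> (norm u + norm w) / 2" using ab abs_triangle_ineq[of a b] by simp
    show "norm (p + q) \<le> norm u + norm w" using pu norm_triangle_ineq[of p q] by linarith
  qed (auto simp: A_def P_def)
  finally have "\<bar>\<delta>\<bar> * (norm u + norm w) \<le> (A / 2 + P) * (norm u + norm w)" by (simp add: algebra_simps)
  then have \<delta>: "\<bar>\<delta>\<bar> \<le> A / 2 + P" using npos by (rule mult_right_le_imp_le)
  have uw: "u - w = (a - b) *\<^sub>R s + (p - q)"
    unfolding p_def q_def by (simp add: algebra_simps)
  have "2 *\<^sub>R (rx s u - rx s w) = (u - w) + \<delta> *\<^sub>R s"
    unfolding rx_def \<delta>_def by (simp add: algebra_simps)
  then have eq: "2 *\<^sub>R (rx s u - rx s w) = (a - b + \<delta>) *\<^sub>R s + (p - q)"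
    unfolding uw by (simp add: algebra_simps)
  have "(norm (2 *\<^sub>R (rx s u - rx s w)))\<^sup>2 = (a - b + \<delta>)\<^sup>2 + P\<^sup>2"
  proof -
    have 1: "(p - q) \<bullet> s = 0" using ps by (simp add: inner_diff_left)
    then have 2: "s \<bullet> (p - q) = 0" by (simp add: inner_commute)
    show ?thesis
      unfolding eq P_def power2_norm_eq_inner inner_add_left[of "_ *\<^sub>R _"] inner_add_right[of _ "_ *\<^sub>R _"]
        inner_scaleR_left inner_scaleR_right 1 2 ss
      by (simp add: power2_eq_square)
  qed
  then have n2: "4 * (norm (rx s u - rx s w))\<^sup>2 = (a - b + \<delta>)\<^sup>2 + P\<^sup>2" by (simp add: power_mult_distrib)
  have "P\<^sup>2 \<le> (2 * norm (rx s u - rx s w))\<^sup>2" "\<bar>a - b + \<delta>\<bar>\<^sup>2 \<le> (2 * norm (rx s u - rx s w))\<^sup>2"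
    using n2 zero_le_power2[of P] zero_le_power2[of "a - b + \<delta>"] by (simp_all add: power_mult_distrib)
  then have b1: "P \<le> 2 * norm (rx s u - rx s w)" and b2: "\<bar>a - b + \<delta>\<bar> \<le> 2 * norm (rx s u - rx s w)"
    by (meson mult_nonneg_nonneg norm_ge_zero power2_le_imp_le zero_le_numeral)+
  have "norm (u - w) \<le> A + P"
  proof -
    note uw
    then show ?thesis using norm_triangle_ineq[of "(a - b) *\<^sub>R s" "p - q"] s by (simp add: A_def P_def)
  qed
  moreover have "A \<le> \<bar>a - b + \<delta>\<bar> + \<bar>\<delta>\<bar>"
    unfolding A_def using abs_triangle_ineq4[of "a - b + \<delta>" \<delta>] by simp
  \<comment> \<open>With \<open>N\<close> for the norm of the difference of the images,
    \<open>A \<le> 2 * N + A / 2 + P\<close> and \<open>P \<le> 2 * N\<close> give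
    \<open>A \<le> 8 * N\<close>, hence the constant 10.\<close>
  ultimately show ?thesis using b1 b2 \<delta> by linarith
qed

lemma rx_minus: "rx (- s) (- u) = - rx s u"
  by (simp add: rx_def algebra_simps)

lemma rx_add_minus: "rx s u + rx (- s) u = u"
  by (simp add: rx_def algebra_simps flip: scaleR_add_left)

lemma rx_orth:
  assumes "norm s = 1" shows "rx s u \<bullet> rx (- s) u = 0"
proof -
  have "s \<bullet> s = 1" using assms by (simp add: norm_eq_1)
  moreover have "norm u * norm u = u \<bullet> u" by (simp add: power2_norm_eq_inner flip: power2_eq_square)
  ultimately show ?thesis
    unfolding rx_def inner_scaleR_left inner_scaleR_right inner_add_left inner_add_right
      inner_minus_left inner_minus_right scaleR_minus_right inner_commute[of s u]
    by (simp only:) (simp add: algebra_simps)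
qed

lemma norm_rx_le: "norm s = 1 \<Longrightarrow> norm (rx s u) \<le> norm u"
  unfolding rx_def using norm_triangle_ineq[of u "norm u *\<^sub>R s"] by simp

lemma continuous_rx [continuous_intros]:
  "continuous_on A (\<lambda>p. f p) \<Longrightarrow> continuous_on A (\<lambda>p. g p) \<Longrightarrow> continuous_on A (\<lambda>p. rx (f p) (g p))"
  unfolding rx_def by (intro continuous_intros)

lemma borel_measurable_rx [measurable]:
  assumes [measurable]: "f \<in> borel_measurable M" "g \<in> borel_measurable M"
  shows "(\<lambda>p. rx (f p) (g p)) \<in> borel_measurable M"
  unfolding rx_def by measurable

lemma open_equator: "open (equator s)"
  unfolding equator_def by (intro open_Collect_less continuous_intros) auto

lemma borel_equator [measurable]: "equator s \<in> sets borel"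
  by (rule borel_open[OF open_equator])

lemma equator_minus [simp]: "equator (- s) = equator s"
  by (simp add: equator_def)

lemma uminus_in_equator [simp]: "- u \<in> equator s \<longleftrightarrow> u \<in> equator s"
  by (simp add: equator_def)

lemma scaleR_in_equator: "0 < c \<Longrightarrow> c *\<^sub>R u \<in> equator s \<longleftrightarrow> u \<in> equator s"
  by (simp add: equator_def abs_mult)

lemma exists_orthogonal_unit:
  fixes s :: "'a::euclidean_space"
  assumes "2 \<le> DIM('a)"
  obtains e where "norm e = 1" "e \<bullet> s = 0"
proof -
  obtain x where "x \<noteq> 0" "orthogonal s x"
    using orthogonal_to_vector_exists[OF assms] by blast
  then show ?thesis
    by (intro that[of "x /\<^sub>R norm x"]) (auto simp: orthogonal_def inner_commute)
qed

definition equator_vol :: "'a::euclidean_space \<Rightarrow> real" where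
  "equator_vol s = measure lborel (equator s \<inter> ball 0 1)"

lemma emeasure_equator_ball:
  fixes s :: "'a::euclidean_space"
  assumes r: "0 < r"
  shows "emeasure lborel (equator s \<inter> ball 0 r) = ennreal (equator_vol s * r ^ DIM('a))"
proof -
  have "equator s \<inter> ball 0 r = (\<lambda>x. 0 + r *\<^sub>R x) ` (equator s \<inter> ball 0 1)"
  proof (intro equalityI subsetI)
    fix x assume "x \<in> equator s \<inter> ball 0 r"
    then have "x = 0 + r *\<^sub>R (x /\<^sub>R r)" "x /\<^sub>R r \<in> equator s \<inter> ball 0 1"
      using r scaleR_in_equator[of "inverse r" x s] by (auto simp: divide_simps)
    then show "x \<in> (\<lambda>x. 0 + r *\<^sub>R x) ` (equator s \<inter> ball 0 1)" by blast
  qed (use r in \<open>auto simp: scaleR_in_equator mult_less_cancel_left1\<close>)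
  moreover have fin: "emeasure lborel (equator s \<inter> ball 0 1) \<noteq> \<infinity>"
    using emeasure_mono[of "equator s \<inter> ball 0 1" "ball 0 1" lborel] emeasure_lborel_ball_finite[of "0::'a" 1]
    by (auto simp: top_unique)
  moreover have "equator s \<inter> ball 0 r \<in> sets borel" by measurable
  moreover have "equator s \<inter> ball 0 1 \<in> sets borel" by measurable
  ultimately show ?thesis
    using r emeasure_lebesgue_affine[of r "0::'a" "equator s \<inter> ball 0 1"]
    by (simp add: equator_vol_def emeasure_eq_ennreal_measure ennreal_mult[symmetric] mult.commute)
qed

lemma equator_vol_pos:
  fixes s :: "'a::euclidean_space"
  assumes "2 \<le> DIM('a)"
  shows "0 < equator_vol s"
proof -
  obtain e where e: "norm e = 1" "e \<bullet> s = 0" using exists_orthogonal_unit[OF assms] .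
  have "(1/2) *\<^sub>R e \<in> equator s \<inter> ball 0 1" using e by (simp add: equator_def)
  then have "equator s \<inter> ball 0 1 \<noteq> {}" by blast
  moreover have "open (equator s \<inter> ball 0 1)" using open_equator by blast
  ultimately have "\<not> negligible (equator s \<inter> ball 0 1)" using open_not_negligible by blast
  then have "emeasure lborel (equator s \<inter> ball 0 1) \<noteq> 0"
    by (auto simp: negligible_iff_null_sets null_sets_def)
  then have "equator_vol s \<noteq> 0"
    using emeasure_equator_ball[of 1 s] by (intro notI) simp
  then show ?thesis by (simp add: equator_vol_def zero_less_measure_iff)
qed

lemma rx_vimage_measure_le:
  fixes s :: "'a::euclidean_space"
  assumes s: "norm s = 1" and S[measurable]: "S \<in> sets borel"
  shows "emeasure lborel {u\<in>equator s. c + rx s u \<in> S} \<le> ennreal (20 ^ DIM('a)) * emeasure lborel S"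
  using expanding_vimage_measure_le[of "\<lambda>u. c + rx s u" "equator s" S 10] rx_expand[OF s] S by simp

text \<open>The number 20 is twice the expansion constant 10 of \<open>rx_expand\<close>. Each of
  three vertices spoils a set of diagonals of measure at most \<open>20 ^ DIM('a)\<close> times that
  of the bad set; dividing by 4 leaves a quarter of the cone.\<close>

definition good_density :: "'a::euclidean_space \<Rightarrow> real" where
  "good_density s = equator_vol s / (4 * 20 ^ DIM('a))"

text \<open>For each of the three vertices, the diagonals \<open>u\<close> that send it into
  \<open>S\<close> form a set controlled by the measure of \<open>S\<close>; the three sets together
  cannot fill the cone. Nothing is assumed of \<open>c\<close> itself, and so knowledge about most
  points reaches a given point.\<close>

lemma good_rectangles:
  fixes s :: "'a::euclidean_space"
  assumes dim: "2 \<le> DIM('a)" and s: "norm s = 1" and r: "0 < r" and S[measurable]: "S \<in> sets borel"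
    and small: "emeasure lborel (S \<inter> ball c r) < ennreal (good_density s * r ^ DIM('a))"
  shows "0 < emeasure lborel {u\<in>equator s \<inter> ball 0 r. c + rx s u \<notin> S \<and> c + rx (- s) u \<notin> S \<and> c + u \<notin> S}"
proof (rule ccontr)
  let ?E = "equator s \<inter> ball 0 r" and ?S = "S \<inter> ball c r" and ?K = "20 ^ DIM('a) :: real"
  let ?A = "{u\<in>equator s. c + rx s u \<in> ?S}" and ?B = "{u\<in>equator (- s). c + rx (- s) u \<in> ?S}"
    and ?C = "{u. c + u \<in> ?S}" and ?D = "{u\<in>?E. c + rx s u \<notin> S \<and> c + rx (- s) u \<notin> S \<and> c + u \<notin> S}"
  assume "\<not> 0 < emeasure lborel ?D"
  then have D: "emeasure lborel ?D = 0" by simp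
  have S'[measurable]: "?S \<in> sets borel" by measurable
  have [measurable]: "?A \<in> sets borel" "?B \<in> sets borel" "?C \<in> sets borel" "?D \<in> sets borel"
    by measurable
  have inb: "c + rx s u \<in> ball c r" "c + rx (- s) u \<in> ball c r" "c + u \<in> ball c r" if "u \<in> ?E" for u
    using that norm_rx_le[OF s, of u] norm_rx_le[of "- s" u] s by (auto simp: dist_norm)
  have "?E \<subseteq> (?A \<union> ?B) \<union> (?C \<union> ?D)" using inb by auto
  then have "emeasure lborel ?E \<le> emeasure lborel ((?A \<union> ?B) \<union> (?C \<union> ?D))"
    by (intro emeasure_mono) auto
  also have "\<dots> \<le> (emeasure lborel ?A + emeasure lborel ?B) + (emeasure lborel ?C + emeasure lborel ?D)"
    by (intro order_trans[OF emeasure_subadditive] add_mono emeasure_subadditive) auto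
  also have "\<dots> \<le> (ennreal ?K * emeasure lborel ?S + ennreal ?K * emeasure lborel ?S)
      + (emeasure lborel ?S + 0)"
  proof (intro add_mono)
    show "emeasure lborel ?A \<le> ennreal ?K * emeasure lborel ?S" by (rule rx_vimage_measure_le[OF s S'])
    show "emeasure lborel ?B \<le> ennreal ?K * emeasure lborel ?S" by (rule rx_vimage_measure_le[OF _ S']) (simp add: s)
    have "emeasure lborel ?C = emeasure (distr lborel borel ((+) c)) ?S"
      using S' by (subst emeasure_distr) (auto simp: vimage_def)
    then show "emeasure lborel ?C \<le> emeasure lborel ?S" by (simp add: lborel_distr_plus)
  qed (use D in simp)
  also have "\<dots> \<le> ennreal (3 * ?K) * emeasure lborel ?S"
  proof -
    have "emeasure lborel ?S \<le> ennreal ?K * emeasure lborel ?S"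
      using mult_right_mono[of 1 "ennreal ?K" "emeasure lborel ?S"] by (simp add: ennreal_ge_1)
    then have "(ennreal ?K * emeasure lborel ?S + ennreal ?K * emeasure lborel ?S) + (emeasure lborel ?S + 0)
        \<le> (ennreal ?K * emeasure lborel ?S + ennreal ?K * emeasure lborel ?S) + (ennreal ?K * emeasure lborel ?S)"
      by (intro add_left_mono) simp
    also have "\<dots> = (ennreal ?K + ennreal ?K + ennreal ?K) * emeasure lborel ?S"
      by (simp only: distrib_right)
    also have "ennreal ?K + ennreal ?K + ennreal ?K = ennreal (3 * ?K)"
      by (simp flip: ennreal_plus)
    finally show ?thesis .
  qed
  also have "\<dots> \<le> ennreal (3 * ?K) * ennreal (good_density s * r ^ DIM('a))"
    using small by (intro mult_left_mono) auto
  also have "\<dots> = ennreal (3 / 4 * equator_vol s * r ^ DIM('a))"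
    using equator_vol_pos[OF dim, of s] r by (simp add: good_density_def ennreal_mult[symmetric])
  also have "\<dots> < ennreal (equator_vol s * r ^ DIM('a))"
    using equator_vol_pos[OF dim, of s] r by (intro ennreal_lessI) auto
  finally show False using emeasure_equator_ball[OF r, of s] by simp
qed

section \<open>Density points and stability under translation\<close>

lemma exists_ball_of_large_density:
  fixes S N :: "'a::euclidean_space set"
  assumes S[measurable]: "S \<in> sets borel" and N: "open N" and pos: "0 < emeasure lborel (S \<inter> N)" and e: "0 < e"
  obtains c r where "0 < r" "ball c r \<subseteq> N" "emeasure lborel (ball c r - S) < ennreal (e * r ^ DIM('a))"
proof -
  let ?f = "indicator (- S) :: 'a \<Rightarrow> real"
  have lm: "cbox a b \<inter> (- S) \<in> lmeasurable" for a b :: 'a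
    by (rule bounded_set_imp_lmeasurable) (auto simp: bounded_Int)
  have int: "?f integrable_on cbox a b" and
    val: "integral (cbox a b) ?f = measure lebesgue (cbox a b \<inter> (- S))" for a b
  proof -
    have *: "(\<lambda>x. if x \<in> cbox a b then ?f x else 0) = indicator (cbox a b \<inter> - S)"
      by (auto simp: indicator_def)
    have "(?f has_integral measure lebesgue (cbox a b \<inter> (- S))) (cbox a b)"
      using lm[of a b] unfolding has_integral_restrict_UNIV[of "cbox a b" ?f, symmetric] *
      by (simp only: lmeasurable_iff_has_integral)
    then show "?f integrable_on cbox a b" "integral (cbox a b) ?f = measure lebesgue (cbox a b \<inter> (- S))"
      by (auto simp: integral_unique)
  qed
  \<comment> \<open>Lebesgue differentiation along cubes with a corner at \<open>x\<close>: outside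
    \<open>Z\<close>, the points of \<open>S\<close> are density points of \<open>S\<close>.\<close>
  obtain Z where Z: "negligible Z"
    "\<And>x e. \<lbrakk>x \<notin> Z; 0 < e\<rbrakk> \<Longrightarrow> \<exists>d>0. \<forall>h. 0 < h \<and> h < d \<longrightarrow>
        norm (integral (cbox x (x + h *\<^sub>R One)) ?f /\<^sub>R h ^ DIM('a) - ?f x) < e"
    using integrable_ccontinuous_explicit[OF int] by blast
  have "\<not> S \<inter> N \<subseteq> Z"
  proof
    assume "S \<inter> N \<subseteq> Z"
    then have "negligible (S \<inter> N)" using Z(1) negligible_subset by blast
    moreover have "S \<inter> N \<in> sets borel" using N by measurable
    ultimately show False using pos by (auto simp: negligible_iff_null_sets null_sets_def)
  qed
  then obtain x where x: "x \<in> S" "x \<in> N" "x \<notin> Z" by blast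
  define e' where "e' = e / 2 ^ DIM('a)"
  have "0 < e'" using e by (simp add: e'_def)
  then obtain d where d: "0 < d" "\<And>h. 0 < h \<Longrightarrow> h < d \<Longrightarrow>
      norm (integral (cbox x (x + h *\<^sub>R One)) ?f /\<^sub>R h ^ DIM('a) - ?f x) < e'"
    using Z(2)[OF x(3)] by blast
  obtain \<epsilon> where \<epsilon>: "0 < \<epsilon>" "ball x \<epsilon> \<subseteq> N" using N x(2) open_contains_ball by blast
  define h where "h = min (d / 2) (\<epsilon> / (norm (One::'a) + 2))"
  have On: "0 < norm (One::'a) + 2" by (intro add_nonneg_pos) auto
  have h: "0 < h" "h < d" using d(1) \<epsilon>(1) On by (auto simp: h_def)
  have "h \<le> \<epsilon> / (norm (One::'a) + 2)" by (simp add: h_def)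
  then have hh: "h * (norm (One::'a) + 2) \<le> \<epsilon>" using pos_le_divide_eq[OF On] by blast
  define c where "c = x + (h/2) *\<^sub>R One"
  have sub: "ball c (h/2) \<subseteq> cbox x (x + h *\<^sub>R One)"
  proof
    fix y assume "y \<in> ball c (h/2)"
    then have "norm (y - c) < h/2" by (simp add: dist_norm norm_minus_commute)
    then have *: "\<bar>(y - c) \<bullet> i\<bar> < h/2" if "i \<in> Basis" for i using Basis_le_norm[OF that, of "y - c"] by linarith
    show "y \<in> cbox x (x + h *\<^sub>R One)"
      unfolding mem_box
    proof
      fix i :: 'a assume i: "i \<in> Basis"
      then show "x \<bullet> i \<le> y \<bullet> i \<and> y \<bullet> i \<le> (x + h *\<^sub>R One) \<bullet> i"
        using *[OF i] i unfolding abs_less_iff c_def inner_diff_left inner_add_left inner_scaleR_left by auto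
    qed
  qed
  have subN: "ball c (h/2) \<subseteq> N"
  proof
    fix y assume "y \<in> ball c (h/2)"
    moreover have "dist x c = h / 2 * norm (One::'a)" using h by (simp add: c_def dist_norm)
    ultimately have "dist x y < h / 2 * norm (One::'a) + h / 2" using dist_triangle[of x y c] by simp
    also have "\<dots> \<le> h * (norm (One::'a) + 2)"
    proof -
      have "0 \<le> h * norm (One::'a)" using h by simp
      moreover have "h / 2 * norm (One::'a) = (h * norm (One::'a)) / 2" by simp
      ultimately show ?thesis unfolding distrib_left using h by linarith
    qed
    finally show "y \<in> N" using hh \<epsilon>(2) by auto
  qed
  have "measure lebesgue (cbox x (x + h *\<^sub>R One) \<inter> - S) / h ^ DIM('a) < e'"
    using d(2)[OF h] x(1) h(1) by (simp add: val divide_inverse mult.commute)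
  then have m: "measure lebesgue (cbox x (x + h *\<^sub>R One) \<inter> - S) < e * (h/2) ^ DIM('a)"
    using h(1) by (simp add: e'_def field_simps power_divide)
  have "emeasure lborel (ball c (h/2) - S) \<le> emeasure lborel (cbox x (x + h *\<^sub>R One) \<inter> - S)"
    using sub by (intro emeasure_mono) auto
  also have "\<dots> = ennreal (measure lebesgue (cbox x (x + h *\<^sub>R One) \<inter> - S))"
    using emeasure_eq_measure2[OF lm[of x "x + h *\<^sub>R One"]] by simp
  also have "\<dots> < ennreal (e * (h/2) ^ DIM('a))"
    using m e h(1) by (intro ennreal_lessI) auto
  finally show thesis using that[of "h/2" c] h(1) subN by simp
qed

text \<open>Regularity squeezes \<open>S\<close> between a compact \<open>T\<close> and an open
  \<open>V\<close>. A shift by less than the distance from \<open>T\<close> to the complement of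
  \<open>V\<close> keeps \<open>T\<close> inside \<open>V\<close>, so only points of
  \<open>S - T\<close> or points moved into \<open>V - S\<close> can leave \<open>S\<close>.\<close>

lemma translation_continuous_measure:
  fixes S :: "'a::euclidean_space set"
  assumes S[measurable]: "S \<in> sets borel" and bS: "bounded S" and e: "0 < e"
  obtains d where "0 < d" "\<And>t. norm t < d \<Longrightarrow> emeasure lborel {x\<in>S. x + t \<notin> S} < ennreal e"
proof -
  have e2: "0 < e / 2" using e by simp
  have SL: "S \<in> sets lebesgue" by simp
  obtain V where V: "open V" "S \<subseteq> V" "V - S \<in> lmeasurable" "emeasure lebesgue (V - S) < ennreal (e/2)"
    using sets_lebesgue_outer_open[OF SL e2] .
  obtain T where T: "closed T" "T \<subseteq> S" "S - T \<in> lmeasurable" "emeasure lebesgue (S - T) < ennreal (e/2)"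
    using sets_lebesgue_inner_closed[OF SL e2] .
  have [measurable]: "V \<in> sets borel" "T \<in> sets borel" using V(1) T(1) by auto
  have cT: "compact T" using T bS bounded_subset compact_eq_bounded_closed by blast
  obtain d where d: "0 < d" "\<And>x t. x \<in> T \<Longrightarrow> norm t < d \<Longrightarrow> x + t \<in> V"
  proof -
    have cl: "closed (- V)" using V(1) by auto
    have dis: "T \<inter> - V = {}" using T V by auto
    obtain d where "0 < d" "\<forall>x\<in>T. \<forall>y\<in>- V. d \<le> dist x y"
      using separate_compact_closed[OF cT cl dis] by blast
    then show ?thesis by (intro that[of d]) (force simp: dist_norm)+
  qed
  show thesis
  proof (rule that[OF d(1)])
    fix t :: 'a assume t: "norm t < d"
    have meas[measurable]: "{x. x + t \<in> V - S} \<in> sets borel" by measurable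
    have "{x\<in>S. x + t \<notin> S} \<subseteq> (S - T) \<union> {x. x + t \<in> V - S}" using d(2)[OF _ t] by blast
    then have "emeasure lborel {x\<in>S. x + t \<notin> S} \<le> emeasure lborel ((S - T) \<union> {x. x + t \<in> V - S})"
      by (intro emeasure_mono) auto
    also have "\<dots> \<le> emeasure lborel (S - T) + emeasure lborel {x. x + t \<in> V - S}"
      by (intro emeasure_subadditive) auto
    also have "emeasure lborel {x. x + t \<in> V - S} = emeasure (distr lborel borel ((+) t)) (V - S)"
      by (subst emeasure_distr) (auto simp: vimage_def add.commute)
    also have "\<dots> = emeasure lborel (V - S)" by (simp add: lborel_distr_plus)
    also have "emeasure lborel (S - T) + emeasure lborel (V - S) < ennreal (e/2) + ennreal (e/2)"
      using V(4) T(4) by (intro add_strict_mono) auto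
    also have "\<dots> = ennreal e" using e by (simp flip: ennreal_plus)
    finally show "emeasure lborel {x\<in>S. x + t \<notin> S} < ennreal e" .
  qed
qed

text \<open>Moving the base vertex from \<open>a\<close> to \<open>b\<close> with \<open>u\<close>
  fixed shifts the other three vertices by the same vector \<open>b - a\<close>. The points lost by
  such a shift are few, and by \<open>rx_vimage_measure_le\<close> so are the diagonals leading to
  them.\<close>

lemma rectangles_open:
  fixes s :: "'a::euclidean_space"
  assumes s: "norm s = 1" and S[measurable]: "S1 \<in> sets borel" "S2 \<in> sets borel" "S3 \<in> sets borel"
    and pos: "0 < emeasure lborel {u\<in>equator s \<inter> ball 0 r. a + rx s u \<in> S1 \<and> a + rx (- s) u \<in> S2 \<and> a + u \<in> S3}"
  obtains d where "0 < d" "\<And>b. dist a b < d \<Longrightarrow>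
    0 < emeasure lborel {u\<in>equator s \<inter> ball 0 r. b + rx s u \<in> S1 \<and> b + rx (- s) u \<in> S2 \<and> b + u \<in> S3}"
proof -
  let ?K = "20 ^ DIM('a) :: real"
  define J where "J b = {u\<in>equator s \<inter> ball 0 r. b + rx s u \<in> S1 \<and> b + rx (- s) u \<in> S2 \<and> b + u \<in> S3}" for b
  have J[measurable]: "J b \<in> sets borel" for b unfolding J_def by measurable
  define m where "m = measure lborel (J a)"
  have "emeasure lborel (J a) \<le> emeasure lborel (ball (0::'a) r)"
    by (intro emeasure_mono) (auto simp: J_def)
  then have fin: "emeasure lborel (J a) \<noteq> \<infinity>"
    using emeasure_lborel_ball_finite[of "0::'a" r] by (auto simp: top_unique)
  have em: "emeasure lborel (J a) = ennreal m" unfolding m_def by (rule emeasure_eq_ennreal_measure) (use fin in simp)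
  have m: "0 < m" using pos em by (simp add: J_def)
  \<comment> \<open>Each vertex loses at most \<open>?K * e\<close>, the three together three
    quarters of \<open>m\<close>.\<close>
  define e where "e = m / (4 * ?K)"
  have e: "0 < e" using m by (simp add: e_def)
  define B where "B S = S \<inter> ball a (r + 1)" for S :: "'a set"
  have B[measurable]: "B S \<in> sets borel" if "S \<in> sets borel" for S using that unfolding B_def by measurable
  have bB: "bounded (B S)" for S unfolding B_def by (simp add: bounded_Int)
  obtain d1 where d1: "0 < d1" "\<And>t. norm t < d1 \<Longrightarrow> emeasure lborel {x\<in>B S1. x + t \<notin> B S1} < ennreal e"
    using translation_continuous_measure[OF B[OF S(1)] bB e] by blast
  obtain d2 where d2: "0 < d2" "\<And>t. norm t < d2 \<Longrightarrow> emeasure lborel {x\<in>B S2. x + t \<notin> B S2} < ennreal e"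
    using translation_continuous_measure[OF B[OF S(2)] bB e] by blast
  obtain d3 where d3: "0 < d3" "\<And>t. norm t < d3 \<Longrightarrow> emeasure lborel {x\<in>B S3. x + t \<notin> B S3} < ennreal e"
    using translation_continuous_measure[OF B[OF S(3)] bB e] by blast
  show thesis
  proof (rule that[of "min d1 (min d2 d3)"])
    fix b assume ab: "dist a b < min d1 (min d2 d3)"
    define t where "t = b - a"
    have t: "norm t < d1" "norm t < d2" "norm t < d3" using ab by (auto simp: t_def dist_norm norm_minus_commute)
    have bt: "b + v = (a + v) + t" for v by (simp add: t_def)
    define D where "D S = {x\<in>B S. x + t \<notin> B S}" for S
    have D[measurable]: "D S \<in> sets borel" if "S \<in> sets borel" for S
    proof -
      have [measurable]: "B S \<in> sets borel" using that by (rule B)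
      show ?thesis unfolding D_def by measurable
    qed
    note [measurable] = D[OF S(1)] D[OF S(2)] D[OF S(3)]
    let ?X = "{u\<in>equator s. a + rx s u \<in> D S1}" and ?Y = "{u\<in>equator (- s). a + rx (- s) u \<in> D S2}"
      and ?Z = "{u. a + u \<in> D S3}"
    have [measurable]: "?X \<in> sets borel" "?Y \<in> sets borel" "?Z \<in> sets borel" by measurable
    have inb: "a + rx s u \<in> ball a (r + 1)" "a + rx (- s) u \<in> ball a (r + 1)" "a + u \<in> ball a (r + 1)"
      if "u \<in> ball 0 r" for u
      using that norm_rx_le[OF s, of u] norm_rx_le[of "- s" u] s by (auto simp: dist_norm)
    have "J a \<subseteq> (?X \<union> ?Y) \<union> (?Z \<union> J b)"
    proof
      fix u assume u: "u \<in> J a"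
      then have *: "u \<in> equator s" "u \<in> ball 0 r" "a + rx s u \<in> S1" "a + rx (- s) u \<in> S2" "a + u \<in> S3"
        by (auto simp: J_def)
      then have **: "a + rx s u \<in> B S1" "a + rx (- s) u \<in> B S2" "a + u \<in> B S3"
        using inb[OF *(2)] by (auto simp: B_def)
      show "u \<in> (?X \<union> ?Y) \<union> (?Z \<union> J b)"
      proof (rule ccontr)
        assume "u \<notin> (?X \<union> ?Y) \<union> (?Z \<union> J b)"
        then have "a + rx s u + t \<in> B S1" "a + rx (- s) u + t \<in> B S2" "a + u + t \<in> B S3" "u \<notin> J b"
          using * ** by (auto simp: D_def)
        then show False using * by (auto simp: J_def bt B_def)
      qed
    qed
    then have "emeasure lborel (J a) \<le> emeasure lborel ((?X \<union> ?Y) \<union> (?Z \<union> J b))"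
      by (intro emeasure_mono) auto
    also have "\<dots> \<le> (emeasure lborel ?X + emeasure lborel ?Y) + (emeasure lborel ?Z + emeasure lborel (J b))"
      by (intro order_trans[OF emeasure_subadditive] add_mono emeasure_subadditive) auto
    also have "\<dots> \<le> (ennreal (?K * e) + ennreal (?K * e)) + (ennreal (?K * e) + emeasure lborel (J b))"
    proof -
      have Ke: "ennreal ?K * ennreal e = ennreal (?K * e)" using e by (simp add: ennreal_mult)
      have "emeasure lborel ?X \<le> ennreal ?K * emeasure lborel (D S1)"
        by (rule rx_vimage_measure_le[OF s D[OF S(1)]])
      also have "\<dots> \<le> ennreal ?K * ennreal e" using d1(2)[OF t(1)] by (intro mult_left_mono) (auto simp: D_def)
      finally have X: "emeasure lborel ?X \<le> ennreal (?K * e)" unfolding Ke .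
      have "emeasure lborel ?Y \<le> ennreal ?K * emeasure lborel (D S2)"
        by (rule rx_vimage_measure_le[OF _ D[OF S(2)]]) (simp add: s)
      also have "\<dots> \<le> ennreal ?K * ennreal e" using d2(2)[OF t(2)] by (intro mult_left_mono) (auto simp: D_def)
      finally have Y: "emeasure lborel ?Y \<le> ennreal (?K * e)" unfolding Ke .
      have "emeasure lborel ?Z = emeasure (distr lborel borel ((+) a)) (D S3)"
        by (subst emeasure_distr) (auto simp: vimage_def)
      also have "\<dots> \<le> ennreal e" using d3(2)[OF t(3)] by (simp add: lborel_distr_plus D_def)
      also have "\<dots> \<le> ennreal (?K * e)" using e by (intro ennreal_leI) simp
      finally show ?thesis using X Y by (intro add_mono) auto
    qed
    finally have le: "ennreal m \<le> ennreal (3 * (?K * e)) + emeasure lborel (J b)"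
      using e unfolding em by (simp add: add.assoc[symmetric] mult.commute flip: ennreal_plus)
    have "3 * (?K * e) = 3/4 * m" by (simp add: e_def)
    then have "3 * (?K * e) < m" using m by linarith
    then have "ennreal (3 * (?K * e)) < ennreal m" by (rule ennreal_lessI[OF m])
    then have "emeasure lborel (J b) \<noteq> 0" using le by (metis add.right_neutral leD)
    then show "0 < emeasure lborel {u\<in>equator s \<inter> ball 0 r. b + rx s u \<in> S1 \<and> b + rx (- s) u \<in> S2 \<and> b + u \<in> S3}"
      by (simp add: J_def zero_less_iff_neq_zero)
  qed (use d1(1) d2(1) d3(1) in simp)
qed

subsection \<open>Sets without rectangles of mixed type are balls\<close>

lemma inner_projection_residual:
  fixes b z :: "'a::real_inner"
  shows "z \<bullet> (b - ((b \<bullet> z) / (z \<bullet> z)) *\<^sub>R z) = 0"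
  by (cases "z = 0") (auto simp: inner_diff_right inner_commute)

text \<open>\<open>U\<close> and \<open>W\<close> play the roles of the essential interiors of the sets \<open>f = 1\<close> and \<open>f = 0\<close>.\<close>

locale rectangle_dichotomy =
  fixes U W :: "'a::euclidean_space set"
  assumes dim: "2 \<le> DIM('a)"
    and closure_U: "closure U = - W"
    and closure_W: "closure W = - U"
    and no_rectangle: "\<And>a x y. x \<bullet> y = 0 \<Longrightarrow> a \<in> W \<Longrightarrow> a + x \<in> U \<Longrightarrow> a + y \<in> U \<Longrightarrow> a + x + y \<notin> W"
begin

lemma open_U: "open U" and open_W: "open W"
  using closed_closure[of W] closed_closure[of U] unfolding closure_U closure_W by (simp_all add: closed_def)

lemma disjoint: "x \<in> U \<Longrightarrow> x \<notin> W"
  using closure_subset[of U] closure_U by auto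

text \<open>Of the four vertices, \<open>p\<close> and \<open>q\<close> lie only in the closures of
  \<open>U\<close> and \<open>W\<close>, and are approximated from inside. The new side
  \<open>y n\<close> is \<open>d - q\<close> made orthogonal to the moved side
  \<open>P n - Q n\<close>, so these are exact rectangles. The other two vertices tend to
  \<open>d\<close> and to \<open>p + d - q\<close>, and openness keeps them in place.\<close>

lemma fourth_vertex:
  assumes p: "p \<notin> W" and d: "d \<in> U" and q: "q \<notin> U" and orth: "(p - q) \<bullet> (d - q) = 0"
  shows "p + d - q \<notin> W"
proof
  assume v: "p + d - q \<in> W"
  have pq: "p \<noteq> q" using v d disjoint by auto
  have "p \<in> closure U" "q \<in> closure W" using p q closure_U closure_W by auto
  then obtain P Q where P: "\<And>n. P n \<in> U" "P \<longlonglongrightarrow> p" and Q: "\<And>n. Q n \<in> W" "Q \<longlonglongrightarrow> q"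
    unfolding closure_sequential by blast
  define y where "y n = (d - q) - (((d - q) \<bullet> (P n - Q n)) / ((P n - Q n) \<bullet> (P n - Q n))) *\<^sub>R (P n - Q n)" for n
  have "y \<longlonglongrightarrow> (d - q) - (((d - q) \<bullet> (p - q)) / ((p - q) \<bullet> (p - q))) *\<^sub>R (p - q)"
    unfolding y_def using P(2) Q(2) pq by (intro tendsto_intros) auto
  then have y: "y \<longlonglongrightarrow> d - q" using orth by (simp add: inner_commute)
  have "(\<lambda>n. Q n + y n) \<longlonglongrightarrow> d" "(\<lambda>n. P n + y n) \<longlonglongrightarrow> p + d - q"
    using tendsto_add[OF Q(2) y] tendsto_add[OF P(2) y] by (simp_all add: add_diff_eq)
  then have "eventually (\<lambda>n. Q n + y n \<in> U) sequentially" "eventually (\<lambda>n. P n + y n \<in> W) sequentially"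
    using open_U open_W d v by (auto elim: topological_tendstoD)
  then obtain n where n: "Q n + y n \<in> U" "P n + y n \<in> W"
    using eventually_happens'[OF sequentially_bot eventually_conj] by blast
  have "(P n - Q n) \<bullet> y n = 0" unfolding y_def by (rule inner_projection_residual)
  from no_rectangle[OF this Q(1)[of n]] show False using P(1)[of n] n by (simp add: add.commute)
qed

text \<open>Here both ends of the diagonal from \<open>p\<close> to \<open>d\<close> are
  approximated from \<open>U\<close>. The right angle at \<open>q\<close> means that
  \<open>q\<close> is on the sphere with this diameter; the factor \<open>k n\<close> rescales
  \<open>q - m\<close> so that it ends on the sphere with the approximating diameter.\<close>

lemma diameter_dichotomy:
  assumes p: "p \<notin> W" and d: "d \<notin> W" and orth: "(p - q) \<bullet> (d - q) = 0" and q: "q \<in> W"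
  shows "p + d - q \<notin> W"
proof
  define m where "m = (1/2) *\<^sub>R (p + d)"
  assume v: "p + d - q \<in> W"
  have "p \<in> closure U" "d \<in> closure U" using p d closure_U by auto
  then obtain P D where P: "\<And>n. P n \<in> U" "P \<longlonglongrightarrow> p" and D: "\<And>n. D n \<in> U" "D \<longlonglongrightarrow> d"
    unfolding closure_sequential by blast
  have pd: "p \<noteq> d" using orth p q by auto
  define M where "M n = (1/2) *\<^sub>R (P n + D n)" for n
  define k where "k n = norm (P n - D n) / norm (p - d)" for n
  have k: "k \<longlonglongrightarrow> norm (p - d) / norm (p - d)" unfolding k_def using P(2) D(2) pd by (intro tendsto_intros) auto
  have M: "M \<longlonglongrightarrow> m" unfolding M_def m_def using P(2) D(2) by (intro tendsto_intros)
  have k1: "k \<longlonglongrightarrow> 1" using k pd by simp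
  have "(\<lambda>n. M n + k n *\<^sub>R (q - m)) \<longlonglongrightarrow> m + 1 *\<^sub>R (q - m)" "(\<lambda>n. M n - k n *\<^sub>R (q - m)) \<longlonglongrightarrow> m - 1 *\<^sub>R (q - m)"
    by (rule tendsto_add[OF M tendsto_scaleR[OF k1 tendsto_const]])
      (rule tendsto_diff[OF M tendsto_scaleR[OF k1 tendsto_const]])
  moreover have "m + 1 *\<^sub>R (q - m) = q" by simp
  moreover have "m - 1 *\<^sub>R (q - m) = p + d - q"
  proof -
    have "m - 1 *\<^sub>R (q - m) = 2 *\<^sub>R m - q" by (simp add: scaleR_2)
    then show ?thesis by (simp add: m_def)
  qed
  ultimately have "(\<lambda>n. M n + k n *\<^sub>R (q - m)) \<longlonglongrightarrow> q" "(\<lambda>n. M n - k n *\<^sub>R (q - m)) \<longlonglongrightarrow> p + d - q"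
    by (simp_all only:)
  from topological_tendstoD[OF this(1) open_W q] topological_tendstoD[OF this(2) open_W v]
  have "eventually (\<lambda>n. M n + k n *\<^sub>R (q - m) \<in> W) sequentially"
    "eventually (\<lambda>n. M n - k n *\<^sub>R (q - m) \<in> W) sequentially"
    by auto
  then obtain n where n: "M n + k n *\<^sub>R (q - m) \<in> W" "M n - k n *\<^sub>R (q - m) \<in> W"
    using eventually_happens'[OF sequentially_bot eventually_conj] by blast
  define b where "b = k n *\<^sub>R (q - m)"
  define a where "a = (1/2) *\<^sub>R (P n - D n)"
  have PD: "P n = M n + a" "D n = M n - a"
    by (auto simp: M_def a_def algebra_simps simp flip: scaleR_add_left)
  define h where "h = (1/2) *\<^sub>R (p - d)"
  have ph: "p = m + h" "d = m - h"
    by (auto simp: m_def h_def algebra_simps simp flip: scaleR_add_left)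
  have "(p - q) \<bullet> (d - q) = (q - m) \<bullet> (q - m) - h \<bullet> h"
    unfolding ph inner_diff_left inner_diff_right inner_add_left inner_add_right
    by (simp only: inner_commute[of h m] inner_commute[of q m] inner_commute[of q h])
  then have "(q - m) \<bullet> (q - m) = h \<bullet> h" using orth by linarith
  then have "norm (q - m) = norm h" by (simp only: norm_eq)
  then have qm: "norm (q - m) = norm (p - d) / 2" by (simp add: h_def)
  have "norm b = norm a" using pd by (simp add: b_def a_def k_def qm)
  then have "a \<bullet> a = b \<bullet> b" by (simp only: norm_eq)
  then have "(a - b) \<bullet> (- a - b) = 0"
    unfolding inner_diff_left inner_diff_right inner_minus_left inner_minus_right inner_commute[of a b] by linarith
  from no_rectangle[OF this, of "M n + b"] show False
    using n P(1)[of n] D(1)[of n] by (simp add: PD b_def[symmetric])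
qed

end

section \<open>Contact points with the smallest enclosing sphere\<close>

locale enclosed_dichotomy = rectangle_dichotomy +
  fixes R :: real
  assumes R: "0 < R"
    and enclosed: "closure U \<subseteq> cball 0 R"
    and centred: "0 \<in> convex hull (closure U \<inter> sphere 0 R)"
begin

text \<open>The contact points. Assumption \<open>centred\<close> is the optimality condition of the
  smallest enclosing ball: the contact points do not all lie in one open half space with the centre
  on its boundary.\<close>

definition T where "T = closure U \<inter> sphere 0 R"

lemma T_iff: "x \<in> T \<longleftrightarrow> x \<notin> W \<and> norm x = R"
  by (auto simp: T_def closure_U)

lemma norm_le: "x \<notin> W \<Longrightarrow> norm x \<le> R"
  using enclosed closure_U by auto

lemma norm_less: "x \<in> U \<Longrightarrow> norm x < R"
proof -
  assume x: "x \<in> U"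
  have "U \<subseteq> cball 0 R" using enclosed closure_subset by blast
  then have "U \<subseteq> interior (cball 0 R)" using open_U by (rule interior_maximal)
  then show ?thesis using x by (auto simp: interior_cball)
qed

lemma T_notin_U: "x \<in> T \<Longrightarrow> x \<notin> U"
  using norm_less T_iff by auto

lemma closed_T: "closed T" and compact_T: "compact T"
  unfolding T_def by (auto intro: closed_Int compact_Int_closed closed_Int_compact)

text \<open>Opposite vertices have equal sums of squared norms. So the vertex opposite to
  \<open>D\<close> has squared norm \<open>R\<^sup>2 + (norm V)\<^sup>2 - (norm D)\<^sup>2\<close>,
  which exceeds \<open>R\<^sup>2\<close>. If \<open>D\<close> were outside \<open>U\<close>,
  \<open>fourth_vertex\<close> would keep that vertex in the enclosing ball.\<close>

lemma lower_energy_vertex: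
  assumes A: "A \<in> T" and V: "V \<in> U" and orth: "(D - A) \<bullet> (D - V) = 0" and less: "norm D < norm V"
  shows "D \<in> U"
proof (rule ccontr)
  assume D: "D \<notin> U"
  have "(A - D) \<bullet> (V - D) = 0" using orth unfolding inner_diff_left inner_diff_right inner_commute[of D A] inner_commute[of V D] by linarith
  then have "A + V - D \<notin> W" using fourth_vertex[of A V D] A V D T_iff by blast
  then have le: "norm (A + V - D) \<le> R" by (rule norm_le)
  have "(A + V - D) \<bullet> (A + V - D) = A \<bullet> A + V \<bullet> V - D \<bullet> D + 2 * ((D - A) \<bullet> (D - V))"
    unfolding inner_diff_left inner_diff_right inner_add_left inner_add_right inner_commute[of D A] inner_commute[of D V]
      inner_commute[of V A] by (simp add: algebra_simps)
  then have "(norm (A + V - D))\<^sup>2 = R\<^sup>2 + (norm V)\<^sup>2 - (norm D)\<^sup>2"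
    using A orth by (simp add: T_iff power2_norm_eq_inner[symmetric])
  moreover have "(norm D)\<^sup>2 < (norm V)\<^sup>2" using less by (intro power_strict_mono) auto
  ultimately have "R\<^sup>2 < (norm (A + V - D))\<^sup>2" by simp
  then show False using le R by (meson leD norm_ge_zero power_mono)
qed

text \<open>The hyperplane is orthogonal to \<open>A\<close> and passes through
  \<open>(- s) *\<^sub>R A\<close>. A point of \<open>U\<close> on it spans a rectangle with this
  point and \<open>A\<close>, whose fourth vertex is \<open>A\<close> plus a vector orthogonal to
  \<open>A\<close> and so sticks out of the enclosing ball.\<close>

lemma missed_hyperplane:
  assumes A: "A \<in> T" and s: "(- s) *\<^sub>R A \<notin> U" and u: "u \<in> U"
  shows "u \<bullet> A \<noteq> - s * R\<^sup>2"
proof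
  assume eq: "u \<bullet> A = - s * R\<^sup>2"
  have AA: "A \<bullet> A = R\<^sup>2" using A by (simp add: T_iff power2_norm_eq_inner[symmetric])
  let ?D = "(- s) *\<^sub>R A"
  have orth: "A \<bullet> (u - ?D) = 0" using eq AA by (simp add: inner_diff_right inner_add_right inner_commute[of A u])
  have "(A - ?D) \<bullet> (u - ?D) = (1 + s) * (A \<bullet> (u - ?D))"
    by (simp add: inner_add_left algebra_simps)
  then have "(A - ?D) \<bullet> (u - ?D) = 0" using orth by simp
  then have "A + u - ?D \<notin> W" using fourth_vertex[of A u ?D] A u s T_iff by blast
  then have le: "norm (A + (u - ?D)) \<le> R" using norm_le[of "A + u - ?D"] by (simp add: add.assoc)
  have "(norm (A + (u - ?D)))\<^sup>2 = R\<^sup>2 + (norm (u - ?D))\<^sup>2"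
    unfolding power2_norm_eq_inner inner_add_left inner_add_right inner_commute[of "u - ?D" A] orth AA by linarith
  moreover have "(norm (A + (u - ?D)))\<^sup>2 \<le> R\<^sup>2" using le by (intro power_mono) auto
  ultimately have "norm (u - ?D) = 0" by simp
  then have "u = ?D" by (simp only: norm_eq_zero right_minus_eq)
  then show False using u s by simp
qed

text \<open>\<open>D l\<close> is the foot of the perpendicular from \<open>V\<close> to the line
  through \<open>A\<close> in direction \<open>w l\<close>, hence a point of the circle with
  diameter from \<open>A\<close> to \<open>V\<close>. As \<open>l\<close> goes from 0 to 1 it runs
  from \<open>V\<close> to the foot on the line in direction \<open>A + V\<close>. In between its
  norm is less than that of \<open>V\<close>, so \<open>lower_energy_vertex\<close> applies.\<close>

lemma inner_arc_meets:
  fixes A V :: 'a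
  assumes A: "A \<in> T" and V: "V \<in> U" and indep: "(A \<bullet> V)\<^sup>2 < (A \<bullet> A) * (V \<bullet> V)"
    and hi: "\<tau> < V \<bullet> B" and lo: "(A + (((V - A) \<bullet> (A + V)) / ((A + V) \<bullet> (A + V))) *\<^sub>R (A + V)) \<bullet> B < \<tau>"
  obtains D where "D \<in> U" "D \<bullet> B = \<tau>"
proof -
  define a where "a = V - A"
  define s where "s = A + V"
  define w where "w l = (1 - l) *\<^sub>R a - l *\<^sub>R s" for l
  define D where "D l = A + ((a \<bullet> w l) / (w l \<bullet> w l)) *\<^sub>R w l" for l
  have gram: "(a \<bullet> s)\<^sup>2 < (a \<bullet> a) * (s \<bullet> s)"
  proof -
    have "(a \<bullet> a) * (s \<bullet> s) - (a \<bullet> s)\<^sup>2 = 4 * ((A \<bullet> A) * (V \<bullet> V) - (A \<bullet> V)\<^sup>2)"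
      unfolding a_def s_def inner_diff_left inner_diff_right inner_add_left inner_add_right inner_commute[of V A]
      by (simp add: power2_eq_square algebra_simps)
    then show ?thesis using indep by simp
  qed
  have w0: "w l \<noteq> 0" for l
  proof
    assume "w l = 0"
    then have eq: "(1 - l) *\<^sub>R a = l *\<^sub>R s" by (simp add: w_def)
    show False
    proof (cases "l = 0")
      case True then show ?thesis using eq gram by simp
    next
      case False
      then have "s = ((1 - l) / l) *\<^sub>R a" using arg_cong[OF eq, of "\<lambda>v. (1/l) *\<^sub>R v"] by simp
      then show ?thesis using gram by (simp add: power2_eq_square mult_ac)
    qed
  qed
  have cont: "continuous_on {0..1} (\<lambda>l. - (D l \<bullet> B))"
    unfolding D_def using w0 unfolding w_def by (intro continuous_intros) auto
  have w01: "w 0 = a" "w 1 = - s" by (auto simp: w_def)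
  have a0: "a \<bullet> a \<noteq> 0" using gram by auto
  have D0: "D 0 = V" using a0 by (simp add: D_def w01) (simp add: a_def)
  have D1: "D 1 = A + ((a \<bullet> s) / (s \<bullet> s)) *\<^sub>R s" by (simp add: D_def w01)
  have "\<exists>l. 0 \<le> l \<and> l \<le> 1 \<and> - (D l \<bullet> B) = - \<tau>"
    by (rule IVT'[OF _ _ _ cont]) (use hi lo in \<open>auto simp: D0 D1 a_def s_def\<close>)
  then obtain l where l: "0 \<le> l" "l \<le> 1" "D l \<bullet> B = \<tau>" by auto
  have "l \<noteq> 0" using l(3) hi D0 by auto
  moreover have "l \<noteq> 1" using l(3) lo D1 by (auto simp: a_def s_def)
  ultimately have l': "0 < l" "l < 1" using l by auto
  define t where "t = (a \<bullet> w l) / (w l \<bullet> w l)"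
  have tw: "t * (w l \<bullet> w l) = a \<bullet> w l" using w0[of l] by (simp add: t_def)
  have DA: "D l - A = t *\<^sub>R w l" and DV: "D l - V = t *\<^sub>R w l - a" by (auto simp: D_def t_def a_def)
  have orth: "(D l - A) \<bullet> (D l - V) = 0"
    unfolding DA DV using tw by (simp add: inner_diff_right inner_commute[of "w l" a])
  have "D l \<bullet> D l - V \<bullet> V = (D l - V) \<bullet> s + (D l - A) \<bullet> (D l - V)"
    unfolding s_def inner_diff_left inner_diff_right inner_add_right inner_commute[of A "D l"] inner_commute[of V "D l"]
      inner_commute[of V A] by linarith
  then have e: "D l \<bullet> D l - V \<bullet> V = t * (w l \<bullet> s) - a \<bullet> s"
    unfolding orth unfolding DV inner_diff_left inner_scaleR_left by linarith
  \<comment> \<open>The sign is that of minus the Gram determinant of \<open>a\<close> and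
    \<open>s\<close>, which is positive because \<open>A\<close> and \<open>V\<close> are linearly
    independent.\<close>
  have "(D l \<bullet> D l - V \<bullet> V) * (w l \<bullet> w l) = (t * (w l \<bullet> w l)) * (w l \<bullet> s) - (a \<bullet> s) * (w l \<bullet> w l)"
    unfolding e by (simp add: algebra_simps)
  also have "\<dots> = - (l * (1 - l) * ((a \<bullet> a) * (s \<bullet> s) - (a \<bullet> s)\<^sup>2))"
    unfolding tw unfolding w_def inner_diff_left inner_diff_right inner_scaleR_left inner_scaleR_right inner_commute[of s a]
    by (simp add: power2_eq_square algebra_simps)
  also have "\<dots> < 0" using l' gram by simp
  finally have "(D l \<bullet> D l - V \<bullet> V) * (w l \<bullet> w l) < 0 * (w l \<bullet> w l)" by simp
  moreover have "0 < w l \<bullet> w l" using w0[of l] by simp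
  ultimately have "D l \<bullet> D l - V \<bullet> V < 0" by (simp only: mult_less_cancel_right_pos)
  then have "D l \<bullet> D l < V \<bullet> V" by simp
  then have "norm (D l) < norm V" by (simp add: norm_lt)
  then show thesis using lower_energy_vertex[OF A V orth] l(3) that by blast
qed

text \<open>Let \<open>V\<close> in \<open>U\<close> tend to \<open>A2\<close>. Since
  \<open>A1\<close> and \<open>A2\<close> have equal norms, their sum and difference are orthogonal,
  so the arc of \<open>inner_arc_meets\<close> ends closer and closer to \<open>A1\<close>. It
  therefore crosses every level of the product with \<open>A2\<close> strictly between
  \<open>A1 \<bullet> A2\<close> and \<open>R\<^sup>2\<close>, while
  \<open>missed_hyperplane\<close> would forbid a level whose axis point is outside
  \<open>U\<close>.\<close>

lemma axis_segment:
  assumes A1: "A1 \<in> T" and A2: "A2 \<in> T" and ne: "A1 \<noteq> A2" "A1 \<noteq> - A2"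
    and \<tau>: "A1 \<bullet> A2 < \<tau>" "\<tau> < R\<^sup>2"
  shows "(\<tau> / R\<^sup>2) *\<^sub>R A2 \<in> U"
proof (rule ccontr)
  assume "(\<tau> / R\<^sup>2) *\<^sub>R A2 \<notin> U"
  then have miss: "u \<bullet> A2 \<noteq> \<tau>" if "u \<in> U" for u
    using missed_hyperplane[OF A2, of "- (\<tau> / R\<^sup>2)" u] that R by simp
  have AA: "A1 \<bullet> A1 = R\<^sup>2" "A2 \<bullet> A2 = R\<^sup>2" using A1 A2 by (auto simp: T_iff power2_norm_eq_inner[symmetric])
  have ne': "A1 + A2 \<noteq> 0" using ne(2) eq_neg_iff_add_eq_0 by blast
  have indep: "(A1 \<bullet> A2)\<^sup>2 < (A1 \<bullet> A1) * (A2 \<bullet> A2)"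
  proof -
    have "0 < (A1 - A2) \<bullet> (A1 - A2)" "0 < (A1 + A2) \<bullet> (A1 + A2)" using ne(1) ne' by auto
    then have "A1 \<bullet> A2 < R\<^sup>2" "- (A1 \<bullet> A2) < R\<^sup>2"
      unfolding inner_diff_left inner_diff_right inner_add_left inner_add_right AA inner_commute[of A2 A1] by linarith+
    then have "\<bar>A1 \<bullet> A2\<bar> < R\<^sup>2" by simp
    then have "\<bar>A1 \<bullet> A2\<bar>\<^sup>2 < (R\<^sup>2)\<^sup>2" by (intro power_strict_mono) auto
    then show ?thesis using AA by (simp add: power2_eq_square)
  qed
  have "A2 \<in> closure U" using A2 by (simp add: T_def)
  then obtain V where V: "\<And>n. V n \<in> U" "V \<longlonglongrightarrow> A2" unfolding closure_sequential by blast
  have nz: "(A1 + A2) \<bullet> (A1 + A2) \<noteq> 0" using ne' by simp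
  have l1: "(\<lambda>n. (A1 \<bullet> A1) * (V n \<bullet> V n) - (A1 \<bullet> V n)\<^sup>2) \<longlonglongrightarrow> (A1 \<bullet> A1) * (A2 \<bullet> A2) - (A1 \<bullet> A2)\<^sup>2"
    using V(2) by (intro tendsto_intros)
  have l2: "(\<lambda>n. V n \<bullet> A2) \<longlonglongrightarrow> A2 \<bullet> A2" using V(2) by (intro tendsto_intros)
  have "(\<lambda>n. (A1 + (((V n - A1) \<bullet> (A1 + V n)) / ((A1 + V n) \<bullet> (A1 + V n))) *\<^sub>R (A1 + V n)) \<bullet> A2)
      \<longlonglongrightarrow> (A1 + (((A2 - A1) \<bullet> (A1 + A2)) / ((A1 + A2) \<bullet> (A1 + A2))) *\<^sub>R (A1 + A2)) \<bullet> A2"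
    using V(2) nz by (intro tendsto_intros)
  moreover have "(A2 - A1) \<bullet> (A1 + A2) = 0" unfolding inner_diff_left inner_add_right AA inner_commute[of A2 A1] by simp
  ultimately have l3: "(\<lambda>n. (A1 + (((V n - A1) \<bullet> (A1 + V n)) / ((A1 + V n) \<bullet> (A1 + V n))) *\<^sub>R (A1 + V n)) \<bullet> A2) \<longlonglongrightarrow> A1 \<bullet> A2"
    by simp
  have "eventually (\<lambda>n. 0 < (A1 \<bullet> A1) * (V n \<bullet> V n) - (A1 \<bullet> V n)\<^sup>2) sequentially"
    using order_tendstoD(1)[OF l1, of 0] indep by simp
  moreover have "eventually (\<lambda>n. \<tau> < V n \<bullet> A2) sequentially" using order_tendstoD(1)[OF l2] \<tau> AA by simp
  moreover have "eventually (\<lambda>n. (A1 + (((V n - A1) \<bullet> (A1 + V n)) / ((A1 + V n) \<bullet> (A1 + V n))) *\<^sub>R (A1 + V n)) \<bullet> A2 < \<tau>) sequentially"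
    by (rule order_tendstoD(2)[OF l3 \<tau>(1)])
  ultimately have "eventually (\<lambda>n. 0 < (A1 \<bullet> A1) * (V n \<bullet> V n) - (A1 \<bullet> V n)\<^sup>2 \<and> \<tau> < V n \<bullet> A2 \<and>
     (A1 + (((V n - A1) \<bullet> (A1 + V n)) / ((A1 + V n) \<bullet> (A1 + V n))) *\<^sub>R (A1 + V n)) \<bullet> A2 < \<tau>) sequentially"
    by eventually_elim auto
  then obtain n where n: "0 < (A1 \<bullet> A1) * (V n \<bullet> V n) - (A1 \<bullet> V n)\<^sup>2" "\<tau> < V n \<bullet> A2"
     "(A1 + (((V n - A1) \<bullet> (A1 + V n)) / ((A1 + V n) \<bullet> (A1 + V n))) *\<^sub>R (A1 + V n)) \<bullet> A2 < \<tau>"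
    using eventually_happens'[OF sequentially_bot] by blast
  obtain D where "D \<in> U" "D \<bullet> A2 = \<tau>"
    by (rule inner_arc_meets[OF A1 V(1)[of n] _ n(2) n(3)]) (use n(1) in auto)
  then show False using miss by blast
qed

text \<open>\<open>A\<close>, \<open>X\<close>, \<open>- A\<close> and \<open>- X\<close> are the
  vertices of a rectangle. With the diagonal from \<open>A\<close> to \<open>- A\<close> outside
  \<open>W\<close>, the points \<open>X\<close> and \<open>- X\<close> cannot both be in
  \<open>W\<close>.\<close>

lemma T_antipodal:
  assumes A: "A \<in> T" "- A \<in> T" and X: "norm X = R" "X \<notin> T"
  shows "- X \<in> T"
proof -
  have "(A - X) \<bullet> (- A - X) = (norm X)\<^sup>2 - (norm A)\<^sup>2"
    by (simp add: power2_norm_eq_inner inner_diff_left inner_diff_right inner_commute del: dot_square_norm)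
  then have "(A - X) \<bullet> (- A - X) = 0" using A X T_iff by simp
  then show ?thesis using diameter_dichotomy[of A "- A" X] A X T_iff by auto
qed

text \<open>Let \<open>d\<close> be the largest parameter in \<open>[-1, 1]\<close> with
  \<open>d *\<^sub>R X\<close> outside \<open>W\<close>. Farther out towards \<open>X\<close> the
  axis lies in \<open>W\<close>, so \<open>missed_hyperplane\<close>, applied to the contact point
  \<open>- X\<close>, keeps \<open>U\<close> off the orthogonal hyperplanes there.\<close>

lemma supporting_level:
  assumes X: "norm X = R" "X \<notin> T" "- X \<in> T"
  obtains d where "d < 1" "d *\<^sub>R X \<notin> W" "\<And>u. u \<notin> W \<Longrightarrow> u \<bullet> X \<le> d * R\<^sup>2"
proof -
  define K where "K = {-1..1} \<inter> {t. t *\<^sub>R X \<in> closure U}"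
  have "closed {t. t *\<^sub>R X \<in> closure U}"
    using continuous_closed_vimage[of "closure U" "\<lambda>t. t *\<^sub>R X"] by (simp add: vimage_def)
  then have cK: "compact K" unfolding K_def by (intro compact_Int_closed) auto
  have neK: "-1 \<in> K" using X closure_U T_iff by (auto simp: K_def)
  obtain d where d: "d \<in> K" "\<And>t. t \<in> K \<Longrightarrow> t \<le> d" using compact_attains_sup[OF cK] neK by blast
  have dW: "d *\<^sub>R X \<notin> W" using d(1) closure_U by (auto simp: K_def)
  have "d \<noteq> 1"
  proof
    assume "d = 1"
    then have "X \<notin> W" using dW by simp
    then show False using X(1,2) T_iff by blast
  qed
  then have d1: "d < 1" using d(1) by (auto simp: K_def)
  have le: "u \<bullet> X \<le> d * R\<^sup>2" if u: "u \<in> U" for u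
  proof (rule ccontr)
    assume "\<not> u \<bullet> X \<le> d * R\<^sup>2"
    then have gt: "d * R\<^sup>2 < u \<bullet> X" by simp
    define t where "t = u \<bullet> X / R\<^sup>2"
    have tR: "u \<bullet> X = t * R\<^sup>2" using R by (simp add: t_def)
    have "u \<bullet> X \<le> norm u * norm X" by (rule norm_cauchy_schwarz)
    also have "\<dots> < R\<^sup>2" using norm_less[OF u] X(1) R by (simp add: power2_eq_square)
    finally have "t < 1" using R by (simp add: t_def)
    moreover have dt: "d < t" using gt R by (simp add: t_def field_simps)
    moreover have "-1 \<le> d" using d(1) by (simp add: K_def)
    ultimately have "t *\<^sub>R X \<notin> closure U" using d(2)[of t] by (auto simp: K_def)
    then have "t *\<^sub>R X \<in> W" using closure_U by auto
    then have "(- t) *\<^sub>R (- X) \<notin> U" using disjoint by auto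
    from missed_hyperplane[OF X(3) this u] show False using tR by simp
  qed
  have "closed {u. u \<bullet> X \<le> d * R\<^sup>2}" by (intro closed_Collect_le continuous_intros)
  then have "closure U \<subseteq> {u. u \<bullet> X \<le> d * R\<^sup>2}" using le by (intro closure_minimal) auto
  then show thesis using that[OF d1 dW] closure_U by blast
qed

text \<open>For \<open>X\<close> on the sphere outside \<open>T\<close>, let \<open>d X\<close> be the level of \<open>supporting_level\<close>. It varies by at most
  a multiple of the squared distance, hence hardly along a fine chain of such points, yet it tends to \<open>1\<close> at \<open>T\<close>.\<close>

lemma T_eq_sphere:
  assumes A: "A \<in> T" "- A \<in> T"
  shows "T = sphere 0 R"
proof (rule ccontr)
  assume "T \<noteq> sphere 0 R"
  moreover have "T \<subseteq> sphere 0 R" by (auto simp: T_def)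
  ultimately obtain X0 where "X0 \<in> sphere 0 R" and X0T: "X0 \<notin> T" by blast
  then have X0: "norm X0 = R" "X0 \<notin> T" by auto
  have ne: "X0 \<noteq> A" "X0 \<noteq> - A" using A X0 by auto
  have AA: "A \<bullet> A = R\<^sup>2" "X0 \<bullet> X0 = R\<^sup>2" using A X0 by (auto simp: T_iff power2_norm_eq_inner[symmetric])
  define c where "c = (A \<bullet> X0) / R\<^sup>2"
  have cR: "A \<bullet> X0 = c * R\<^sup>2" using R by (simp add: c_def)
  have R2: "0 < R\<^sup>2" using R by simp
  have c: "\<bar>c\<bar> < 1"
  proof -
    have "A + X0 \<noteq> 0" using ne(2) by (metis add.commute eq_neg_iff_add_eq_0)
    then have "0 < (A - X0) \<bullet> (A - X0)" "0 < (A + X0) \<bullet> (A + X0)" using ne by auto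
    then have "c * R\<^sup>2 < 1 * R\<^sup>2" "- c * R\<^sup>2 < 1 * R\<^sup>2"
      unfolding inner_diff_left inner_diff_right inner_add_left inner_add_right AA inner_commute[of X0 A] cR by linarith+
    then have "c < 1" "- c < 1" unfolding mult_less_cancel_right_pos[OF R2] by auto
    then show ?thesis by simp
  qed
  define \<theta> where "\<theta> = arccos c"
  have cos\<theta>: "cos \<theta> = c" and \<theta>0: "0 < \<theta>" and \<theta>pi: "\<theta> \<le> pi"
    using c arccos_lt_bounded[of c] unfolding \<theta>_def by (simp_all add: cos_arccos_abs abs_less_iff)
  define s where "s = sqrt (1 - c\<^sup>2)"
  have c2: "c\<^sup>2 < 1" using c by (simp add: abs_square_less_1)
  have s: "0 < s" "s\<^sup>2 = 1 - c\<^sup>2" using c2 by (auto simp: s_def)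
  have sin\<theta>: "sin \<theta> = s" using c by (simp add: \<theta>_def s_def sin_arccos_abs)
  define E where "E = (1 / s) *\<^sub>R (A - c *\<^sub>R X0)"
  have EX: "E \<bullet> X0 = 0" using AA cR by (simp add: E_def inner_diff_left)
  have EE: "E \<bullet> E = R\<^sup>2"
  proof -
    have "(A - c *\<^sub>R X0) \<bullet> (A - c *\<^sub>R X0) = R\<^sup>2 * (1 - c\<^sup>2)"
      unfolding inner_diff_left inner_diff_right inner_scaleR_left inner_scaleR_right inner_commute[of X0 A] AA cR
      by (simp add: power2_eq_square right_diff_distrib)
    moreover have "E \<bullet> E = ((A - c *\<^sub>R X0) \<bullet> (A - c *\<^sub>R X0)) / s\<^sup>2"
      unfolding E_def inner_scaleR_left inner_scaleR_right by (simp add: power2_eq_square)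
    ultimately show ?thesis using s c2 by simp
  qed
  \<comment> \<open>A great circle from \<open>X0\<close> at parameter 0 to \<open>A\<close> at
    \<open>\<theta>\<close>. Below, \<open>m\<close> is the first parameter at which it meets
    \<open>T\<close>.\<close>
  define g where "g x = cos x *\<^sub>R X0 + sin x *\<^sub>R E" for x
  have gg: "g x \<bullet> g y = R\<^sup>2 * cos (x - y)" for x y
    unfolding g_def inner_add_left inner_add_right inner_scaleR_left inner_scaleR_right AA EE EX inner_commute[of X0 E] cos_diff
    by (simp add: algebra_simps)
  have ng: "norm (g x) = R" for x
    unfolding norm_eq_sqrt_inner gg using R by simp
  have g0: "g 0 = X0" by (simp add: g_def)
  have g\<theta>: "g \<theta> = A" using s by (simp add: g_def cos\<theta> sin\<theta> E_def)
  define K where "K = {0..\<theta>} \<inter> {x. g x \<in> T}"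
  have "closed {x. g x \<in> T}"
  proof -
    have "continuous_on UNIV g" unfolding g_def by (intro continuous_intros)
    then show ?thesis using closed_vimage[OF closed_T] by (simp add: vimage_def)
  qed
  then have cK: "compact K" unfolding K_def by (intro compact_Int_closed) auto
  have "\<theta> \<in> K" using g\<theta> A \<theta>0 by (auto simp: K_def)
  then obtain m where m: "m \<in> K" "\<And>t. t \<in> K \<Longrightarrow> m \<le> t" using compact_attains_inf[OF cK] by blast
  have "m \<noteq> 0" using m(1) X0 g0 by (auto simp: K_def)
  then have m0: "0 < m" using m(1) by (auto simp: K_def)
  have nT: "g x \<notin> T" if "0 \<le> x" "x < m" for x using m(2)[of x] m(1) that by (auto simp: K_def)
  have "\<exists>d<1. d *\<^sub>R g x \<notin> W \<and> (\<forall>u. u \<notin> W \<longrightarrow> u \<bullet> g x \<le> d * R\<^sup>2)" if "0 \<le> x" "x < m" for x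
    using supporting_level[OF ng nT[OF that] T_antipodal[OF A ng nT[OF that]]] by metis
  then obtain d where d: "\<And>x. 0 \<le> x \<Longrightarrow> x < m \<Longrightarrow> d x < 1 \<and> d x *\<^sub>R g x \<notin> W \<and> (\<forall>u. u \<notin> W \<longrightarrow> u \<bullet> g x \<le> d x * R\<^sup>2)"
    by metis
  have step: "d y * cos (x - y) \<le> d x" if "0 \<le> x" "x < m" "0 \<le> y" "y < m" for x y
  proof -
    have "(d y *\<^sub>R g y) \<bullet> g x \<le> d x * R\<^sup>2" using d[of x] d[of y] that by blast
    then have "(d y * cos (x - y)) * R\<^sup>2 \<le> d x * R\<^sup>2" using gg[of y x] cos_minus[of "x - y"] by (simp add: mult_ac)
    then show ?thesis unfolding mult_le_cancel_right_pos[OF R2] .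
  qed
  have last: "cos (m - x) \<le> d x" if "0 \<le> x" "x < m" for x
  proof -
    have "g m \<notin> W" using m(1) T_iff by (auto simp: K_def)
    then have "g m \<bullet> g x \<le> d x * R\<^sup>2" using d[OF that] by blast
    then have "cos (m - x) * R\<^sup>2 \<le> d x * R\<^sup>2" using gg[of m x] by (simp add: mult_ac)
    then show ?thesis unfolding mult_le_cancel_right_pos[OF R2] .
  qed
  have cosb: "1 - h\<^sup>2 / 2 \<le> cos h" for h :: real
  proof -
    have "cos h = 1 - 2 * (sin (h/2))\<^sup>2" using cos_double_sin[of "h/2"] by simp
    moreover have "(sin (h/2))\<^sup>2 \<le> (h/2)\<^sup>2" using abs_sin_x_le_abs_x[of "h/2"] abs_le_square_iff by blast
    moreover have "2 * (h/2)\<^sup>2 = h\<^sup>2 / 2" by (simp add: power2_eq_square)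
    ultimately show ?thesis by linarith
  qed
  have low: "1 - m\<^sup>2 / (2 * real N) \<le> d 0" if N: "0 < N" for N :: nat
  proof -
    define h where "h = m / real N"
    have h0: "0 < h" using m0 N by (simp add: h_def)
    have Nh: "real N * h = m" using N by (simp add: h_def)
    \<comment> \<open>The induction runs backwards from the last point of the chain before
      \<open>m\<close>, where the contact point \<open>g m\<close> itself gives a level of at least
      \<open>cos h\<close>. There are \<open>N\<close> losses of at most
      \<open>h\<^sup>2 / 2\<close> each, in all \<open>m\<^sup>2 / (2 * real N)\<close>.\<close>
    have ind: "1 - real (k + 1) * (h\<^sup>2 / 2) \<le> d (real (N - 1 - k) * h)" if "k \<le> N - 1" for k
      using that
    proof (induction k)
      case 0
      have lt: "real (N - 1) * h < m" unfolding Nh[symmetric] using h0 N by (intro mult_strict_right_mono) auto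
      have "m - real (N - 1) * h = h" unfolding Nh[symmetric] using N by (simp add: of_nat_diff algebra_simps)
      then show ?case using last[of "real (N - 1) * h"] lt cosb[of h] h0 by simp
    next
      case (Suc k)
      define x where "x = real (N - 1 - Suc k) * h"
      define y where "y = real (N - 1 - k) * h"
      have "N - 1 - k = Suc (N - 1 - Suc k)" using Suc.prems by simp
      then have xy: "x - y = - h" by (simp add: x_def y_def algebra_simps)
      have "real (N - 1 - Suc k) < real N" "real (N - 1 - k) < real N" using N by auto
      then have lt: "x < m" "y < m" unfolding Nh[symmetric] x_def y_def using h0 by (auto intro!: mult_strict_right_mono)
      have ge: "0 \<le> x" "0 \<le> y" using h0 by (auto simp: x_def y_def)
      have "d y * cos h \<le> d x" using step[OF ge(1) lt(1) ge(2) lt(2)] xy by simp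
      moreover have "d y - (1 - cos h) \<le> d y * cos h"
      proof -
        have "0 \<le> (1 - d y) * (1 - cos h)" using d[OF ge(2) lt(2)] by (intro mult_nonneg_nonneg) auto
        then show ?thesis by (simp add: algebra_simps)
      qed
      moreover have "1 - real (k + 1) * (h\<^sup>2 / 2) \<le> d y" using Suc by (simp add: y_def)
      moreover have "real (Suc k + 1) * (h\<^sup>2 / 2) = real (k + 1) * (h\<^sup>2 / 2) + h\<^sup>2 / 2"
        by (simp add: algebra_simps)
      ultimately have "1 - real (Suc k + 1) * (h\<^sup>2 / 2) \<le> d x" using cosb[of h] by linarith
      then show ?case unfolding x_def .
    qed
    have "real N * (h\<^sup>2 / 2) = m\<^sup>2 / (2 * real N)" using N by (simp add: h_def power2_eq_square)
    then show ?thesis using ind[of "N - 1"] N by simp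
  qed
  have "d 0 < 1" using d[of 0] m0 by simp
  then obtain N :: nat where N: "m\<^sup>2 / (1 - d 0) < real N" using reals_Archimedean2 by blast
  have "0 \<le> m\<^sup>2 / (1 - d 0)" using \<open>d 0 < 1\<close> by simp
  then have N0: "0 < real N" using N by linarith
  have "m\<^sup>2 < real N * (1 - d 0)" using N \<open>d 0 < 1\<close> by (simp add: field_simps)
  moreover have "(1 - d 0) * (2 * real N) \<le> m\<^sup>2" using low[of N] N0 by (simp add: field_simps)
  moreover have "0 \<le> real N * (1 - d 0)" using N0 \<open>d 0 < 1\<close> by simp
  ultimately show False by (simp add: algebra_simps)
qed

text \<open>If an inner point \<open>D'\<close> were in \<open>W\<close>, then
  \<open>missed_hyperplane\<close>, used with the contact point in the direction of
  \<open>- D'\<close>, would keep \<open>U\<close> off the hyperplanes orthogonal to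
  \<open>D'\<close> through all nearby points of the axis. But the one through \<open>D'\<close>
  meets the sphere in a contact point \<open>X\<close>, and there are points of \<open>U\<close>
  arbitrarily close to \<open>X\<close>.\<close>

lemma closure_eq_cball:
  assumes T: "T = sphere 0 R"
  shows "closure U = cball 0 R"
proof -
  have ball: "D \<notin> W" if D: "norm D < R" for D
  proof
    assume "D \<in> W"
    then obtain e where e: "0 < e" "ball D e \<subseteq> W" using open_W open_contains_ball by blast
    \<comment> \<open>The axis needs a nonzero point; as \<open>W\<close> is open, the origin can be
      replaced by a neighbour.\<close>
    obtain D' where D': "D' \<in> W" "norm D' < R" "D' \<noteq> 0"
    proof (cases "D = 0")
      case True
      obtain b :: 'a where b: "b \<in> Basis" by (meson ex_in_conv nonempty_Basis)
      define k where "k = min (e/2) (R/2)"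
      have k: "0 < k" "k < e" "k < R" using e R by (auto simp: k_def)
      have "k *\<^sub>R b \<in> W" using e(2) k True b by (auto simp: dist_norm)
      then show ?thesis using that[of "k *\<^sub>R b"] k b by (auto simp: nonzero_Basis)
    qed (use D \<open>D \<in> W\<close> that in blast)
    have DD: "0 < D' \<bullet> D'" using D'(3) by simp
    obtain x where x: "x \<noteq> 0" "orthogonal D' x" using orthogonal_to_vector_exists[OF dim] by blast
    define X where "X = D' + (sqrt (R\<^sup>2 - (norm D')\<^sup>2) / norm x) *\<^sub>R x"
    have Dx: "D' \<bullet> x = 0" using x by (simp add: orthogonal_def)
    have "(norm D')\<^sup>2 < R\<^sup>2" using D'(2) by (intro power_strict_mono) auto
    then have "(norm X)\<^sup>2 = R\<^sup>2"
      unfolding X_def power2_norm_eq_inner inner_add_left inner_add_right inner_scaleR_left inner_scaleR_right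
        inner_commute[of x D'] Dx
      using x(1) by (simp add: power2_norm_eq_inner[symmetric] power2_eq_square)
    then have "norm X = R" using R by simp
    then have XT: "X \<in> T" using T by simp
    have XD: "X \<bullet> D' = D' \<bullet> D'" using Dx by (simp add: X_def inner_add_left inner_commute[of x D'])
    let ?S = "{u. ((u \<bullet> D') / (D' \<bullet> D')) *\<^sub>R D' \<in> W}"
    have "open ?S"
    proof -
      have "continuous_on UNIV (\<lambda>u. ((u \<bullet> D') / (D' \<bullet> D')) *\<^sub>R D')" using DD by (intro continuous_intros) auto
      then show ?thesis using open_vimage[OF open_W] by (simp add: vimage_def)
    qed
    moreover have "X \<in> ?S" unfolding mem_Collect_eq XD using DD D'(1) by (simp del: dot_square_norm)
    moreover have "X \<in> closure U" using XT by (simp add: T_def)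
    ultimately obtain u where u: "u \<in> U" "u \<in> ?S"
      by (metis (no_types, lifting) Int_iff closure_iff_nhds_not_empty disjoint_iff order_refl)
    define \<mu> where "\<mu> = (u \<bullet> D') / (D' \<bullet> D')"
    define A where "A = (- (R / norm D')) *\<^sub>R D'"
    have "norm A = R" using D'(3) R by (simp add: A_def)
    then have "A \<in> T" using T by simp
    moreover have "- (\<mu> * norm D' / R) *\<^sub>R A = \<mu> *\<^sub>R D'" using D'(3) R by (simp add: A_def)
    then have "- (\<mu> * norm D' / R) *\<^sub>R A \<notin> U" using u(2) disjoint by (auto simp: \<mu>_def)
    ultimately have "u \<bullet> A \<noteq> - (\<mu> * norm D' / R) * R\<^sup>2" using u(1) by (rule missed_hyperplane)
    moreover have "u \<bullet> D' = \<mu> * (norm D')\<^sup>2" using DD by (simp add: \<mu>_def power2_norm_eq_inner)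
    then have "u \<bullet> A = - (\<mu> * norm D' / R) * R\<^sup>2" using D'(3) R by (simp add: A_def power2_eq_square)
    ultimately show False by simp
  qed
  show ?thesis
  proof
    show "closure U \<subseteq> cball 0 R" by (rule enclosed)
    show "cball 0 R \<subseteq> closure U"
    proof
      fix x :: 'a assume "x \<in> cball 0 R"
      then consider "norm x < R" | "x \<in> T" using T by fastforce
      then show "x \<in> closure U" by cases (use ball closure_U in \<open>auto simp: T_def\<close>)
    qed
  qed
qed

end

section \<open>Existence of an antipodal pair of contact points\<close>

lemma zero_in_convex_hull_obtain:
  fixes T :: "'a::euclidean_space set"
  assumes "0 \<in> convex hull T"
  obtains S u where "finite S" "S \<subseteq> T" "S \<noteq> {}" "\<And>x. x \<in> S \<Longrightarrow> 0 < u x" "sum u S = (1::real)" "(\<Sum>x\<in>S. u x *\<^sub>R x) = 0"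
proof -
  obtain S u where S: "finite S" "S \<subseteq> T" "\<forall>x\<in>S. 0 \<le> u x" "sum u S = 1" "(\<Sum>x\<in>S. u x *\<^sub>R x) = 0"
    using assms unfolding convex_hull_explicit by blast
  define S' where "S' = {x\<in>S. u x \<noteq> 0}"
  have S'S: "S' \<subseteq> S" by (auto simp: S'_def)
  have "sum u S' = sum u S" "(\<Sum>x\<in>S'. u x *\<^sub>R x) = (\<Sum>x\<in>S. u x *\<^sub>R x)"
    using S(1) S'S by (auto intro!: sum.mono_neutral_left simp: S'_def)
  moreover have "finite S'" using S(1) S'S finite_subset by blast
  moreover have "S' \<noteq> {}" using calculation(1) S(4) by auto
  moreover have "S' \<subseteq> T" using S(2) S'S by blast
  moreover have "0 < u x" if "x \<in> S'" for x using that S(3) by (auto simp: S'_def order_le_less)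
  ultimately show thesis using that[of S' u] S(4,5) by metis
qed

text \<open>A point missing from a segment lies in a gap whose ends are in the closed set
  \<open>C\<close>, and \<open>between\<close> puts another point of \<open>C\<close> strictly
  inside the gap.\<close>

lemma closed_between_imp_convex:
  fixes C :: "'a::euclidean_space set"
  assumes C: "closed C"
    and between: "\<And>a b. a \<in> C \<Longrightarrow> b \<in> C \<Longrightarrow> a \<noteq> b \<Longrightarrow> \<exists>t. 0 < t \<and> t < 1 \<and> a + t *\<^sub>R (b - a) \<in> C"
  shows "convex C"
proof (rule ccontr)
  assume "\<not> convex C"
  then obtain a b u where ab: "a \<in> C" "b \<in> C" and u: "0 \<le> u" "u \<le> 1" and out: "a + u *\<^sub>R (b - a) \<notin> C"
    unfolding convex_alt by (fastforce simp: algebra_simps)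
  define g where "g t = a + t *\<^sub>R (b - a)" for t
  have cl: "closed {t. g t \<in> C}"
  proof -
    have "continuous_on UNIV g" unfolding g_def by (intro continuous_intros)
    from closed_vimage[OF C this] show ?thesis by (simp add: vimage_def)
  qed
  have "compact ({0..u} \<inter> {t. g t \<in> C})" "compact ({u..1} \<inter> {t. g t \<in> C})"
    using cl by (auto intro!: compact_Int_closed)
  moreover have "0 \<in> {0..u} \<inter> {t. g t \<in> C}" "1 \<in> {u..1} \<inter> {t. g t \<in> C}" using ab u by (auto simp: g_def)
  ultimately obtain l r where l: "l \<in> {0..u} \<inter> {t. g t \<in> C}" "\<And>t. t \<in> {0..u} \<inter> {t. g t \<in> C} \<Longrightarrow> t \<le> l"
    and r: "r \<in> {u..1} \<inter> {t. g t \<in> C}" "\<And>t. t \<in> {u..1} \<inter> {t. g t \<in> C} \<Longrightarrow> r \<le> t"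
    using compact_attains_sup[of "{0..u} \<inter> {t. g t \<in> C}"] compact_attains_inf[of "{u..1} \<inter> {t. g t \<in> C}"] by blast
  have gu: "g u \<notin> C" using out by (simp add: g_def)
  have lu: "l < u" "u < r" using l(1) r(1) gu by (auto simp: order_le_less)
  have "b \<noteq> a" using ab out by auto
  then have "g l \<noteq> g r" using lu by (simp add: g_def)
  then obtain t where t: "0 < t" "t < 1" "g l + t *\<^sub>R (g r - g l) \<in> C" using between l(1) r(1) by blast
  define k where "k = l + t * (r - l)"
  have "g l + t *\<^sub>R (g r - g l) = g k"
    by (simp add: g_def k_def algebra_simps)
  then have gk: "g k \<in> C" using t by simp
  have k: "l < k" "k < r"
  proof -
    have "0 < t * (r - l)" "t * (r - l) < 1 * (r - l)" using t lu by (auto intro!: mult_strict_right_mono)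
    then show "l < k" "k < r" by (auto simp: k_def)
  qed
  show False
  proof (cases "k \<le> u")
    case True
    then show False using l(2)[of k] l(1) k gk by auto
  next
    case False
    then show False using r(2)[of k] r(1) k gk by auto
  qed
qed

context enclosed_dichotomy
begin

text \<open>The inner contact points \<open>Q\<close> of the largest centred ball in
  \<open>U\<close> are played off against the outer ones in \<open>T\<close>. The indirect
  assumption pays for three things: an obtuse pair of contact points that is not antipodal, which
  puts 0 into \<open>U\<close>; the inequality \<open>r < R\<close>, since a full ball has antipodal
  contact points; and a contact point off the axis of a given one.\<close>

lemma antipodal_pair_exists: "\<exists>A\<in>T. - A \<in> T"
proof (rule ccontr)
  assume "\<not> (\<exists>A\<in>T. - A \<in> T)"
  then have noanti: "\<And>A. A \<in> T \<Longrightarrow> - A \<notin> T" by blast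
  have AA: "A \<bullet> A = R\<^sup>2" if "A \<in> T" for A using that by (auto simp: T_iff power2_norm_eq_inner[symmetric])
  have R2: "0 < R\<^sup>2" using R by simp
  obtain S \<mu> where S: "finite S" "S \<subseteq> T" "S \<noteq> {}" "\<And>x. x \<in> S \<Longrightarrow> 0 < \<mu> x" "sum \<mu> S = (1::real)" "(\<Sum>x\<in>S. \<mu> x *\<^sub>R x) = 0"
    using zero_in_convex_hull_obtain[of T] centred unfolding T_def by blast
  obtain x0 where x0: "x0 \<in> S" using S(3) by blast
  \<comment> \<open>The products with \<open>x0\<close> have weighted sum 0, and that of
    \<open>x0\<close> itself is positive.\<close>
  have "\<exists>x\<in>S. x \<bullet> x0 < 0"
  proof (rule ccontr)
    assume "\<not> (\<exists>x\<in>S. x \<bullet> x0 < 0)"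
    then have nn: "0 \<le> \<mu> x * (x \<bullet> x0)" if "x \<in> S" for x using S(4) that by (force intro!: mult_nonneg_nonneg)
    have "(\<Sum>x\<in>S. \<mu> x * (x \<bullet> x0)) = (\<Sum>x\<in>S. \<mu> x *\<^sub>R x) \<bullet> x0" by (simp add: inner_sum_left)
    then have "(\<Sum>x\<in>S. \<mu> x * (x \<bullet> x0)) = 0" using S(6) by simp
    then have "\<mu> x0 * (x0 \<bullet> x0) = 0" using sum_nonneg_eq_0_iff[of S "\<lambda>x. \<mu> x * (x \<bullet> x0)"] S(1) nn x0 by blast
    moreover have "x0 \<bullet> x0 = R\<^sup>2" using AA x0 S(2) by blast
    ultimately show False using S(4)[OF x0] R2 by simp
  qed
  then obtain x1 where x1: "x1 \<in> S" "x1 \<bullet> x0 < 0" by blast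
  have xT: "x0 \<in> T" "x1 \<in> T" using x0 x1 S(2) by auto
  have x10: "x1 \<noteq> x0" "x1 \<noteq> - x0" using x1 noanti xT AA[OF xT(1)] R2 by auto
  have U0: "0 \<in> U" using axis_segment[OF xT(2,1) x10 x1(2) R2] by simp
  have "x0 \<in> - U" using xT(1) T_notin_U by blast
  moreover have cU: "closed (- U)" using open_U by auto
  ultimately obtain q0 where q0: "q0 \<notin> U" "\<And>q. q \<notin> U \<Longrightarrow> norm q0 \<le> norm q"
    using distance_attains_inf[of "- U" 0] by (metis ComplD ComplI dist_0_norm empty_iff)
  define r where "r = norm q0"
  have "q0 \<noteq> 0" using q0 U0 by auto
  then have r: "0 < r" by (simp add: r_def)
  have in_ball: "x \<in> U" if "norm x < r" for x using q0(2)[of x] that by (auto simp: r_def)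
  have rR: "r < R"
  proof (rule ccontr)
    assume "\<not> r < R"
    then have "ball 0 R \<subseteq> U" using in_ball by auto
    then have "cball 0 R \<subseteq> closure U" using closure_mono[of "ball 0 R" U] R by simp
    then have "x0 \<in> T" "- x0 \<in> T" using xT by (auto simp: T_def)
    then show False using noanti by blast
  qed
  define Q where "Q = {q. q \<notin> U \<and> norm q = r}"
  have Qne: "q0 \<in> Q" using q0 by (simp add: Q_def r_def)
  have "Q = - U \<inter> sphere 0 r" by (auto simp: Q_def)
  then have cQ: "compact Q" using cU by (simp add: closed_Int_compact)
  \<comment> \<open>\<open>r\<close> is the largest radius with \<open>ball 0 r \<subseteq> U\<close>. Consider the rectangles on the side from \<open>q\<close> to \<open>A\<close> with other
    side \<open>m y\<close>: for \<open>m < 1\<close> the vertex at \<open>q\<close> moves into this ball, for \<open>m > 1\<close> the vertex at \<open>A\<close> leaves \<open>cball 0 R\<close>.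
    Either way the fourth vertex is determined, and \<open>m \<longlonglongrightarrow> 1\<close> gives the claim.\<close>
  have mirror: "A + y \<in> T \<and> q + y \<in> Q"
    if A: "A \<in> T" and q: "q \<in> Q" and orth: "y \<bullet> (A - q) = 0" and Ay: "norm (A + y) = R" for A q y
  proof (cases "y = 0")
    case True then show ?thesis using A q by simp
  next
    case False
    have yA: "2 * (y \<bullet> A) = - (y \<bullet> y)"
    proof -
      have "(A + y) \<bullet> (A + y) = A \<bullet> A" using Ay A AA by (simp add: power2_norm_eq_inner[symmetric])
      then show ?thesis by (simp add: inner_add_left inner_add_right inner_commute[of A y])
    qed
    have yq: "y \<bullet> q = y \<bullet> A" using orth by (simp add: inner_diff_right)
    have yy: "0 < y \<bullet> y" using False by simp
    have qq: "q \<bullet> q = r\<^sup>2" using q by (auto simp: Q_def power2_norm_eq_inner[symmetric])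
    have nq: "(norm (q + m *\<^sub>R y))\<^sup>2 = r\<^sup>2 + (m\<^sup>2 - m) * (y \<bullet> y)"
     and nA: "(norm (A + m *\<^sub>R y))\<^sup>2 = R\<^sup>2 + (m\<^sup>2 - m) * (y \<bullet> y)" for m
    proof -
      have "2 * m * (y \<bullet> A) = - (m * (y \<bullet> y))" using yA by (metis mult.commute mult.left_commute mult_minus_right)
      then show "(norm (q + m *\<^sub>R y))\<^sup>2 = r\<^sup>2 + (m\<^sup>2 - m) * (y \<bullet> y)" "(norm (A + m *\<^sub>R y))\<^sup>2 = R\<^sup>2 + (m\<^sup>2 - m) * (y \<bullet> y)"
        unfolding power2_norm_eq_inner inner_add_left inner_add_right inner_scaleR_left inner_scaleR_right
          inner_commute[of q y] inner_commute[of A y] qq yq AA[OF A]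
        by (simp_all add: power2_eq_square algebra_simps)
    qed
    have orth': "(A - q) \<bullet> (m *\<^sub>R y) = 0" for m using orth by (simp add: inner_commute)
    have shrink: "A + m *\<^sub>R y \<in> closure U" if m: "0 < m" "m < 1" for m
    proof -
      have "m\<^sup>2 < m" using m by (simp add: power2_eq_square)
      then have "(m\<^sup>2 - m) * (y \<bullet> y) < 0" using yy by (simp add: mult_less_0_iff)
      then have "(norm (q + m *\<^sub>R y))\<^sup>2 < r\<^sup>2" unfolding nq by simp
      then have "norm (q + m *\<^sub>R y) < r" using r by (simp add: power2_less_imp_less)
      then have "q + m *\<^sub>R y \<in> U" by (rule in_ball)
      then have "A + (q + m *\<^sub>R y) - q \<notin> W" using fourth_vertex[of A "q + m *\<^sub>R y" q] A q orth'[of m] by (simp add: T_iff Q_def)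
      then show ?thesis using closure_U by (simp add: add.commute add.left_commute)
    qed
    have grow: "q + m *\<^sub>R y \<notin> U" if m: "1 < m" for m
    proof
      assume qU: "q + m *\<^sub>R y \<in> U"
      have "m < m\<^sup>2" using m by (simp add: power2_eq_square)
      then have "0 < (m\<^sup>2 - m) * (y \<bullet> y)" using yy by simp
      then have "R\<^sup>2 < (norm (A + m *\<^sub>R y))\<^sup>2" unfolding nA by simp
      then have "R < norm (A + m *\<^sub>R y)" by (rule power2_less_imp_less) simp
      then have "A + m *\<^sub>R y \<in> W" using norm_le by force
      moreover have "A + (q + m *\<^sub>R y) - q \<notin> W" using fourth_vertex[of A "q + m *\<^sub>R y" q] A q qU orth'[of m] by (simp add: T_iff Q_def)
      ultimately show False by (simp add: add.commute add.left_commute)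
    qed
    let ?m = "\<lambda>n::nat. 1 - 1 / (real n + 2)" and ?M = "\<lambda>n::nat. 1 + 1 / (real n + 2)"
    have lim: "?m \<longlonglongrightarrow> 1" "?M \<longlonglongrightarrow> 1"
    proof -
      have "(\<lambda>n::nat. 1 / (real n + 2)) \<longlonglongrightarrow> 0" by real_asymp
      from tendsto_diff[OF tendsto_const[of 1] this] tendsto_add[OF tendsto_const[of 1] this]
      show "?m \<longlonglongrightarrow> 1" "?M \<longlonglongrightarrow> 1" by simp_all
    qed
    have "(\<lambda>n. A + ?m n *\<^sub>R y) \<longlonglongrightarrow> A + 1 *\<^sub>R y" by (intro tendsto_add tendsto_scaleR lim tendsto_const)
    moreover have "A + ?m n *\<^sub>R y \<in> closure U" for n by (rule shrink) (auto simp: field_simps)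
    ultimately have "A + 1 *\<^sub>R y \<in> closure U" by (meson closed_closure closed_sequentially)
    moreover have "(\<lambda>n. q + ?M n *\<^sub>R y) \<longlonglongrightarrow> q + 1 *\<^sub>R y" by (intro tendsto_add tendsto_scaleR lim tendsto_const)
    moreover have "q + ?M n *\<^sub>R y \<in> - U" for n using grow[of "?M n"] by (auto simp: field_simps)
    moreover have "q + 1 *\<^sub>R y \<in> - U" by (rule closed_sequentially[OF cU calculation(3) calculation(2)])
    ultimately have "A + 1 *\<^sub>R y \<in> closure U" "q + 1 *\<^sub>R y \<in> - U" by blast+
    then have "A + y \<in> closure U" "q + y \<in> - U" by simp_all
    moreover have "(norm (q + y))\<^sup>2 = r\<^sup>2" using nq[of 1] by simp
    then have "norm (q + y) = r" using r by simp
    ultimately show ?thesis using Ay by (simp add: T_def Q_def)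
  qed
  \<comment> \<open>\<open>A + y\<close> is the mirror image of \<open>A\<close> in the line spanned
    by \<open>A - q\<close>, so its norm is \<open>R\<close> and \<open>y\<close> is orthogonal to
    \<open>A - q\<close>, as \<open>mirror\<close> requires.\<close>
  have reflect: "A + y \<in> T \<and> q + y \<in> Q" if A: "A \<in> T" and q: "q \<in> Q"
    and y: "y = (2 * ((A \<bullet> (A - q)) / ((A - q) \<bullet> (A - q)))) *\<^sub>R (A - q) - 2 *\<^sub>R A" for A q y
  proof (rule mirror[OF A q])
    have "A \<noteq> q" using A q rR by (auto simp: T_iff Q_def)
    then have nz: "(A - q) \<bullet> (A - q) \<noteq> 0" by simp
    have y': "y = - 2 *\<^sub>R (A - ((A \<bullet> (A - q)) / ((A - q) \<bullet> (A - q))) *\<^sub>R (A - q))"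
      unfolding y by (simp add: scaleR_diff_right)
    have "(A - q) \<bullet> y = 0" unfolding y' inner_scaleR_right inner_projection_residual by simp
    then show "y \<bullet> (A - q) = 0" by (simp add: inner_commute)
    then have "y \<bullet> (A + y) = - (y \<bullet> A)"
    proof -
      have "A + y + A = (2 * ((A \<bullet> (A - q)) / ((A - q) \<bullet> (A - q)))) *\<^sub>R (A - q)" unfolding y by (simp add: scaleR_2)
      then have "y \<bullet> (A + y + A) = 0" using \<open>y \<bullet> (A - q) = 0\<close> by simp
      then show ?thesis by (simp add: inner_add_right)
    qed
    then have "(A + y) \<bullet> (A + y) = A \<bullet> A" by (simp add: inner_add_left inner_add_right inner_commute[of A y])
    then show "norm (A + y) = R" using A AA R by (simp add: norm_eq_sqrt_inner)
  qed
  define \<rho> where "\<rho> = r / R"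
  have \<rho>: "0 < \<rho>" "\<rho> < 1" using r rR by (auto simp: \<rho>_def)
  \<comment> \<open>Unless it is collinear with \<open>A\<close>, a point of \<open>Q\<close> is mirrored to a point of \<open>Q\<close> with smaller product with \<open>A\<close>.\<close>
  have collinear: "\<exists>q\<in>Q. (\<forall>q'\<in>Q. A \<bullet> q \<le> A \<bullet> q') \<and> (q = \<rho> *\<^sub>R A \<or> q = (- \<rho>) *\<^sub>R A)" if A: "A \<in> T" for A
  proof -
    have "continuous_on Q (\<lambda>q. A \<bullet> q)" by (intro continuous_intros)
    then obtain q where q: "q \<in> Q" "\<And>q'. q' \<in> Q \<Longrightarrow> A \<bullet> q \<le> A \<bullet> q'"
      using continuous_attains_inf[OF cQ] Qne by blast
    define w where "w = A - q"
    define k where "k = (A \<bullet> w) / (w \<bullet> w)"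
    have "A \<noteq> q" using A q rR by (auto simp: T_iff Q_def)
    then have ww: "0 < w \<bullet> w" by (simp add: w_def)
    have "q + ((2 * k) *\<^sub>R w - 2 *\<^sub>R A) \<in> Q" using reflect[OF A q(1)] by (simp add: w_def k_def)
    then have "A \<bullet> q \<le> A \<bullet> (q + ((2 * k) *\<^sub>R w - 2 *\<^sub>R A))" by (rule q(2))
    then have "R\<^sup>2 \<le> k * (A \<bullet> w)" using AA[OF A] by (simp add: inner_add_right inner_diff_right)
    then have le: "R\<^sup>2 * (w \<bullet> w) \<le> (A \<bullet> w)\<^sup>2" using ww by (simp add: k_def power2_eq_square field_simps)
    have "(R\<^sup>2 *\<^sub>R w - (A \<bullet> w) *\<^sub>R A) \<bullet> (R\<^sup>2 *\<^sub>R w - (A \<bullet> w) *\<^sub>R A) = R\<^sup>2 * (R\<^sup>2 * (w \<bullet> w) - (A \<bullet> w)\<^sup>2)"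
      unfolding inner_diff_left inner_diff_right inner_scaleR_left inner_scaleR_right AA[OF A] inner_commute[of w A]
      by (simp add: power2_eq_square algebra_simps)
    also have "\<dots> \<le> 0" using le by (intro mult_nonneg_nonpos) auto
    finally have "(R\<^sup>2 *\<^sub>R w - (A \<bullet> w) *\<^sub>R A) \<bullet> (R\<^sup>2 *\<^sub>R w - (A \<bullet> w) *\<^sub>R A) = 0"
      using inner_ge_zero order_antisym by blast
    then have "R\<^sup>2 *\<^sub>R w = (A \<bullet> w) *\<^sub>R A" by (simp only: inner_eq_zero_iff right_minus_eq)
    then have "(1 / R\<^sup>2) *\<^sub>R (R\<^sup>2 *\<^sub>R w) = (1 / R\<^sup>2) *\<^sub>R ((A \<bullet> w) *\<^sub>R A)" by simp
    then have w': "w = ((A \<bullet> w) / R\<^sup>2) *\<^sub>R A" using R by simp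
    define t where "t = 1 - (A \<bullet> w) / R\<^sup>2"
    have qt: "q = t *\<^sub>R A"
    proof -
      have "q = A - w" by (simp add: w_def)
      also have "\<dots> = A - ((A \<bullet> w) / R\<^sup>2) *\<^sub>R A" using w' by simp
      finally show ?thesis by (simp add: t_def scaleR_diff_left)
    qed
    have "\<bar>t\<bar> * R = r" using q(1) A by (simp add: Q_def qt T_iff)
    then have "\<bar>t\<bar> = \<rho>" using R by (simp add: \<rho>_def field_simps)
    then have "t = \<rho> \<or> t = - \<rho>" by auto
    then show ?thesis using q qt by blast
  qed
  \<comment> \<open>Otherwise the minimum of \<open>A \<bullet> q\<close> over \<open>Q\<close> is
    attained at \<open>\<rho> *\<^sub>R A\<close>, where this product is also as large as it can be
    at radius \<open>r\<close>. Then \<open>Q\<close> is a single point, but a contact point off the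
    axis of \<open>A\<close> contributes another one.\<close>
  have opposite: "(- \<rho>) *\<^sub>R A \<in> Q" if A: "A \<in> T" for A
  proof (rule ccontr)
    assume no: "(- \<rho>) *\<^sub>R A \<notin> Q"
    then obtain q where q: "q \<in> Q" "\<And>q'. q' \<in> Q \<Longrightarrow> A \<bullet> q \<le> A \<bullet> q'" "q = \<rho> *\<^sub>R A" using collinear[OF A] by auto
    have only: "q' = \<rho> *\<^sub>R A" if q': "q' \<in> Q" for q'
    proof -
      have "\<rho> * R\<^sup>2 \<le> A \<bullet> q'" using q(2)[OF q'] AA[OF A] by (simp add: q(3))
      moreover have "q' \<bullet> q' = \<rho>\<^sup>2 * R\<^sup>2" using q' R by (simp add: Q_def power2_norm_eq_inner[symmetric] \<rho>_def power_divide)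
      then have "q' \<bullet> q' = \<rho> * (\<rho> * R\<^sup>2)" by (simp add: power2_eq_square)
      moreover have "(q' - \<rho> *\<^sub>R A) \<bullet> (q' - \<rho> *\<^sub>R A) = q' \<bullet> q' - 2 * (\<rho> * (A \<bullet> q')) + \<rho> * (\<rho> * R\<^sup>2)"
        unfolding inner_diff_left inner_diff_right inner_scaleR_left inner_scaleR_right AA[OF A] inner_commute[of q' A]
        by (simp add: algebra_simps)
      moreover have "\<rho> * (\<rho> * R\<^sup>2) \<le> \<rho> * (A \<bullet> q')" using calculation(1) \<rho> by (intro mult_left_mono) auto
      ultimately have "(q' - \<rho> *\<^sub>R A) \<bullet> (q' - \<rho> *\<^sub>R A) \<le> 0" by linarith
      then have "(q' - \<rho> *\<^sub>R A) \<bullet> (q' - \<rho> *\<^sub>R A) = 0" using inner_ge_zero order_antisym by blast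
      then show ?thesis by (simp only: inner_eq_zero_iff right_minus_eq)
    qed
    obtain B where B: "B \<in> T" "B \<noteq> A" using xT x10 by metis
    have "B \<noteq> - A" using B A noanti by auto
    obtain q' where "q' \<in> Q" "q' = \<rho> *\<^sub>R B \<or> q' = (- \<rho>) *\<^sub>R B" using collinear[OF B(1)] by blast
    then have "\<rho> *\<^sub>R A = \<rho> *\<^sub>R B \<or> \<rho> *\<^sub>R A = \<rho> *\<^sub>R (- B)" using only by auto
    then have "A = B \<or> A = - B" using \<rho>(1) by (metis less_irrefl scaleR_cancel_left)
    then show False using B(2) \<open>B \<noteq> - A\<close> by auto
  qed
  \<comment> \<open>Reflecting \<open>A\<close> with respect to the inner contact point
    \<open>(- \<rho>) *\<^sub>R B\<close> gives a contact point in the span of \<open>A\<close> and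
    \<open>B\<close>; both coefficients are positive because \<open>\<rho> < 1\<close>.\<close>
  have between: "\<exists>p q. 0 < p \<and> 0 < q \<and> p *\<^sub>R A + q *\<^sub>R B \<in> T" if A: "A \<in> T" and B: "B \<in> T" for A B
  proof -
    define c where "c = (A \<bullet> B) / R\<^sup>2"
    define w where "w = A - (- \<rho>) *\<^sub>R B"
    define N where "N = 1 + \<rho>\<^sup>2 + 2 * \<rho> * c"
    have cR: "A \<bullet> B = c * R\<^sup>2" using R by (simp add: c_def)
    have "\<bar>A \<bullet> B\<bar> \<le> R\<^sup>2" using Cauchy_Schwarz_ineq2[of A B] A B by (simp add: T_iff power2_eq_square)
    then have "\<bar>c\<bar> \<le> 1" using R by (simp add: c_def)
    then have c: "- 1 \<le> c" by simp
    have \<rho>c: "- \<rho> \<le> \<rho> * c" using mult_left_mono[OF c, of \<rho>] \<rho> by simp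
    have "0 < (1 - \<rho>)\<^sup>2" using \<rho> by simp
    then have N: "0 < N" using \<rho>c by (simp add: N_def power2_eq_square algebra_simps)
    have Aw: "A \<bullet> w = R\<^sup>2 * (1 + \<rho> * c)" unfolding w_def inner_diff_right inner_scaleR_right AA[OF A] cR by (simp add: algebra_simps)
    have ww: "w \<bullet> w = R\<^sup>2 * N"
      unfolding w_def inner_diff_left inner_diff_right inner_scaleR_left inner_scaleR_right AA[OF A] AA[OF B] inner_commute[of B A] cR N_def
      by (simp add: power2_eq_square algebra_simps)
    have "A + ((2 * ((A \<bullet> w) / (w \<bullet> w))) *\<^sub>R w - 2 *\<^sub>R A) \<in> T"
      using reflect[OF A opposite[OF B]] by (simp add: w_def)
    moreover have "(A \<bullet> w) / (w \<bullet> w) = (1 + \<rho> * c) / N" using R by (simp add: Aw ww)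
    ultimately have *: "A + ((2 * ((1 + \<rho> * c) / N)) *\<^sub>R w - 2 *\<^sub>R A) \<in> T" by simp
    have "A + ((2 * ((1 + \<rho> * c) / N)) *\<^sub>R w - 2 *\<^sub>R A)
        = (2 * ((1 + \<rho> * c) / N) - 1) *\<^sub>R A + (2 * ((1 + \<rho> * c) / N) * \<rho>) *\<^sub>R B"
      by (simp add: w_def algebra_simps scaleR_2)
    moreover have "0 < 2 * ((1 + \<rho> * c) / N) - 1"
    proof -
      have "2 * ((1 + \<rho> * c) / N) - 1 = (1 - \<rho>\<^sup>2) / N" using N by (simp add: N_def field_simps)
      moreover have "\<rho>\<^sup>2 < 1" using \<rho> by (simp add: abs_square_less_1)
      ultimately show ?thesis using N by simp
    qed
    moreover have "0 < 2 * ((1 + \<rho> * c) / N) * \<rho>" using \<rho> \<rho>c N by (intro mult_pos_pos divide_pos_pos) auto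
    ultimately show ?thesis using * by metis
  qed
  \<comment> \<open>By \<open>between\<close> the cone over \<open>T\<close> is convex. As \<open>0\<close> is a convex combination of points of \<open>T\<close>, the cone contains
    the point opposite to each of them.\<close>
  define C where "C = {v. v = 0 \<or> (R / norm v) *\<^sub>R v \<in> T}"
  have ray: "t *\<^sub>R A \<in> C" if "A \<in> T" "0 \<le> t" for t A
  proof (cases "t = 0")
    case False
    then have "(R / norm (t *\<^sub>R A)) *\<^sub>R (t *\<^sub>R A) = A" using that R by (simp add: T_iff)
    then show ?thesis using that by (simp add: C_def)
  qed (simp add: C_def)
  have rayD: "\<exists>A\<in>T. v = (norm v / R) *\<^sub>R A" if "v \<in> C" for v
  proof (cases "v = 0")
    case True then show ?thesis using xT by auto
  next
    case False
    then have "(R / norm v) *\<^sub>R v \<in> T" using that by (simp add: C_def)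
    moreover have "v = (norm v / R) *\<^sub>R ((R / norm v) *\<^sub>R v)" using False R by simp
    ultimately show ?thesis by blast
  qed
  have closedC: "closed C"
    unfolding closed_sequential_limits
  proof (intro allI impI)
    fix f l assume f: "(\<forall>n. f n \<in> C) \<and> f \<longlonglongrightarrow> l"
    show "l \<in> C"
    proof (cases "l = 0")
      case False
      have "eventually (\<lambda>n. f n \<noteq> 0) sequentially" using f False by (intro tendsto_imp_eventually_ne[of f l]) auto
      then have ev: "eventually (\<lambda>n. (R / norm (f n)) *\<^sub>R f n \<in> T) sequentially"
        by eventually_elim (use f in \<open>auto simp: C_def\<close>)
      have "(\<lambda>n. (R / norm (f n)) *\<^sub>R f n) \<longlonglongrightarrow> (R / norm l) *\<^sub>R l" using f False by (intro tendsto_intros) auto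
      then have "(R / norm l) *\<^sub>R l \<in> T" by (rule Lim_in_closed_set[OF closed_T ev sequentially_bot])
      then show ?thesis by (simp add: C_def)
    qed (simp add: C_def)
  qed
  have "convex C"
  proof (rule closed_between_imp_convex[OF closedC])
    fix a b assume a: "a \<in> C" and b: "b \<in> C" and "a \<noteq> b"
    obtain A B where A: "A \<in> T" "a = (norm a / R) *\<^sub>R A" and B: "B \<in> T" "b = (norm b / R) *\<^sub>R B" using rayD a b by blast
    obtain p q where pq: "0 < p" "0 < q" "p *\<^sub>R A + q *\<^sub>R B \<in> T" using between[OF A(1) B(1)] by blast
    show "\<exists>t. 0 < t \<and> t < 1 \<and> a + t *\<^sub>R (b - a) \<in> C"
    proof (cases "a = 0 \<or> b = 0")
      case True
      then show ?thesis
      proof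
        assume a0: "a = 0"
        have "(1/2 * (norm b / R)) *\<^sub>R B \<in> C" using R by (intro ray B) auto
        moreover have "(1/2 * (norm b / R)) *\<^sub>R B = a + (1/2) *\<^sub>R (b - a)" using a0 arg_cong[OF B(2), of "\<lambda>v. (1/2) *\<^sub>R v"] by simp
        ultimately show ?thesis by (intro exI[of _ "1/2"]) auto
      next
        assume b0: "b = 0"
        have "(1/2 * (norm a / R)) *\<^sub>R A \<in> C" using R by (intro ray A) auto
        moreover have "(1/2 * (norm a / R)) *\<^sub>R A = a + (1/2) *\<^sub>R (b - a)"
        proof -
          have "a + (1/2) *\<^sub>R (b - a) = (1 - 1/2) *\<^sub>R a" unfolding b0 by (simp only: scaleR_diff_left) simp
          then show ?thesis using arg_cong[OF A(2), of "\<lambda>v. (1/2) *\<^sub>R v"] by simp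
        qed
        ultimately show ?thesis by (intro exI[of _ "1/2"]) auto
      qed
    next
      case False
      define x where "x = p * (R / norm a)"
      define y where "y = q * (R / norm b)"
      have xy: "0 < x" "0 < y" using pq R False by (auto simp: x_def y_def)
      have "x *\<^sub>R ((norm a / R) *\<^sub>R A) = p *\<^sub>R A" "y *\<^sub>R ((norm b / R) *\<^sub>R B) = q *\<^sub>R B"
        using False R by (simp_all add: x_def y_def)
      then have "x *\<^sub>R a = p *\<^sub>R A" "y *\<^sub>R b = q *\<^sub>R B"
        unfolding A(2)[symmetric] B(2)[symmetric] .
      then have "x *\<^sub>R a + y *\<^sub>R b \<in> T" using pq(3) by simp
      then have "(1 / (x + y)) *\<^sub>R (x *\<^sub>R a + y *\<^sub>R b) \<in> C" using xy by (intro ray) auto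
      moreover have "(1 / (x + y)) *\<^sub>R (x *\<^sub>R a + y *\<^sub>R b) = a + (y / (x + y)) *\<^sub>R (b - a)"
      proof -
        have "x / (x + y) = 1 - y / (x + y)" using xy by (simp add: field_simps)
        moreover have "(1 / (x + y)) *\<^sub>R (x *\<^sub>R a + y *\<^sub>R b) = (x / (x + y)) *\<^sub>R a + (y / (x + y)) *\<^sub>R b"
          by (simp add: scaleR_add_right)
        ultimately have "(1 / (x + y)) *\<^sub>R (x *\<^sub>R a + y *\<^sub>R b) = (1 - y / (x + y)) *\<^sub>R a + (y / (x + y)) *\<^sub>R b"
          by (simp only:)
        then show ?thesis by (simp only: scaleR_diff_left scaleR_diff_right scaleR_one) simp
      qed
      ultimately show ?thesis using xy by (intro exI[of _ "y / (x + y)"]) auto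
    qed
  qed
  then have hull: "convex hull T \<subseteq> C" using ray[of _ 1] by (intro hull_minimal) auto
  have "(\<Sum>x\<in>S - {x0}. \<mu> x *\<^sub>R x) = - (\<mu> x0 *\<^sub>R x0)"
    using S(1,6) x0 by (simp add: sum.remove[of S x0] add_eq_0_iff)
  moreover define \<kappa> where "\<kappa> = 1 - \<mu> x0"
  have sumk: "sum \<mu> (S - {x0}) = \<kappa>" using S(1,5) x0 by (simp add: sum.remove[of S x0] \<kappa>_def)
  have "0 < \<mu> x1" "x1 \<in> S - {x0}" using S(4) x1 x10 by auto
  then have \<kappa>: "0 < \<kappa>" unfolding sumk[symmetric] using S(1,4) by (intro sum_pos) auto
  have "(\<Sum>x\<in>S - {x0}. (\<mu> x / \<kappa>) *\<^sub>R x) \<in> convex hull T"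
  proof (rule convex_sum)
    show "(\<Sum>i\<in>S - {x0}. \<mu> i / \<kappa>) = 1" using \<kappa> sumk by (simp add: sum_divide_distrib[symmetric])
    show "0 \<le> \<mu> i / \<kappa>" if "i \<in> S - {x0}" for i using S(4)[of i] \<kappa> that by simp
    show "i \<in> convex hull T" if "i \<in> S - {x0}" for i using S(2) that by (intro hull_inc) auto
  qed (use S(1) in auto)
  moreover have "(\<Sum>x\<in>S - {x0}. (\<mu> x / \<kappa>) *\<^sub>R x) = (1 / \<kappa>) *\<^sub>R (\<Sum>x\<in>S - {x0}. \<mu> x *\<^sub>R x)"
    by (simp add: scaleR_sum_right)
  ultimately have "(1 / \<kappa>) *\<^sub>R (- (\<mu> x0 *\<^sub>R x0)) \<in> C" using hull by auto
  then have inC: "(- (\<mu> x0 / \<kappa>)) *\<^sub>R x0 \<in> C" by simp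
  define k where "k = \<mu> x0 / \<kappa>"
  have k: "0 < k" using \<kappa> S(4)[OF x0] by (simp add: k_def)
  have "(R / norm ((- k) *\<^sub>R x0)) *\<^sub>R ((- k) *\<^sub>R x0) = - x0"
    using k R xT(1) by (simp add: T_iff)
  moreover have "(- k) *\<^sub>R x0 \<noteq> 0" using k R xT(1) by (auto simp: T_iff)
  ultimately have "- x0 \<in> T" using inC unfolding k_def[symmetric] C_def by auto
  then show False using noanti xT by blast
qed

lemma closure_is_centred_cball: "closure U = cball 0 R"
  using antipodal_pair_exists T_eq_sphere closure_eq_cball by blast

end

section \<open>The smallest enclosing ball\<close>

lemma minimal_enclosing_ball:
  fixes K :: "'a::euclidean_space set"
  assumes K: "compact K" "K \<noteq> {}"
  obtains c R where "0 \<le> R" "K \<subseteq> cball c R" "0 \<in> convex hull ((\<lambda>x. x - c) ` K \<inter> sphere 0 R)"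
proof -
  obtain R0 where R0: "\<And>x. x \<in> K \<Longrightarrow> norm x \<le> R0" using compact_imp_bounded[OF K(1)] bounded_iff by metis
  obtain v0 where v0: "v0 \<in> K" using K(2) by blast
  have R0p: "0 \<le> R0" using R0[OF v0] norm_ge_zero[of v0] by linarith
  \<comment> \<open>The cut-off makes the set of candidates compact. No ball of radius at most
    \<open>R0\<close> is lost: it contains \<open>v0\<close>, so its centre is within
    \<open>R0\<close> of \<open>v0\<close>.\<close>
  define P where "P = {p. K \<subseteq> cball (fst p) (snd p)} \<inter> (cball v0 R0 \<times> {0..R0})"
  have "{p. K \<subseteq> cball (fst p) (snd p)} = (\<Inter>v\<in>K. {p::'a \<times> real. dist (fst p) v \<le> snd p})" by auto
  moreover have "closed {p::'a \<times> real. dist (fst p) v \<le> snd p}" for v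
    by (intro closed_Collect_le continuous_intros)
  ultimately have "closed {p::'a \<times> real. K \<subseteq> cball (fst p) (snd p)}" by (simp add: closed_INT)
  then have cP: "compact P" unfolding P_def by (intro closed_Int_compact compact_Times) auto
  have "(0, R0) \<in> P" using R0 R0p v0 by (auto simp: P_def)
  then obtain p where p: "p \<in> P" "\<And>p'. p' \<in> P \<Longrightarrow> snd p \<le> snd p'"
  proof -
    have "continuous_on P snd" by (intro continuous_intros)
    then show ?thesis using continuous_attains_inf[OF cP] \<open>(0, R0) \<in> P\<close> that by blast
  qed
  define c where "c = fst p"
  define R where "R = snd p"
  have cR: "K \<subseteq> cball c R" "0 \<le> R" "R \<le> R0" using p(1) by (auto simp: P_def c_def R_def)
  have minimal: "\<exists>v\<in>K. R \<le> dist c' v" for c'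
  proof (rule ccontr)
    assume "\<not> (\<exists>v\<in>K. R \<le> dist c' v)"
    then have less: "\<And>v. v \<in> K \<Longrightarrow> dist c' v < R" by force
    obtain w where w: "w \<in> K" "\<And>v. v \<in> K \<Longrightarrow> dist c' v \<le> dist c' w"
    proof -
      have "continuous_on K (dist c')" by (intro continuous_intros)
      then show ?thesis using continuous_attains_sup[OF K] that by blast
    qed
    have "(c', dist c' w) \<in> P" using w less[OF w(1)] cR(3) less[OF v0] by (auto simp: P_def dist_commute)
    then show False using p(2) less[OF w(1)] by (fastforce simp: R_def)
  qed
  define T where "T = (\<lambda>x. x - c) ` K \<inter> sphere 0 R"
  have "compact ((\<lambda>x. x - c) ` K)" by (intro compact_continuous_image continuous_intros K)
  then have cT: "compact T" unfolding T_def by (intro compact_Int_closed) auto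
  have "0 \<in> convex hull T"
  proof (rule ccontr)
    assume "0 \<notin> convex hull T"
    then obtain a b where ab: "0 < b" "\<And>x. x \<in> convex hull T \<Longrightarrow> b < a \<bullet> x"
      using separating_hyperplane_closed_0[of "convex hull T"] cT
      by (metis compact_convex_hull compact_imp_closed convex_convex_hull)
    \<comment> \<open>Moving the centre by \<open>e n *\<^sub>R a\<close> towards the separated
      contact points ought to shrink the ball. The points \<open>v n\<close> that still have
      distance at least \<open>R\<close> accumulate at a contact point \<open>l\<close> with
      \<open>a \<bullet> (l - c) \<le> 0\<close>, against the separation.\<close>
    define e where "e n = 1 / (real n + 1)" for n :: nat
    have e: "0 < e n" for n by (simp add: e_def)
    have elim: "e \<longlonglongrightarrow> 0" unfolding e_def by real_asymp
    have "\<forall>n. \<exists>v. v \<in> K \<and> R \<le> dist (c + e n *\<^sub>R a) v" using minimal by blast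
    then obtain v where v: "\<And>n. v n \<in> K" "\<And>n. R \<le> dist (c + e n *\<^sub>R a) (v n)"
      unfolding choice_iff by blast
    obtain l r where l: "l \<in> K" "strict_mono r" "(v \<circ> r) \<longlonglongrightarrow> l"
      using K(1) v(1) unfolding compact_def by metis
    have er: "(\<lambda>n. e (r n)) \<longlonglongrightarrow> 0" using LIMSEQ_subseq_LIMSEQ[OF elim l(2)] by (simp add: o_def)
    have vr: "(\<lambda>n. v (r n)) \<longlonglongrightarrow> l" using l(3) by (simp add: o_def)
    have "(\<lambda>n. dist (c + e (r n) *\<^sub>R a) (v (r n))) \<longlonglongrightarrow> dist (c + 0 *\<^sub>R a) l"
      using er vr by (intro tendsto_intros)
    then have "R \<le> dist (c + 0 *\<^sub>R a) l" using v(2) by (intro LIMSEQ_le_const) auto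
    moreover have "dist c l \<le> R" using cR(1) l(1) by auto
    ultimately have "norm (l - c) = R" by (simp add: dist_norm norm_minus_commute)
    then have "l - c \<in> T" using l(1) by (auto simp: T_def)
    then have pos: "b < a \<bullet> (l - c)" by (intro ab(2) hull_inc)
    have small: "a \<bullet> (v n - c) \<le> e n * (a \<bullet> a) / 2" for n
    proof -
      have "R\<^sup>2 \<le> (norm ((v n - c) - e n *\<^sub>R a))\<^sup>2"
        using v(2)[of n] cR(2) by (intro power_mono) (auto simp: dist_norm norm_minus_commute algebra_simps)
      also have "\<dots> = (norm (v n - c))\<^sup>2 - 2 * e n * (a \<bullet> (v n - c)) + e n * e n * (a \<bullet> a)"
        unfolding power2_norm_eq_inner inner_diff_left[of "v n - c"] inner_diff_right[of _ "v n - c"] inner_scaleR_left inner_scaleR_right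
          inner_commute[of "v n - c" a]
        by (simp add: algebra_simps)
      also have "(norm (v n - c))\<^sup>2 \<le> R\<^sup>2"
        using cR v(1)[of n] by (intro power_mono) (auto simp: dist_norm norm_minus_commute subset_iff)
      finally have "e n * (2 * (a \<bullet> (v n - c))) \<le> e n * (e n * (a \<bullet> a))" by (simp add: algebra_simps)
      then have "2 * (a \<bullet> (v n - c)) \<le> e n * (a \<bullet> a)" using e[of n] by (simp only: mult_le_cancel_left_pos)
      then show ?thesis by simp
    qed
    have "(\<lambda>n. a \<bullet> (v (r n) - c)) \<longlonglongrightarrow> a \<bullet> (l - c)" using vr by (intro tendsto_intros)
    moreover have "(\<lambda>n. e (r n) * (a \<bullet> a) / 2) \<longlonglongrightarrow> 0 * (a \<bullet> a) / 2" using er by (intro tendsto_intros) auto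
    ultimately have "a \<bullet> (l - c) \<le> 0 * (a \<bullet> a) / 2" by (rule LIMSEQ_le) (use small in blast)
    then show False using pos ab(1) by simp
  qed
  then show thesis using that[OF cR(2,1)] by (simp add: T_def)
qed

context rectangle_dichotomy
begin

lemma closure_is_cball:
  assumes bU: "bounded U" and neU: "U \<noteq> {}"
  obtains c R where "0 < R" "closure U = cball c R"
proof -
  have K: "compact (closure U)" "closure U \<noteq> {}" using bU neU by auto
  obtain c R where cR: "0 \<le> R" "closure U \<subseteq> cball c R" "0 \<in> convex hull ((\<lambda>x. x - c) ` closure U \<inter> sphere 0 R)"
    using minimal_enclosing_ball[OF K] .
  have "R \<noteq> 0"
  proof
    assume "R = 0"
    then have "U \<subseteq> {c}" using cR(2) closure_subset[of U] by auto
    then have "U \<subseteq> interior {c}" using open_U by (rule interior_maximal)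
    then show False using neU by simp
  qed
  then have R: "0 < R" using cR(1) by simp
  have mem: "x \<in> (\<lambda>x. x - c) ` S \<longleftrightarrow> x + c \<in> S" for x S by (force simp: image_iff algebra_simps)
  have cl: "closure ((\<lambda>x. x - c) ` S) = (\<lambda>x. x - c) ` closure S" for S
    using closure_translation[of "- c" S] by (simp add: image_def)
  have cpl: "(\<lambda>x. x - c) ` (- S) = - (\<lambda>x. x - c) ` S" for S by (auto simp: mem)
  interpret E: enclosed_dichotomy "(\<lambda>x. x - c) ` U" "(\<lambda>x. x - c) ` W" R
  proof
    show "closure ((\<lambda>x. x - c) ` U) = - (\<lambda>x. x - c) ` W" "closure ((\<lambda>x. x - c) ` W) = - (\<lambda>x. x - c) ` U"
      unfolding cl closure_U closure_W cpl by simp_all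
    show "a + x + y \<notin> (\<lambda>x. x - c) ` W"
      if "x \<bullet> y = 0" "a \<in> (\<lambda>x. x - c) ` W" "a + x \<in> (\<lambda>x. x - c) ` U" "a + y \<in> (\<lambda>x. x - c) ` U" for a x y
      using no_rectangle[of x y "a + c"] that unfolding mem by (simp add: add_ac)
    show "closure ((\<lambda>x. x - c) ` U) \<subseteq> cball 0 R"
      unfolding cl using cR(2) by (auto simp: dist_norm norm_minus_commute)
    show "0 \<in> convex hull (closure ((\<lambda>x. x - c) ` U) \<inter> sphere 0 R)" unfolding cl by (rule cR(3))
  qed (rule dim, rule R)
  have "(\<lambda>x. x - c) ` closure U = cball 0 R" using E.closure_is_centred_cball unfolding cl .
  then have "x \<in> closure U \<longleftrightarrow> x \<in> cball c R" for x
    using mem[of "x - c" "closure U"] by (simp add: dist_norm norm_minus_commute)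
  then have "closure U = cball c R" by blast
  then show thesis using that R by blast
qed

end

subsection \<open>Essential interiors\<close>

lemma AE_lborel_affine:
  fixes P :: "'a::euclidean_space \<Rightarrow> bool" and c :: real
  assumes c: "c \<noteq> 0" and P[measurable]: "Measurable.pred borel P" and ae: "AE x in lborel. P x"
  shows "AE x in lborel. P (t + c *\<^sub>R x)"
proof -
  have "density (distr lborel borel (\<lambda>x. t + c *\<^sub>R x)) (\<lambda>_. ennreal (\<bar>c\<bar> ^ DIM('a))) = (lborel :: 'a measure)"
    by (rule sym, rule lborel_affine[OF c])
  then have "AE x in density (distr lborel borel (\<lambda>x. t + c *\<^sub>R x)) (\<lambda>_. ennreal (\<bar>c\<bar> ^ DIM('a))). P x"
    by (simp only: ae)
  then have "AE x in distr lborel borel (\<lambda>x. t + c *\<^sub>R x). P x"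
    using c by (simp add: AE_density)
  then show ?thesis by (simp add: AE_distr_iff)
qed

lemma AE_lborel_commute:
  fixes P :: "'a::euclidean_space \<Rightarrow> 'a \<Rightarrow> bool"
  assumes [measurable]: "Measurable.pred (borel \<Otimes>\<^sub>M borel) (\<lambda>p. P (fst p) (snd p))"
  shows "(AE x in lborel. AE y in lborel. P x y) \<longleftrightarrow> (AE y in lborel. AE x in lborel. P x y)"
proof (rule lborel_pair.AE_commute)
  have "{p \<in> space (borel \<Otimes>\<^sub>M borel). P (fst p) (snd p)} \<in> sets (borel \<Otimes>\<^sub>M borel)" by measurable
  moreover have "sets (lborel \<Otimes>\<^sub>M lborel) = sets (borel \<Otimes>\<^sub>M (borel :: 'a measure))" by (intro sets_pair_measure_cong) auto
  ultimately show "{p \<in> space (lborel \<Otimes>\<^sub>M lborel). P (fst p) (snd p)} \<in> sets (lborel \<Otimes>\<^sub>M lborel)"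
    by (simp add: space_pair_measure)
qed

text \<open>For fixed \<open>u\<close> the bad \<open>v\<close> form a translate of
  \<open>N\<close>, whatever \<open>h\<close> is; Fubini exchanges the quantifiers.\<close>

lemma AE_shift_notin_null_set:
  fixes h :: "'a::euclidean_space \<Rightarrow> 'a"
  assumes N[measurable]: "N \<in> sets borel" and null: "emeasure lborel N = 0" and h[measurable]: "h \<in> borel_measurable borel"
  shows "AE v in lborel. AE u in lborel. v + h u \<notin> N"
proof -
  have "AE v in lborel. v \<notin> N" using N null by (intro AE_not_in) (simp add: null_sets_def)
  then have "AE v in lborel. h u + 1 *\<^sub>R v \<notin> N" for u
    by (intro AE_lborel_affine) auto
  then have "AE u in lborel. AE v in lborel. v + h u \<notin> N" by (simp add: add.commute)
  then show ?thesis by (subst AE_lborel_commute) auto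
qed

text \<open>The substitution of \<open>(v + u, - u)\<close> for \<open>(v, u)\<close> describes the
  same rectangle from the opposite vertex. It is composed of shifts and a reflection, which preserve
  null sets.\<close>

lemma AE_opposite_vertex:
  fixes P :: "'a::euclidean_space \<Rightarrow> 'a \<Rightarrow> bool"
  assumes P[measurable]: "Measurable.pred (borel \<Otimes>\<^sub>M borel) (\<lambda>p. P (fst p) (snd p))"
    and ae: "AE v in lborel. AE u in lborel. P v u"
  shows "AE v in lborel. AE u in lborel. P (v + u) (- u)"
proof -
  have [measurable]: "Measurable.pred borel (\<lambda>v. P (f v) (g v))" if "f \<in> borel_measurable borel" "g \<in> borel_measurable borel"
    for f g :: "'a \<Rightarrow> 'a"
    using measurable_compose[OF measurable_Pair[OF that] P] by simp
  have [measurable]: "Measurable.pred (borel \<Otimes>\<^sub>M borel) (\<lambda>p. P (f p) (g p))"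
    if "f \<in> borel_measurable (borel \<Otimes>\<^sub>M borel)" "g \<in> borel_measurable (borel \<Otimes>\<^sub>M borel)" for f g :: "'a \<times> 'a \<Rightarrow> 'a"
    using measurable_compose[OF measurable_Pair[OF that] P] by simp
  have "AE u in lborel. AE v in lborel. P v u" using ae by (subst (asm) AE_lborel_commute) auto
  then have "AE u in lborel. AE v in lborel. P ((- u) + 1 *\<^sub>R v) u"
  proof eventually_elim
    case (elim u)
    show ?case by (rule AE_lborel_affine[where P = "\<lambda>v. P v u" and t = "- u" and c = 1]) (use elim in auto)
  qed
  then have "AE v in lborel. AE u in lborel. P (v - u) u" by (subst AE_lborel_commute) auto
  then show ?thesis
  proof eventually_elim
    case (elim v)
    have "AE u in lborel. P (v - (0 + (-1) *\<^sub>R u)) (0 + (-1) *\<^sub>R u)"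
      by (rule AE_lborel_affine[where P = "\<lambda>u. P (v - u) u" and t = 0 and c = "-1"]) (use elim in auto)
    then show ?case by simp
  qed
qed

text \<open>Unaffected by changes of \<open>S\<close> on null sets, and open. Through it, statements
  about almost all rectangles become statements about all of them.\<close>

definition essint :: "'a::euclidean_space set \<Rightarrow> 'a set" where
  "essint S = {p. \<exists>e>0. emeasure lborel (ball p e - S) = 0}"

lemma open_essint:
  assumes S[measurable]: "S \<in> sets borel"
  shows "open (essint S)"
  unfolding open_contains_ball
proof
  fix p assume "p \<in> essint S"
  then obtain e where e: "0 < e" "emeasure lborel (ball p e - S) = 0" by (auto simp: essint_def)
  have "q \<in> essint S" if q: "q \<in> ball p e" for q
  proof -
    have "ball q (e - dist p q) \<subseteq> ball p e"
    proof
      fix x assume "x \<in> ball q (e - dist p q)"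
      then show "x \<in> ball p e" using dist_triangle[of p x q] by simp
    qed
    then have "emeasure lborel (ball q (e - dist p q) - S) \<le> emeasure lborel (ball p e - S)"
      by (intro emeasure_mono) auto
    then show ?thesis using e q by (auto simp: essint_def intro!: exI[of _ "e - dist p q"])
  qed
  then show "\<exists>e>0. ball p e \<subseteq> essint S" using e by blast
qed

text \<open>The balls in the definition are uncountably many, but by Lindelof countably many of them
  cover the same set.\<close>

lemma emeasure_essint_diff:
  fixes S :: "'a::euclidean_space set"
  assumes S[measurable]: "S \<in> sets borel"
  shows "emeasure lborel (essint S - S) = 0"
proof -
  let ?F = "{ball p e |p e. 0 < e \<and> emeasure lborel (ball p e - S) = 0}"
  have "\<And>B. B \<in> ?F \<Longrightarrow> open B" by auto
  then obtain F' where F': "F' \<subseteq> ?F" "countable F'" "\<Union>F' = \<Union>?F" by (rule Lindelof[of ?F]) auto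
  have "essint S \<subseteq> \<Union>?F" by (force simp: essint_def)
  then have "essint S \<subseteq> \<Union>F'" by (simp only: F'(3))
  then have sub: "essint S - S \<subseteq> (\<Union>B\<in>F'. B - S)" by blast
  have F'm: "B \<in> sets borel" "emeasure lborel (B - S) = 0" if "B \<in> F'" for B using F'(1) that by auto
  have "(\<Union>B\<in>F'. B - S) \<in> null_sets lborel"
    using F'(2) F'm by (intro null_sets_UN') (auto simp: null_sets_def)
  moreover have "essint S \<in> sets borel" using open_essint[OF S] by simp
  ultimately show ?thesis using sub emeasure_mono[OF sub, of lborel] by (simp add: null_sets_def)
qed

lemma emeasure_ball_pos: "0 < e \<Longrightarrow> 0 < emeasure lborel (ball (p::'a::euclidean_space) e)"
  by (simp add: emeasure_ball)

lemma essint_disjoint: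
  fixes S :: "'a::euclidean_space set"
  assumes S[measurable]: "S \<in> sets borel" and p: "p \<in> essint S"
  shows "p \<notin> essint (- S)"
proof
  assume "p \<in> essint (- S)"
  then obtain d e where d: "0 < d" "emeasure lborel (ball p d - S) = 0" and e: "0 < e" "emeasure lborel (ball p e - - S) = 0"
    using p by (auto simp: essint_def)
  have "emeasure lborel (ball p (min d e)) \<le> emeasure lborel ((ball p d - S) \<union> (ball p e - - S))"
    by (intro emeasure_mono) auto
  also have "\<dots> \<le> emeasure lborel (ball p d - S) + emeasure lborel (ball p e - - S)"
    by (intro emeasure_subadditive) auto
  finally show False using d e emeasure_ball_pos[of "min d e" p] by simp
qed

lemma essint_I:
  assumes e: "0 < e" and ae: "AE v in lborel. v \<in> ball p e \<longrightarrow> v \<in> S" and S[measurable]: "S \<in> sets borel"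
  shows "p \<in> essint S"
proof -
  have "AE v in lborel. v \<notin> ball p e - S" using ae by eventually_elim auto
  then have "emeasure lborel (ball p e - S) = 0"
    using AE_iff_null_sets[of "ball p e - S" lborel] by (auto simp: null_sets_def)
  then show ?thesis using e by (auto simp: essint_def)
qed

lemma AE_imp_ex:
  assumes ae: "AE x in M. P x" and A: "A \<in> sets M" "emeasure M A \<noteq> 0"
  shows "\<exists>x\<in>A. P x"
proof (rule ccontr)
  assume "\<not> (\<exists>x\<in>A. P x)"
  then have "AE x in M. x \<notin> A" using ae by (auto elim: eventually_mono)
  then show False using A AE_iff_null_sets[of A M] by (auto simp: null_sets_def)
qed

text \<open>Countability allows the exceptional null sets of all directions to be united, and
  density allows every rectangle to be approximated by one with a direction in the set.\<close>

definition dense_directions :: "'a::euclidean_space set \<Rightarrow> bool" where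
  "dense_directions G \<longleftrightarrow> countable G \<and> (\<forall>s\<in>G. norm s = 1) \<and> (\<forall>s e. norm s = 1 \<longrightarrow> 0 < e \<longrightarrow> (\<exists>s'\<in>G. dist s s' < e))"

lemma dense_directions_norm: "dense_directions G \<Longrightarrow> s \<in> G \<Longrightarrow> norm s = 1"
  by (auto simp: dense_directions_def)

lemma dense_directions_nonempty:
  fixes G :: "'a::euclidean_space set"
  assumes "dense_directions G" obtains s where "s \<in> G"
proof -
  obtain b :: 'a where "b \<in> Basis" using nonempty_Basis by blast
  then have "norm b = 1" by simp
  then obtain s' where "s' \<in> G" using assms zero_less_one unfolding dense_directions_def by blast
  then show thesis by (rule that)
qed

text \<open>The two diagonals have equal length, so \<open>s\<close> is \<open>x - y\<close> divided
  by the length of \<open>x + y\<close>. A degenerate rectangle admits every unit vector.\<close>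

lemma rectangle_direction:
  fixes x y :: "'a::euclidean_space"
  assumes "x \<bullet> y = 0"
  obtains s where "norm s = 1" "rx s (x + y) = x" "rx (- s) (x + y) = y"
proof (cases "x + y = 0")
  case True
  then have "y = - x" by (simp add: add_eq_0_iff)
  then have xy: "x = 0" "y = 0" using assms by auto
  obtain b :: 'a where "b \<in> Basis" using nonempty_Basis by blast
  then show thesis using that[of b] xy by (simp add: rx_def)
next
  case False
  have "(norm (x + y))\<^sup>2 = (norm (x - y))\<^sup>2"
    unfolding power2_norm_eq_inner inner_add_left inner_add_right inner_diff_left inner_diff_right inner_commute[of y x] assms by simp
  then have n: "norm (x - y) = norm (x + y)" by simp
  define s where "s = (1 / norm (x + y)) *\<^sub>R (x - y)"
  have "norm (x + y) *\<^sub>R s = x - y" using False by (simp add: s_def)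
  moreover have "norm s = 1" using n False by (simp add: s_def)
  moreover have "(1/2) *\<^sub>R ((x + y) + (x - y)) = x" "(1/2) *\<^sub>R ((x + y) - (x - y)) = y"
    by (simp_all add: algebra_simps flip: scaleR_add_left)
  ultimately show thesis using that[of s] by (simp add: rx_def)
qed

text \<open>The conditions are open in base point, diagonal and direction together, so the direction
  may be replaced by a close one in \<open>G\<close>. For almost every \<open>v\<close> near
  \<open>a\<close>, almost every \<open>u\<close> near \<open>x + y\<close> has its three vertices
  in \<open>S1\<close>, \<open>S2\<close> and \<open>S3\<close> themselves and not just in their
  essential interiors; one such \<open>u\<close> puts \<open>v\<close> into
  \<open>S4\<close>.\<close>

lemma essint_fourth_vertex:
  fixes S1 S2 S3 S4 :: "'a::euclidean_space set"
  assumes G: "dense_directions G"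
    and S[measurable]: "S1 \<in> sets borel" "S2 \<in> sets borel" "S3 \<in> sets borel" "S4 \<in> sets borel"
    and ae: "\<And>s. s \<in> G \<Longrightarrow> AE v in lborel. AE u in lborel. v + rx s u \<in> S1 \<longrightarrow> v + rx (- s) u \<in> S2 \<longrightarrow> v + u \<in> S3 \<longrightarrow> v \<in> S4"
    and xy: "x \<bullet> y = 0" and mem: "a + x \<in> essint S1" "a + y \<in> essint S2" "a + x + y \<in> essint S3"
  shows "a \<in> essint S4"
proof -
  obtain s0 where s0: "norm s0 = 1" "rx s0 (x + y) = x" "rx (- s0) (x + y) = y" using rectangle_direction[OF xy] .
  let ?V = "(\<lambda>p::'a \<times> 'a \<times> 'a. fst p + rx (snd (snd p)) (fst (snd p))) -` essint S1
     \<inter> (\<lambda>p. fst p + rx (- snd (snd p)) (fst (snd p))) -` essint S2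
     \<inter> (\<lambda>p. fst p + fst (snd p)) -` essint S3"
  have "open ?V" by (intro open_Int open_vimage open_essint S continuous_intros)
  moreover have "(a, x + y, s0) \<in> ?V" using s0 mem by (simp add: add.assoc)
  ultimately obtain A B where A: "open A" "a \<in> A" and B: "open B" "(x + y, s0) \<in> B" and AB: "A \<times> B \<subseteq> ?V"
    by (rule open_prod_elim) auto
  obtain C D where C: "open C" "x + y \<in> C" and D: "open D" "s0 \<in> D" and CD: "C \<times> D \<subseteq> B"
    using B by (rule open_prod_elim) auto
  obtain e where e: "0 < e" "ball a e \<subseteq> A" using A open_contains_ball by blast
  obtain f where f: "0 < f" "ball (x + y) f \<subseteq> C" using C open_contains_ball by blast
  obtain g where g: "0 < g" "ball s0 g \<subseteq> D" using D open_contains_ball by blast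
  obtain s where s: "s \<in> G" "dist s0 s < g" using G s0(1) g(1) unfolding dense_directions_def by blast
  have in_ess: "v + rx s u \<in> essint S1" "v + rx (- s) u \<in> essint S2" "v + u \<in> essint S3"
    if "v \<in> ball a e" "u \<in> ball (x + y) f" for v u
  proof -
    have "v \<in> A" "u \<in> C" "s \<in> D" using that s(2) e(2) f(2) g(2) by auto
    then have "(v, u, s) \<in> ?V" using AB CD by blast
    then show "v + rx s u \<in> essint S1" "v + rx (- s) u \<in> essint S2" "v + u \<in> essint S3" by auto
  qed
  have null: "AE v in lborel. AE u in lborel. v + h u \<notin> essint S' - S'"
    if "S' \<in> sets borel" "h \<in> borel_measurable borel" for S' and h :: "'a \<Rightarrow> 'a"
    using that open_essint[of S'] by (intro AE_shift_notin_null_set emeasure_essint_diff) auto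
  have m: "rx s \<in> borel_measurable borel" "rx (- s) \<in> borel_measurable borel" "(\<lambda>u. u) \<in> borel_measurable (borel :: 'a measure)"
    by measurable
  have "AE v in lborel. v \<in> ball a e \<longrightarrow> v \<in> S4"
    using ae[OF s(1)] null[OF S(1) m(1)] null[OF S(2) m(2)] null[OF S(3) m(3)]
  proof eventually_elim
    case (elim v)
    then have "AE u in lborel. v \<in> ball a e \<longrightarrow> u \<in> ball (x + y) f \<longrightarrow> v \<in> S4"
      by eventually_elim (use in_ess in blast)
    then have "\<exists>u\<in>ball (x + y) f. v \<in> ball a e \<longrightarrow> u \<in> ball (x + y) f \<longrightarrow> v \<in> S4"
      by (rule AE_imp_ex) (use emeasure_ball_pos[OF f(1), of "x + y"] in auto)
    then show ?case by blast
  qed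
  then show ?thesis by (rule essint_I[OF e(1) _ S(4)])
qed

lemma sphere_null_set: "sphere (p::'a::euclidean_space) r \<in> null_sets lborel"
proof -
  have "negligible (sphere p r)" by (rule negligible_sphere)
  then have "emeasure lebesgue (sphere p r) = 0" by (simp add: negligible_iff_null_sets null_sets_def)
  then show ?thesis by (simp add: null_sets_def)
qed

section \<open>Sets without rectangles of mixed type, up to null sets\<close>

locale collision_set =
  fixes G S :: "'a::euclidean_space set"
  assumes dim: "2 \<le> DIM('a)"
    and G: "dense_directions G"
    and S[measurable]: "S \<in> sets borel"
    and ae: "\<And>s. s \<in> G \<Longrightarrow> AE v in lborel. AE u in lborel.
      \<not> (v \<in> S \<and> v + u \<in> S \<and> v + rx s u \<notin> S \<and> v + rx (- s) u \<notin> S) \<and>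
      \<not> (v \<notin> S \<and> v + u \<notin> S \<and> v + rx s u \<in> S \<and> v + rx (- s) u \<in> S)"
begin

lemma complement: "collision_set G (- S)"
proof
  show "- S \<in> sets borel" using S by measurable
  fix s assume "s \<in> G"
  from ae[OF this] show "AE v in lborel. AE u in lborel.
      \<not> (v \<in> - S \<and> v + u \<in> - S \<and> v + rx s u \<notin> - S \<and> v + rx (- s) u \<notin> - S) \<and>
      \<not> (v \<notin> - S \<and> v + u \<notin> - S \<and> v + rx s u \<in> - S \<and> v + rx (- s) u \<in> - S)"
    by (simp add: conj_commute)
qed (rule dim, rule G)

text \<open>By \<open>rectangles_open\<close> such rectangles exist in positive measure at every
  base point near \<open>a\<close>. Almost none of these base points can be outside
  \<open>S\<close>, as they would complete a forbidden rectangle.\<close>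

lemma essint_I_rectangles:
  assumes s: "s \<in> G"
    and pos: "0 < emeasure lborel {u\<in>equator s \<inter> ball 0 r. a + rx s u \<in> S \<and> a + rx (- s) u \<in> S \<and> a + u \<in> - S}"
  shows "a \<in> essint S"
proof -
  have ns: "norm s = 1" using dense_directions_norm[OF G s] .
  have mS: "- S \<in> sets borel" by measurable
  obtain d where d: "0 < d" "\<And>b. dist a b < d \<Longrightarrow>
    0 < emeasure lborel {u\<in>equator s \<inter> ball 0 r. b + rx s u \<in> S \<and> b + rx (- s) u \<in> S \<and> b + u \<in> - S}"
    using rectangles_open[OF ns S S mS pos] by blast
  show ?thesis
  proof (rule essint_I[OF d(1) _ S])
    show "AE v in lborel. v \<in> ball a d \<longrightarrow> v \<in> S"
      using ae[OF s]
    proof eventually_elim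
      case (elim v)
      show ?case
      proof
        assume "v \<in> ball a d"
        then have "0 < emeasure lborel {u\<in>equator s \<inter> ball 0 r. v + rx s u \<in> S \<and> v + rx (- s) u \<in> S \<and> v + u \<in> - S}"
          using d(2) by simp
        moreover have "{u\<in>equator s \<inter> ball 0 r. v + rx s u \<in> S \<and> v + rx (- s) u \<in> S \<and> v + u \<in> - S} \<in> sets lborel"
          by measurable
        ultimately have "\<exists>u\<in>{u\<in>equator s \<inter> ball 0 r. v + rx s u \<in> S \<and> v + rx (- s) u \<in> S \<and> v + u \<in> - S}.
          \<not> (v \<in> S \<and> v + u \<in> S \<and> v + rx s u \<notin> S \<and> v + rx (- s) u \<notin> S) \<and>
          \<not> (v \<notin> S \<and> v + u \<notin> S \<and> v + rx s u \<in> S \<and> v + rx (- s) u \<in> S)"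
          by (intro AE_imp_ex[OF elim]) auto
        then show "v \<in> S" by auto
      qed
    qed
  qed
qed

text \<open>Suppose not. Then at each point of \<open>N\<close> almost no rectangle has both
  neighbours in \<open>S\<close> and the opposite vertex outside. But in a ball where
  \<open>S\<close> is dense there is a \<open>v\<close> outside \<open>S\<close> with many
  rectangles whose other three vertices are in \<open>S\<close>; seen from the vertex
  \<open>v + u\<close> these are just the excluded ones.\<close>

lemma essint_meets:
  assumes N: "open N" and pos: "0 < emeasure lborel (S \<inter> N)"
  shows "essint S \<inter> N \<noteq> {}"
proof
  assume disj: "essint S \<inter> N = {}"
  obtain s where s: "s \<in> G" using dense_directions_nonempty[OF G] .
  have ns: "norm s = 1" using dense_directions_norm[OF G s] .
  have mS[measurable]: "- S \<in> sets borel" by measurable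
  have Nb[measurable]: "N \<in> sets borel" using N by simp
  \<comment> \<open>The point \<open>v\<close> is sought in the ball of half the radius, and
    \<open>good_rectangles\<close> is applied around it with radius \<open>r / 2\<close>; hence the
    power of 2.\<close>
  define k where "k = good_density s / 2 ^ DIM('a)"
  have k: "0 < k" using equator_vol_pos[OF dim, of s] by (simp add: k_def good_density_def)
  obtain c r where r: "0 < r" and cN: "ball c r \<subseteq> N" and dens: "emeasure lborel (ball c r - S) < ennreal (k * r ^ DIM('a))"
    using exists_ball_of_large_density[OF S N pos k] .
  have rect: "AE u in lborel. u \<in> equator s \<inter> ball 0 r \<longrightarrow> \<not> (a + rx s u \<in> S \<and> a + rx (- s) u \<in> S \<and> a + u \<in> - S)"
    if "a \<in> N" for a
  proof -
    let ?J = "{u\<in>equator s \<inter> ball 0 r. a + rx s u \<in> S \<and> a + rx (- s) u \<in> S \<and> a + u \<in> - S}"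
    have "emeasure lborel ?J = 0"
      using essint_I_rectangles[OF s, of r a] that disj by (auto simp: zero_less_iff_neq_zero)
    moreover have "?J \<in> sets lborel" by measurable
    ultimately have "?J \<in> null_sets lborel" by (simp add: null_sets_def)
    then show ?thesis by (rule AE_I') auto
  qed
  define E where "E = equator s \<inter> ball 0 r"
  have E[measurable]: "E \<in> sets borel" unfolding E_def by measurable
  define P where "P a u \<longleftrightarrow> \<not> (a \<in> N \<and> u \<in> E \<and> a + rx s u \<in> S \<and> a + rx (- s) u \<in> S \<and> a + u \<notin> S)" for a u
  have P: "Measurable.pred (borel \<Otimes>\<^sub>M borel) (\<lambda>p. P (fst p) (snd p))"
    unfolding P_def by measurable
  have "AE a in lborel. AE u in lborel. P a u"
  proof (rule AE_I2)
    fix a :: 'a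
    show "AE u in lborel. P a u"
    proof (cases "a \<in> N")
      case True
      from rect[OF True] show ?thesis by eventually_elim (auto simp: P_def E_def)
    qed (simp add: P_def)
  qed
  from AE_opposite_vertex[OF P this] have ae1: "AE v in lborel. AE u in lborel. P (v + u) (- u)" .
  \<comment> \<open>Otherwise \<open>c\<close> itself would be in the essential interior of
    \<open>S\<close>.\<close>
  have "0 < emeasure lborel (ball c (r/2) - S)"
  proof (rule ccontr)
    assume "\<not> 0 < emeasure lborel (ball c (r/2) - S)"
    then have "c \<in> essint S" using r by (auto simp: essint_def intro!: exI[of _ "r/2"])
    then show False using disj cN r by (auto simp: subset_iff)
  qed
  then have "\<exists>v\<in>ball c (r/2) - S. AE u in lborel. P (v + u) (- u)"
    by (intro AE_imp_ex[OF ae1]) auto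
  then obtain v where v: "v \<in> ball c (r/2) - S" and aev: "AE u in lborel. P (v + u) (- u)" by blast
  have sub: "ball v (r/2) \<subseteq> ball c r"
  proof
    fix x assume "x \<in> ball v (r/2)"
    then show "x \<in> ball c r" using v dist_triangle[of c x v] by auto
  qed
  have "emeasure lborel (- S \<inter> ball v (r/2)) \<le> emeasure lborel (ball c r - S)"
    using sub by (intro emeasure_mono) auto
  also have "\<dots> < ennreal (good_density s * (r/2) ^ DIM('a))" using dens by (simp add: k_def power_divide)
  finally have "0 < emeasure lborel {u\<in>equator s \<inter> ball 0 (r/2). v + rx s u \<notin> - S \<and> v + rx (- s) u \<notin> - S \<and> v + u \<notin> - S}"
    using r by (intro good_rectangles[OF dim ns _ mS]) auto
  moreover have "{u\<in>equator s \<inter> ball 0 (r/2). v + rx s u \<notin> - S \<and> v + rx (- s) u \<notin> - S \<and> v + u \<notin> - S} \<in> sets lborel"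
    by measurable
  ultimately have "\<exists>u\<in>{u\<in>equator s \<inter> ball 0 (r/2). v + rx s u \<notin> - S \<and> v + rx (- s) u \<notin> - S \<and> v + u \<notin> - S}. P (v + u) (- u)"
    by (intro AE_imp_ex[OF aev]) auto
  then obtain u where u: "u \<in> equator s" "u \<in> ball 0 (r/2)" "v + rx s u \<in> S" "v + rx (- s) u \<in> S" "P (v + u) (- u)"
    by auto
  have "v + u \<in> N" using u(2) sub cN by (auto simp: dist_norm subset_iff)
  moreover have eq: "v + u + rx s (- u) = v + rx s u" "v + u + rx (- s) (- u) = v + rx (- s) u"
    using rx_minus[of s u] rx_minus[of "- s" u] rx_add_minus[of s u] by (auto simp: algebra_simps)
  moreover have "- u \<in> E" using u(1,2) r by (simp add: E_def)
  moreover have "v + u + (- u) \<notin> S" using v by simp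
  ultimately show False using u(3-5) unfolding P_def eq by blast
qed

text \<open>Every ball around a point outside \<open>essint (- S)\<close> meets \<open>S\<close> in
  positive measure, hence meets \<open>essint S\<close>. With the same for \<open>- S\<close>, this
  provides the exact setting of \<open>rectangle_dichotomy\<close>.\<close>

lemma closure_essint: "closure (essint S) = - essint (- S)"
proof
  have mS: "- S \<in> sets borel" by measurable
  have "essint S \<subseteq> - essint (- S)" using essint_disjoint[OF S] by auto
  moreover have "closed (- essint (- S))" using open_essint[OF mS] by auto
  ultimately show "closure (essint S) \<subseteq> - essint (- S)" by (rule closure_minimal)
  show "- essint (- S) \<subseteq> closure (essint S)"
  proof
    fix p assume p: "p \<in> - essint (- S)"
    show "p \<in> closure (essint S)"
      unfolding closure_approachable
    proof (intro allI impI)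
      fix e :: real assume e: "0 < e"
      have "ball p e - - S = S \<inter> ball p e" by auto
      then have "0 < emeasure lborel (S \<inter> ball p e)" using p e by (auto simp: essint_def zero_less_iff_neq_zero)
      from essint_meets[OF open_ball this] show "\<exists>y\<in>essint S. dist y p < e" by (auto simp: dist_commute)
    qed
  qed
qed

lemma no_rectangle:
  assumes "x \<bullet> y = 0" "a \<in> essint (- S)" "a + x \<in> essint S" "a + y \<in> essint S"
  shows "a + x + y \<notin> essint (- S)"
proof
  assume b: "a + x + y \<in> essint (- S)"
  have mS: "- S \<in> sets borel" by measurable
  have "a \<in> essint S"
  proof (rule essint_fourth_vertex[OF G S S mS S _ assms(1,3,4) b])
    fix s assume "s \<in> G"
    from ae[OF this] show "AE v in lborel. AE u in lborel. v + rx s u \<in> S \<longrightarrow> v + rx (- s) u \<in> S \<longrightarrow> v + u \<in> - S \<longrightarrow> v \<in> S"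
    proof eventually_elim
      case (elim v)
      then show ?case by eventually_elim auto
    qed
  qed
  then show False using essint_disjoint[OF S] assms(2) by blast
qed

text \<open>For almost every \<open>w\<close> in \<open>A\<close>, the rectangle with opposite
  vertices \<open>v\<close> and \<open>w\<close>, both in \<open>S\<close>, has a further vertex in
  \<open>S\<close>. So \<open>A\<close> is covered, up to a null set, by the preimages of
  \<open>S\<close> under two maps with the measure bound. As \<open>rx\<close> has Lipschitz
  constant 1, the images stay within \<open>L\<close> of the vertices belonging to the diagonal from
  \<open>v\<close> to 0.\<close>

lemma measure_image_bound:
  fixes v w :: 'a
  assumes s: "s \<in> G" and A[measurable]: "A \<in> sets borel"
    and AB: "A \<subseteq> ball 0 L" and eq: "\<And>w. w \<in> A \<Longrightarrow> w - v \<in> equator s"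
    and v: "v \<in> S" and AS: "A \<subseteq> S"
    and aev: "AE u in lborel. \<not> (v \<in> S \<and> v + u \<in> S \<and> v + rx s u \<notin> S \<and> v + rx (- s) u \<notin> S)"
  shows "emeasure lborel A \<le> ennreal (20 ^ DIM('a)) * (emeasure lborel (S \<inter> ball (v + rx s (- v)) L)
    + emeasure lborel (S \<inter> ball (v + rx (- s) (- v)) L))"
proof -
  have ns: "norm s = 1" "norm (- s) = 1" using dense_directions_norm[OF G s] by auto
  let ?B = "\<lambda>s. {u\<in>equator s. v + rx s u \<in> S \<inter> ball (v + rx s (- v)) L}"
  let ?N = "{u. v + u \<in> A \<and> v + rx s u \<notin> S \<and> v + rx (- s) u \<notin> S}"
  have B: "{u\<in>equator s'. v + rx s' u \<in> T} \<in> sets borel" if [measurable]: "T \<in> sets borel" for s' T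
    by measurable
  have m1: "?B s \<in> sets borel" by (intro B sets.Int S) simp
  have m2: "?B (- s) \<in> sets borel" by (intro B sets.Int S) simp
  have m3: "?N \<in> sets borel" by measurable
  note m[measurable] = m1 m2 m3
  have N0: "emeasure lborel ?N = 0"
  proof -
    have "AE u in lborel. u \<notin> ?N" using aev by eventually_elim (use v AS in auto)
    then show ?thesis using AE_iff_null_sets[of ?N lborel] m(3) by (auto simp: null_sets_def)
  qed
  have lip: "norm (rx t u - rx t u') \<le> norm (u - u')" if "norm t = 1" for t u u' :: 'a
  proof -
    have "rx t u - rx t u' = (1/2) *\<^sub>R ((u - u') + (norm u - norm u') *\<^sub>R t)"
      by (simp add: rx_def algebra_simps)
    then have "norm (rx t u - rx t u') \<le> (1/2) * (norm (u - u') + \<bar>norm u - norm u'\<bar>)"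
      using norm_triangle_ineq[of "u - u'" "(norm u - norm u') *\<^sub>R t"] that by simp
    then show ?thesis using norm_triangle_ineq3[of u u'] by simp
  qed
  have near: "v + rx t u \<in> ball (v + rx t (- v)) L" if "norm t = 1" "v + u \<in> A" for t u
    using lip[OF that(1), of u "- v"] that(2) AB by (auto simp: dist_norm norm_minus_commute add.commute subset_iff)
  have "{u. v + u \<in> A} \<subseteq> (?B s \<union> ?B (- s)) \<union> ?N"
  proof
    fix u assume "u \<in> {u. v + u \<in> A}"
    then have u: "v + u \<in> A" by simp
    have "u \<in> equator s" using eq[OF u] by simp
    then show "u \<in> (?B s \<union> ?B (- s)) \<union> ?N" using u near[OF ns(1) u] near[OF ns(2) u] by auto
  qed
  then have "emeasure lborel {u. v + u \<in> A} \<le> emeasure lborel ((?B s \<union> ?B (- s)) \<union> ?N)"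
    by (intro emeasure_mono) auto
  also have "\<dots> \<le> (emeasure lborel (?B s) + emeasure lborel (?B (- s))) + emeasure lborel ?N"
    by (intro order_trans[OF emeasure_subadditive] add_mono emeasure_subadditive) auto
  also have "\<dots> \<le> (ennreal (20 ^ DIM('a)) * emeasure lborel (S \<inter> ball (v + rx s (- v)) L)
    + ennreal (20 ^ DIM('a)) * emeasure lborel (S \<inter> ball (v + rx (- s) (- v)) L)) + 0"
    using N0 by (intro add_mono rx_vimage_measure_le ns) auto
  also have "\<dots> = ennreal (20 ^ DIM('a)) * (emeasure lborel (S \<inter> ball (v + rx s (- v)) L)
    + emeasure lborel (S \<inter> ball (v + rx (- s) (- v)) L))" by (simp add: distrib_left)
  also have "emeasure lborel {u. v + u \<in> A} = emeasure (distr lborel borel ((+) v)) A"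
    by (subst emeasure_distr) (auto simp: vimage_def)
  finally show ?thesis by (simp add: lborel_distr_plus)
qed

text \<open>Made for \<open>essentially_bounded\<close>. The rectangles with opposite vertices
  \<open>v\<close> and 0 have side vertices whose products with \<open>v\<close> depend on
  \<open>s i \<bullet> v\<close>, so the gaps separate them. Being nearly orthogonal to
  \<open>v\<close> keeps the diagonals in the cone \<open>equator (s i)\<close>.\<close>

lemma separated_directions:
  fixes v :: 'a
  assumes v: "v \<noteq> 0" and n: "0 < n"
  obtains s :: "nat \<Rightarrow> 'a" where "\<And>i. s i \<in> G"
    "\<And>i. i < n \<Longrightarrow> 0 < s i \<bullet> v \<and> s i \<bullet> v < norm v / 4"
    "\<And>i. i < n \<Longrightarrow> norm v / (16 * real n) \<le> 2 * (s i \<bullet> v)"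
    "\<And>i j. i < j \<Longrightarrow> j < n \<Longrightarrow> norm v / (16 * real n) \<le> s j \<bullet> v - s i \<bullet> v"
proof -
  obtain e where e: "norm e = 1" "e \<bullet> v = 0" using exists_orthogonal_unit[OF dim] .
  \<comment> \<open>\<open>\<tau> i\<close> is the intended cosine of the angle to \<open>v\<close>.
    The spacing is \<open>8 * d\<close>; passing to directions in \<open>G\<close> costs
    \<open>d\<close> at each end, and the remaining \<open>6 * d\<close> exceeds the required
    \<open>4 * d\<close>.\<close>
  define \<tau> where "\<tau> i = (real i + 1) / (8 * real n)" for i :: nat
  define d where "d = 1 / (64 * real n)"
  have d: "0 < d" using n by (simp add: d_def)
  define \<sigma> where "\<sigma> i = sqrt (1 - (\<tau> i)\<^sup>2) *\<^sub>R e + (\<tau> i / norm v) *\<^sub>R v" for i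
  have \<tau>: "8 * d \<le> \<tau> i" "\<tau> i \<le> 1/8" if "i < n" for i
    using that n by (auto simp: \<tau>_def d_def field_simps)
  have "\<exists>s\<in>G. i < n \<longrightarrow> dist (\<sigma> i) s < d" for i
  proof (cases "i < n")
    case True
    have "0 \<le> \<tau> i" using \<tau>[OF True] d by linarith
    then have "(\<tau> i)\<^sup>2 \<le> 1" using \<tau>(2)[OF True] by (simp add: abs_square_le_1)
    moreover have "\<sigma> i \<bullet> \<sigma> i = (sqrt (1 - (\<tau> i)\<^sup>2))\<^sup>2 * (e \<bullet> e) + (\<tau> i / norm v)\<^sup>2 * (v \<bullet> v)"
      unfolding \<sigma>_def inner_add_left inner_add_right inner_scaleR_left inner_scaleR_right inner_commute[of v e] e(2)
      by (simp add: power2_eq_square algebra_simps e(2) inner_commute)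
    ultimately have "\<sigma> i \<bullet> \<sigma> i = 1" using e(1) v by (simp add: norm_eq_1 power_divide power2_norm_eq_inner)
    then have "norm (\<sigma> i) = 1" by (simp add: norm_eq_1)
    then show ?thesis using G d unfolding dense_directions_def by blast
  next
    case False
    then show ?thesis using dense_directions_nonempty[OF G] by blast
  qed
  then obtain s where s: "\<And>i. s i \<in> G" "\<And>i. i < n \<Longrightarrow> dist (\<sigma> i) (s i) < d" by metis
  have \<sigma>v: "\<sigma> i \<bullet> v = \<tau> i * norm v" for i
    using v e(2) by (simp add: \<sigma>_def inner_add_left power2_norm_eq_inner[symmetric] power2_eq_square)
  have close: "\<bar>s i \<bullet> v - \<tau> i * norm v\<bar> \<le> d * norm v" if "i < n" for i
  proof -
    have "s i \<bullet> v - \<tau> i * norm v = (s i - \<sigma> i) \<bullet> v" by (simp add: inner_diff_left \<sigma>v)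
    then have "\<bar>s i \<bullet> v - \<tau> i * norm v\<bar> \<le> norm (s i - \<sigma> i) * norm v" using Cauchy_Schwarz_ineq2 by metis
    also have "\<dots> \<le> d * norm v" using s(2)[OF that] by (intro mult_right_mono) (auto simp: dist_norm norm_minus_commute)
    finally show ?thesis .
  qed
  have nv: "0 < norm v" using v by simp
  define D where "D = d * norm v"
  have D: "0 < D" using d nv by (simp add: D_def)
  have n16: "norm v / (16 * real n) = 4 * D" by (simp add: D_def d_def)
  have T: "8 * D \<le> \<tau> i * norm v" "\<tau> i * norm v \<le> norm v / 8" if "i < n" for i
    using mult_right_mono[OF \<tau>(1)[OF that], of "norm v"] mult_right_mono[OF \<tau>(2)[OF that], of "norm v"] by (auto simp: D_def)
  have D64: "D \<le> norm v / 64" using n nv by (simp add: D_def d_def field_simps)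
  show thesis
  proof (rule that[of s])
    show "s i \<in> G" for i by (rule s(1))
    show "0 < s i \<bullet> v \<and> s i \<bullet> v < norm v / 4" if "i < n" for i
      using close[OF that] T[OF that] D D64 nv unfolding D_def[symmetric] abs_le_iff by linarith
    show "norm v / (16 * real n) \<le> 2 * (s i \<bullet> v)" if "i < n" for i
      using close[OF that] T[OF that] D unfolding n16 D_def[symmetric] abs_le_iff by linarith
    show "norm v / (16 * real n) \<le> s j \<bullet> v - s i \<bullet> v" if ij: "i < j" "j < n" for i j
    proof -
      have "\<tau> i + 8 * d = (real i + 2) / (8 * real n)" using n by (simp add: \<tau>_def d_def field_simps)
      also have "\<dots> \<le> \<tau> j" unfolding \<tau>_def using ij by (intro divide_right_mono) auto
      finally have "\<tau> i + 8 * d \<le> \<tau> j" .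
      then have "(\<tau> i + 8 * d) * norm v \<le> \<tau> j * norm v" using nv by (intro mult_right_mono) auto
      then have "\<tau> i * norm v + 8 * D \<le> \<tau> j * norm v" by (simp add: D_def algebra_simps)
      then show ?thesis using close[of i] close[of j] ij D unfolding n16 D_def[symmetric] abs_le_iff by linarith
    qed
  qed
qed

text \<open>By \<open>measure_image_bound\<close>, a far point \<open>v\<close> of \<open>S\<close>
  and one direction exhibit two balls of radius \<open>L\<close> that together carry at least the
  measure of \<open>A\<close> divided by \<open>?K\<close>. With \<open>n\<close> separated
  directions all \<open>2 * n\<close> balls are disjoint, which is impossible for large
  \<open>n\<close> as \<open>S\<close> has finite measure.\<close>

lemma essentially_bounded:
  assumes pos: "0 < emeasure lborel S" and fin: "emeasure lborel S < \<infinity>"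
  obtains L where "emeasure lborel (S - ball 0 L) = 0"
proof -
  have "\<exists>k::nat. emeasure lborel (S \<inter> ball 0 (real k)) \<noteq> 0"
  proof (rule ccontr)
    assume "\<not> (\<exists>k::nat. emeasure lborel (S \<inter> ball 0 (real k)) \<noteq> 0)"
    then have "(\<Union>k::nat. S \<inter> ball 0 (real k)) \<in> null_sets lborel" by (intro null_sets_UN) (auto simp: null_sets_def)
    moreover have "S = (\<Union>k::nat. S \<inter> ball 0 (real k))"
    proof (intro equalityI subsetI)
      fix x assume x: "x \<in> S"
      obtain k :: nat where "norm x < real k" using reals_Archimedean2 by blast
      then show "x \<in> (\<Union>k::nat. S \<inter> ball 0 (real k))" using x by auto
    qed auto
    ultimately show False using pos by (auto simp: null_sets_def)
  qed
  then obtain k :: nat where k: "emeasure lborel (S \<inter> ball 0 (real k)) \<noteq> 0" by blast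
  define L where "L = real k + 1"
  define A where "A = S \<inter> ball 0 L"
  have A[measurable]: "A \<in> sets borel" unfolding A_def by measurable
  have L: "0 < L" by (simp add: L_def)
  let ?K = "20 ^ DIM('a) :: real"
  have eS: "emeasure lborel S = ennreal (measure lborel S)" using fin by (intro emeasure_eq_ennreal_measure) auto
  have "emeasure lborel A \<le> emeasure lborel S" by (intro emeasure_mono) (auto simp: A_def)
  then have finA: "emeasure lborel A \<noteq> \<infinity>" using fin by (auto simp: top_unique)
  then have eA: "emeasure lborel A = ennreal (measure lborel A)" by (intro emeasure_eq_ennreal_measure) auto
  have "emeasure lborel (S \<inter> ball 0 (real k)) \<le> emeasure lborel A" by (intro emeasure_mono) (auto simp: A_def L_def)
  then have mA: "0 < measure lborel A" using k eA by (cases "measure lborel A = 0") (auto simp: zero_less_measure_iff)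
  obtain n :: nat where n: "?K * measure lborel S / measure lborel A < real n" using reals_Archimedean2 by blast
  have "0 \<le> ?K * measure lborel S / measure lborel A" by simp
  then have "0 < real n" using n by linarith
  then have n0: "0 < n" by simp
  \<comment> \<open>The centres below are at least \<open>norm v / (32 * real n)\<close> apart; for
    \<open>norm v \<ge> M\<close> this is at least \<open>2 * L\<close>, so the balls are
    disjoint.\<close>
  define M where "M = 64 * real n * L"
  have M_ge: "64 * L \<le> M" using n0 L by (simp add: M_def)
  have Gc: "countable G" using G by (simp add: dense_directions_def)
  have "AE v in lborel. \<forall>s\<in>G. AE u in lborel. \<not> (v \<in> S \<and> v + u \<in> S \<and> v + rx s u \<notin> S \<and> v + rx (- s) u \<notin> S)"
    unfolding AE_ball_countable[OF Gc]
  proof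
    fix s assume "s \<in> G"
    from ae[OF this] show "AE v in lborel. AE u in lborel. \<not> (v \<in> S \<and> v + u \<in> S \<and> v + rx s u \<notin> S \<and> v + rx (- s) u \<notin> S)"
    proof eventually_elim
      case (elim v)
      then show ?case by eventually_elim auto
    qed
  qed
  then have "AE v in lborel. v \<notin> S - ball 0 M"
  proof eventually_elim
    case (elim v)
    show ?case
    proof
      assume "v \<in> S - ball 0 M"
      then have v: "v \<in> S" "M \<le> norm v" by auto
      have nv: "0 < norm v" "64 * L \<le> norm v" using v(2) M_ge L by linarith+
      then have v0: "v \<noteq> 0" by auto
      obtain s :: "nat \<Rightarrow> 'a" where s: "\<And>i. s i \<in> G"
        "\<And>i. i < n \<Longrightarrow> 0 < s i \<bullet> v \<and> s i \<bullet> v < norm v / 4"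
        "\<And>i. i < n \<Longrightarrow> norm v / (16 * real n) \<le> 2 * (s i \<bullet> v)"
        "\<And>i j. i < j \<Longrightarrow> j < n \<Longrightarrow> norm v / (16 * real n) \<le> s j \<bullet> v - s i \<bullet> v"
        using separated_directions[OF v0 n0] by blast
      define p where "p i b = v + rx (if b then s i else - s i) (- v)" for i and b :: bool
      have p: "p i b \<bullet> v = norm v / 2 * (norm v + (if b then s i \<bullet> v else - (s i \<bullet> v)))" for i b
        by (simp add: p_def rx_def inner_add_left power2_norm_eq_inner[symmetric] power2_eq_square algebra_simps)
      have gap: "norm v / (16 * real n) \<le> \<bar>(if b then s i \<bullet> v else - (s i \<bullet> v)) - (if c then s j \<bullet> v else - (s j \<bullet> v))\<bar>"
        if ij: "i < n" "j < n" "(i, b) \<noteq> (j, c)" for i j b c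
      proof -
        have g: "0 < s i \<bullet> v" "0 < s j \<bullet> v" using s(2) ij by auto
        show ?thesis
        proof (cases "b = c")
          case True
          then consider "i < j" | "j < i" using ij(3) by (cases i j rule: linorder_cases) auto
          then show ?thesis using True s(4)[of i j] s(4)[of j i] ij by cases auto
        next
          case False
          then show ?thesis using s(3)[OF ij(1)] s(3)[OF ij(2)] g by auto
        qed
      qed
      have disj: "ball (p i b) L \<inter> ball (p j c) L = {}" if ij: "i < n" "j < n" "(i, b) \<noteq> (j, c)" for i j b c
      proof -
        have "norm v / 2 * (norm v / (16 * real n)) \<le> norm v / 2 * \<bar>(if b then s i \<bullet> v else - (s i \<bullet> v)) - (if c then s j \<bullet> v else - (s j \<bullet> v))\<bar>"
          using gap[OF ij] by (intro mult_left_mono) auto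
        also have "\<dots> = \<bar>(p i b - p j c) \<bullet> v\<bar>"
          unfolding inner_diff_left p right_diff_distrib[symmetric] abs_mult by simp
        also have "\<dots> \<le> norm (p i b - p j c) * norm v" by (rule Cauchy_Schwarz_ineq2)
        finally have "norm v * (norm v / (32 * real n)) \<le> norm v * norm (p i b - p j c)" by (simp add: mult.commute)
        then have "norm v / (32 * real n) \<le> norm (p i b - p j c)" using nv(1) by (simp only: mult_le_cancel_left_pos)
        moreover have "2 * L \<le> norm v / (32 * real n)" using v(2) n0 by (simp add: M_def field_simps)
        ultimately have "2 * L \<le> dist (p i b) (p j c)" by (simp add: dist_norm)
        then have False if "dist (p i b) z < L" "dist (p j c) z < L" for z
          using dist_triangle2[of "p i b" "p j c" z] that by linarith
        then show ?thesis by (simp only: set_eq_iff Int_iff mem_ball empty_iff) blast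
      qed
      have le: "emeasure lborel A \<le> ennreal ?K * (emeasure lborel (S \<inter> ball (p i True) L) + emeasure lborel (S \<inter> ball (p i False) L))"
        if i: "i < n" for i
      proof -
        have eq: "w - v \<in> equator (s i)" if w: "w \<in> A" for w
        proof -
          have nw: "norm w < L" using w by (simp add: A_def)
          have "\<bar>w \<bullet> s i\<bar> \<le> norm w * norm (s i)" by (rule Cauchy_Schwarz_ineq2)
          then have "\<bar>w \<bullet> s i\<bar> \<le> norm w" using dense_directions_norm[OF G s(1)[of i]] by simp
          moreover have "\<bar>v \<bullet> s i\<bar> < norm v / 4" using s(2)[OF i] by (simp add: inner_commute)
          moreover have "norm v - norm w \<le> norm (w - v)" using norm_triangle_ineq2[of v w] by (simp add: norm_minus_commute)
          moreover have "\<bar>(w - v) \<bullet> s i\<bar> \<le> \<bar>w \<bullet> s i\<bar> + \<bar>v \<bullet> s i\<bar>" unfolding inner_diff_left by (rule abs_triangle_ineq4)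
          ultimately show ?thesis using nw nv L unfolding equator_def mem_Collect_eq by linarith
        qed
        show ?thesis
          using measure_image_bound[OF s(1) A _ eq v(1) _ elim[rule_format, OF s(1)], of L] by (simp add: A_def p_def)
      qed
      let ?I = "{..<n} \<times> (UNIV :: bool set)"
      have "(\<Sum>i<n. emeasure lborel A) \<le> (\<Sum>i<n. ennreal ?K * (emeasure lborel (S \<inter> ball (p i True) L) + emeasure lborel (S \<inter> ball (p i False) L)))"
        using le by (intro sum_mono) auto
      also have "\<dots> = ennreal ?K * (\<Sum>i<n. \<Sum>b\<in>UNIV. emeasure lborel (S \<inter> ball (p i b) L))"
        by (simp add: sum_distrib_left UNIV_bool add.commute)
      also have "(\<Sum>i<n. \<Sum>b\<in>UNIV. emeasure lborel (S \<inter> ball (p i b) L)) = (\<Sum>q\<in>?I. emeasure lborel (S \<inter> ball (p (fst q) (snd q)) L))"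
        by (simp add: sum.cartesian_product case_prod_beta)
      also have "\<dots> = emeasure lborel (\<Union>q\<in>?I. S \<inter> ball (p (fst q) (snd q)) L)"
      proof (rule sum_emeasure)
        show "disjoint_family_on (\<lambda>q. S \<inter> ball (p (fst q) (snd q)) L) ?I"
          unfolding disjoint_family_on_def
        proof (intro ballI impI)
          fix q q' assume "q \<in> ?I" "q' \<in> ?I" "q \<noteq> q'"
          then have "ball (p (fst q) (snd q)) L \<inter> ball (p (fst q') (snd q')) L = {}"
            by (intro disj) auto
          then show "S \<inter> ball (p (fst q) (snd q)) L \<inter> (S \<inter> ball (p (fst q') (snd q')) L) = {}" by blast
        qed
      qed auto
      also have "\<dots> \<le> emeasure lborel S" by (intro emeasure_mono) auto
      finally have "of_nat n * emeasure lborel A \<le> ennreal ?K * emeasure lborel S" by (simp add: mult_left_mono)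
      then have "ennreal (real n * measure lborel A) \<le> ennreal (?K * measure lborel S)"
        unfolding eA eS by (simp add: ennreal_mult ennreal_of_nat_eq_real_of_nat)
      then have "real n * measure lborel A \<le> ?K * measure lborel S" by (simp add: ennreal_le_iff)
      moreover have "?K * measure lborel S < real n * measure lborel A" using n mA by (simp add: field_simps)
      ultimately show False by linarith
    qed
  qed
  then have "emeasure lborel (S - ball 0 M) = 0"
    using AE_iff_null_sets[of "S - ball 0 M" lborel] by (auto simp: null_sets_def)
  then show thesis by (rule that)
qed

lemma ball_AE:
  assumes pos: "0 < emeasure lborel S" and fin: "emeasure lborel S < \<infinity>"
  obtains c R where "0 < R" "AE v in lborel. v \<in> S \<longleftrightarrow> v \<in> cball c R"
proof -
  interpret comp: collision_set G "- S" by (rule complement)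
  have neU: "essint S \<noteq> {}" using essint_meets[of UNIV] pos by auto
  obtain L where L: "emeasure lborel (S - ball 0 L) = 0" using essentially_bounded[OF pos fin] .
  have bU: "essint S \<subseteq> cball 0 L"
  proof (rule ccontr)
    assume "\<not> essint S \<subseteq> cball 0 L"
    then obtain p where p: "p \<in> essint S" "p \<notin> cball 0 L" by blast
    have "p \<in> essint (- S)"
    proof (rule essint_I)
      show "0 < dist p 0 - L" using p(2) by (simp add: dist_norm)
      have "S - ball 0 L \<in> null_sets lborel" using L by (auto simp: null_sets_def)
      from AE_not_in[OF this] show "AE v in lborel. v \<in> ball p (dist p 0 - L) \<longrightarrow> v \<in> - S"
      proof eventually_elim
        case (elim v)
        have "L < dist 0 v" if "v \<in> ball p (dist p 0 - L)"
          using that dist_triangle[of p 0 v] by (simp add: dist_commute)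
        then show ?case using elim by auto
      qed
    qed auto
    then show False using essint_disjoint[OF S p(1)] by blast
  qed
  interpret rectangle_dichotomy "essint S" "essint (- S)"
    by standard (use dim closure_essint comp.closure_essint no_rectangle in auto)
  obtain c R where cR: "0 < R" "closure (essint S) = cball c R"
    using closure_is_cball[OF bounded_subset[OF bounded_cball bU] neU] .
  have W: "essint (- S) = - cball c R" using closure_essint cR(2) by auto
  then have "closure (- cball c R) = - essint S" using comp.closure_essint by simp
  then have U: "essint S = ball c R" using cR(1) by (simp add: closure_complement)
  have n1: "ball c R - S \<in> null_sets lborel" using emeasure_essint_diff[OF S] U by (auto simp: null_sets_def)
  have n2: "- cball c R - - S \<in> null_sets lborel" using emeasure_essint_diff[of "- S"] W by (auto simp: null_sets_def)
  have "AE v in lborel. v \<in> S \<longleftrightarrow> v \<in> cball c R"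
    using AE_not_in[OF n1] AE_not_in[OF n2] AE_not_in[OF sphere_null_set[of c R]] by eventually_elim auto
  then show thesis using that cR(1) by blast
qed

end

subsection \<open>Functions with equal sums over the diagonals of rectangles\<close>

text \<open>Moving negative terms to the other side reduces additivity on the line to nonnegative
  arguments; rational multiples and continuity do the rest.\<close>

lemma continuous_additive_real:
  fixes h :: "real \<Rightarrow> real"
  assumes pos: "\<And>s t. 0 \<le> s \<Longrightarrow> 0 \<le> t \<Longrightarrow> h (s + t) = h s + h t"
    and opp: "\<And>t. h (- t) = - h t" and cont: "continuous_on UNIV h"
  shows "h t = t * h 1"
proof -
  have add: "h (a + b) = h a + h b" for a b
  proof -
    consider "0 \<le> a" "0 \<le> b" | "a \<le> 0" "b \<le> 0" | "0 \<le> a + b" "b \<le> 0" | "0 \<le> a + b" "a \<le> 0"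
      | "a + b \<le> 0" "0 \<le> b" | "a + b \<le> 0" "0 \<le> a" by linarith
    then show ?thesis
    proof cases
      case 1 then show ?thesis by (rule pos)
    next
      case 2 then show ?thesis using pos[of "- a" "- b"] opp[of "a + b"] opp[of a] opp[of b] by simp
    next
      case 3 then show ?thesis using pos[of "a + b" "- b"] opp[of b] by simp
    next
      case 4 then show ?thesis using pos[of "a + b" "- a"] opp[of a] by simp
    next
      case 5 then show ?thesis using pos[of "- (a + b)" b] opp[of "a + b"] opp[of a] by simp
    next
      case 6 then show ?thesis using pos[of "- (a + b)" a] opp[of "a + b"] opp[of b] by simp
    qed
  qed
  interpret additive h by standard (rule add)
  have nat: "h (real n * s) = real n * h s" for n s
    by (induction n) (simp_all add: zero add distrib_right)
  have int: "h (of_int k * s) = of_int k * h s" for k :: int and s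
    using nat[of "nat k" s] nat[of "nat (- k)" s] minus[of "of_int (- k) * s"] by (cases "0 \<le> k") auto
  have rat: "h q = q * h 1" if q: "q \<in> \<rat>" for q :: real
  proof -
    obtain a b :: int where ab: "0 < b" "q = of_int a / of_int b" using q by (auto elim: Rats_cases')
    then have "of_int b * h q = h (of_int a)" using int[of b q] by simp
    also have "\<dots> = of_int a * h 1" using int[of a 1] by simp
    finally have "h q = of_int a * h 1 / of_int b" using ab(1) by (subst eq_divide_eq) (simp add: mult.commute)
    then show ?thesis by (simp add: ab(2))
  qed
  have "closed {t. h t = t * h 1}" by (intro closed_Collect_eq cont continuous_intros)
  moreover have "\<rat> \<subseteq> {t. h t = t * h 1}" using rat by blast
  ultimately have "closure \<rat> \<subseteq> {t. h t = t * h 1}" by (rule closure_minimal[rotated])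
  then show ?thesis by (auto simp: Rats_closure_real)
qed

locale orthogonally_additive =
  fixes g :: "'a::euclidean_space \<Rightarrow> real"
  assumes dim: "2 \<le> DIM('a)"
    and orth_add: "\<And>x y. x \<bullet> y = 0 \<Longrightarrow> g (x + y) = g x + g y"
    and cont: "continuous_on UNIV g"
begin

lemma zero: "g 0 = 0"
proof -
  have "g (0 + 0) = g 0 + g 0" by (rule orth_add) simp
  then show ?thesis by simp
qed

lemma sum_axes: "g v = (\<Sum>i\<in>Basis. g ((v \<bullet> i) *\<^sub>R i))"
proof -
  have "g (\<Sum>i\<in>F. (v \<bullet> i) *\<^sub>R i) = (\<Sum>i\<in>F. g ((v \<bullet> i) *\<^sub>R i))" if "finite F" "F \<subseteq> Basis" for F
    using that
  proof (induction F rule: finite_induct)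
    case (insert j F)
    have "((v \<bullet> j) *\<^sub>R j) \<bullet> (\<Sum>i\<in>F. (v \<bullet> i) *\<^sub>R i) = 0"
      unfolding inner_sum_right
    proof (intro sum.neutral ballI)
      fix i assume "i \<in> F"
      then have "j \<noteq> i" "i \<in> Basis" "j \<in> Basis" using insert by auto
      then show "((v \<bullet> j) *\<^sub>R j) \<bullet> ((v \<bullet> i) *\<^sub>R i) = 0" by (simp add: inner_not_same_Basis)
    qed
    then show ?case using insert orth_add by simp
  qed (simp add: zero)
  from this[of Basis] show ?thesis by (simp add: euclidean_representation)
qed

text \<open>Additivity along a line comes from the pair \<open>a e + c d\<close>, \<open>b e - c d\<close> with \<open>d\<close> a unit vector orthogonal to \<open>e\<close>
  and \<open>c\<^sup>2 = a b\<close>, which is orthogonal.\<close>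

lemma odd_linear:
  assumes odd: "\<And>x. g (- x) = - g x"
  shows "g v = (\<Sum>i\<in>Basis. g i *\<^sub>R i) \<bullet> v"
proof -
  have axis: "g (t *\<^sub>R e) = t * g e" if e: "norm e = 1" for t e
  proof -
    obtain d where d: "norm d = 1" "d \<bullet> e = 0" using exists_orthogonal_unit[OF dim] .
    have ee: "e \<bullet> e = 1" "d \<bullet> d = 1" "e \<bullet> d = 0" using e d by (auto simp: norm_eq_1 inner_commute)
    have pos: "g ((a + b) *\<^sub>R e) = g (a *\<^sub>R e) + g (b *\<^sub>R e)" if "0 \<le> a" "0 \<le> b" for a b
    proof -
      define c where "c = sqrt (a * b)"
      have c: "c * c = a * b" using that by (simp add: c_def)
      have "(a *\<^sub>R e + c *\<^sub>R d) \<bullet> (b *\<^sub>R e - c *\<^sub>R d) = 0"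
        by (simp add: inner_add_left inner_diff_right ee d c)
      from orth_add[OF this] have "g ((a + b) *\<^sub>R e) = g (a *\<^sub>R e + c *\<^sub>R d) + g (b *\<^sub>R e + - (c *\<^sub>R d))"
        by (simp add: algebra_simps)
      also have "\<dots> = (g (a *\<^sub>R e) + g (c *\<^sub>R d)) + (g (b *\<^sub>R e) + g (- (c *\<^sub>R d)))"
        by (intro arg_cong2[where f = "(+)"] orth_add) (auto simp: ee)
      finally show ?thesis by (simp add: odd)
    qed
    have opp: "g ((- a) *\<^sub>R e) = - g (a *\<^sub>R e)" for a using odd[of "a *\<^sub>R e"] by simp
    have "g (t *\<^sub>R e) = t * g (1 *\<^sub>R e)"
      by (rule continuous_additive_real[of "\<lambda>t. g (t *\<^sub>R e)", OF pos opp])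
        (auto intro!: continuous_on_compose2[OF cont] continuous_intros)
    then show ?thesis by simp
  qed
  show ?thesis
    unfolding sum_axes[of v] inner_sum_left by (intro sum.cong) (auto simp: axis inner_commute)
qed

text \<open>Vectors of equal norm are \<open>p + m\<close> and \<open>p - m\<close> with orthogonal
  \<open>p\<close> and \<open>m\<close>, so an even \<open>g\<close> has the same value at
  both.\<close>

lemma even_radial:
  assumes even: "\<And>x. g (- x) = g x"
  obtains c where "\<And>v. g v = c * (norm v)\<^sup>2"
proof -
  have radial: "g x = g y" if xy: "norm x = norm y" for x y
  proof -
    define p where "p = (1/2) *\<^sub>R (x + y)"
    define m where "m = (1/2) *\<^sub>R (x - y)"
    have "x \<bullet> x = y \<bullet> y" using xy by (simp add: norm_eq)
    then have pm: "p \<bullet> m = 0" by (simp add: p_def m_def algebra_simps inner_add_left inner_diff_right inner_commute)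
    then have pm': "p \<bullet> - m = 0" by simp
    have "p + m = (1/2) *\<^sub>R (x + x)" "p + - m = (1/2) *\<^sub>R (y + y)"
      unfolding p_def m_def by (simp_all add: algebra_simps)
    then have "x = p + m" "y = p + - m" by simp_all
    then show ?thesis using orth_add[OF pm] orth_add[OF pm'] even[of m] by simp
  qed
  obtain e :: 'a where e: "norm e = 1" using vector_choose_size[of 1] by auto
  obtain d where d: "norm d = 1" "d \<bullet> e = 0" using exists_orthogonal_unit[OF dim] .
  \<comment> \<open>\<open>g\<close> as a function of the squared norm, extended oddly. By
    Pythagoras, adding orthogonal vectors adds the arguments of \<open>h\<close>.\<close>
  define h where "h t = (if 0 \<le> t then g (sqrt t *\<^sub>R e) else - g (sqrt (- t) *\<^sub>R e))" for t
  have h0: "h 0 = 0" by (simp add: h_def zero)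
  have opp: "h (- t) = - h t" for t by (auto simp: h_def zero)
  have pos: "h (s + t) = h s + h t" if "0 \<le> s" "0 \<le> t" for s t
  proof -
    have o: "(sqrt s *\<^sub>R e) \<bullet> (sqrt t *\<^sub>R d) = 0" using d by (simp add: inner_commute)
    then have "(norm (sqrt s *\<^sub>R e + sqrt t *\<^sub>R d))\<^sup>2 = s + t"
      using that e d by (simp add: norm_add_Pythagorean orthogonal_def)
    then have "norm (sqrt s *\<^sub>R e + sqrt t *\<^sub>R d) = norm (sqrt (s + t) *\<^sub>R e)"
      using that e by (simp add: real_sqrt_unique)
    then have "g (sqrt (s + t) *\<^sub>R e) = g (sqrt s *\<^sub>R e + sqrt t *\<^sub>R d)" using radial by metis
    also have "\<dots> = g (sqrt s *\<^sub>R e) + g (sqrt t *\<^sub>R d)" by (rule orth_add[OF o])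
    also have "g (sqrt t *\<^sub>R d) = g (sqrt t *\<^sub>R e)" by (rule radial) (simp add: e d)
    finally show ?thesis using that by (simp add: h_def)
  qed
  have "continuous_on ({0..} \<union> {..0}) h"
  proof (rule continuous_on_closed_Un)
    show "continuous_on {0..} h"
      by (rule continuous_on_eq[of _ "\<lambda>t. g (sqrt t *\<^sub>R e)"])
        (auto simp: h_def intro!: continuous_on_compose2[OF cont] continuous_intros)
    show "continuous_on {..0} h"
      by (rule continuous_on_eq[of _ "\<lambda>t. - g (sqrt (- t) *\<^sub>R e)"])
        (auto simp: h_def zero intro!: continuous_on_compose2[OF cont] continuous_intros)
  qed auto
  moreover have "{0..} \<union> {..0} = (UNIV :: real set)" by auto
  ultimately have "continuous_on UNIV h" by simp
  then have "h t = t * h 1" for t using continuous_additive_real[of h, OF pos opp] by blast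
  moreover have "g v = h ((norm v)\<^sup>2)" for v
    using radial[of v "norm v *\<^sub>R e"] e by (simp add: h_def)
  ultimately have "g v = h 1 * (norm v)\<^sup>2" for v by (metis mult.commute)
  then show thesis by (rule that)
qed

end

text \<open>With \<open>x\<close> and \<open>y\<close> also \<open>- x\<close> and
  \<open>- y\<close> are orthogonal, so the even and odd parts of \<open>q - q 0\<close> are both
  orthogonally additive. They yield the quadratic and the linear term.\<close>

lemma rectangle_function_quadratic:
  fixes q :: "'a::euclidean_space \<Rightarrow> real"
  assumes dim: "2 \<le> DIM('a)" and cont: "continuous_on UNIV q"
    and rect: "\<And>x y. x \<bullet> y = 0 \<Longrightarrow> q 0 + q (x + y) = q x + q y"
  obtains b c where "\<And>v. q v = q 0 + b \<bullet> v + c * (norm v)\<^sup>2"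
proof -
  have [continuous_intros]: "continuous_on A (\<lambda>x. q (- x))" "continuous_on A q" for A
    by (auto intro!: continuous_on_compose2[OF cont] continuous_intros)
  have rect': "q (- x - y) = q (- x) + q (- y) - q 0" if "x \<bullet> y = 0" for x y
    using rect[of "- x" "- y"] that by simp
  interpret ev: orthogonally_additive "\<lambda>x. (q x + q (- x)) / 2 - q 0"
  proof
    show "continuous_on UNIV (\<lambda>x. (q x + q (- x)) / 2 - q 0)" by (intro continuous_intros) auto
    fix x y :: 'a assume "x \<bullet> y = 0"
    then show "((q (x + y) + q (- (x + y))) / 2 - q 0) = ((q x + q (- x)) / 2 - q 0) + ((q y + q (- y)) / 2 - q 0)"
      using rect[of x y] rect'[of x y] by (simp add: field_simps)
  qed (rule dim)
  interpret od: orthogonally_additive "\<lambda>x. (q x - q (- x)) / 2"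
  proof
    show "continuous_on UNIV (\<lambda>x. (q x - q (- x)) / 2)" by (intro continuous_intros) auto
    fix x y :: 'a assume "x \<bullet> y = 0"
    then show "((q (x + y) - q (- (x + y))) / 2) = ((q x - q (- x)) / 2) + ((q y - q (- y)) / 2)"
      using rect[of x y] rect'[of x y] by (simp add: field_simps)
  qed (rule dim)
  obtain c where c: "\<And>v. (q v + q (- v)) / 2 - q 0 = c * (norm v)\<^sup>2" using ev.even_radial by force
  define b where "b = (\<Sum>i\<in>Basis. ((q i - q (- i)) / 2) *\<^sub>R i)"
  have b: "(q v - q (- v)) / 2 = b \<bullet> v" for v unfolding b_def by (rule od.odd_linear) (simp add: field_simps)
  have "q v = q 0 + b \<bullet> v + c * (norm v)\<^sup>2" for v using b[of v] c[of v] by (simp add: field_simps)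
  then show thesis by (rule that)
qed

lemma continuous_AE_zero:
  fixes D :: "'a::euclidean_space \<Rightarrow> real"
  assumes cont: "continuous_on UNIV D" and ae: "AE u in lborel. D u = 0"
  shows "D u = 0"
proof (rule ccontr)
  assume u: "D u \<noteq> 0"
  have "open {u. D u \<noteq> 0}" by (intro open_Collect_neq cont continuous_intros)
  then obtain e where e: "0 < e" "ball u e \<subseteq> {u. D u \<noteq> 0}" using u open_contains_ball by blast
  have "\<exists>x\<in>ball u e. D x = 0"
    using emeasure_ball_pos[OF e(1), of u] by (intro AE_imp_ex[OF ae]) auto
  then show False using e(2) by auto
qed

lemma AE_negligible:
  assumes m: "{v. \<not> P v} \<in> sets borel" and ae: "AE v in lborel. P v"
  shows "negligible {v. \<not> P v}"
proof -
  have "{v. \<not> P v} \<in> null_sets lborel" using ae AE_iff_null_sets[of "{v. \<not> P v}" lborel] m by simp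
  then show ?thesis unfolding negligible_iff_null_sets by (rule null_sets_completionI)
qed

lemma continuous_on_box_integral:
  fixes f :: "'a::euclidean_space \<Rightarrow> real"
  assumes int: "\<And>a b. f integrable_on cbox a b" and h: "0 \<le> h"
  shows "continuous_on UNIV (\<lambda>v. integral (cbox v (v + h *\<^sub>R One)) f)"
proof (clarsimp simp: continuous_on_iff)
  fix v :: 'a and e :: real assume e: "0 < e"
  let ?B = "cbox (v - One) (v + (h + 1) *\<^sub>R One)"
  have mem: "w \<in> ?B" "w + h *\<^sub>R One \<in> ?B" if "norm (w - v) \<le> 1" for w
  proof -
    have "\<bar>(w - v) \<bullet> i\<bar> \<le> 1" if "i \<in> Basis" for i
      using Basis_le_norm[OF that, of "w - v"] \<open>norm (w - v) \<le> 1\<close> by linarith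
    then have "- 1 \<le> (w - v) \<bullet> i \<and> (w - v) \<bullet> i \<le> 1" if "i \<in> Basis" for i using that abs_le_iff by fastforce
    then have "v \<bullet> i - 1 \<le> w \<bullet> i \<and> w \<bullet> i \<le> v \<bullet> i + 1" if "i \<in> Basis" for i
      using that by (fastforce simp: inner_diff_left)
    then show "w \<in> ?B" "w + h *\<^sub>R One \<in> ?B"
      using h by (fastforce simp: mem_box inner_diff_left inner_add_left)+
  qed
  have "v \<in> ?B" "v + h *\<^sub>R One \<in> ?B" using mem[of v] by simp_all
  then obtain d where d: "0 < d" "\<And>c' d'. c' \<in> ?B \<Longrightarrow> d' \<in> ?B \<Longrightarrow> norm (c' - v) \<le> d \<Longrightarrow> norm (d' - (v + h *\<^sub>R One)) \<le> d
      \<Longrightarrow> norm (integral (cbox c' d') f - integral (cbox v (v + h *\<^sub>R One)) f) < e"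
    using indefinite_integral_continuous[OF int _ _ e, of v "v - One" "v + (h + 1) *\<^sub>R One" "v + h *\<^sub>R One"] by blast
  show "\<exists>d>0. \<forall>w. dist w v < d \<longrightarrow> dist (integral (cbox w (w + h *\<^sub>R One)) f) (integral (cbox v (v + h *\<^sub>R One)) f) < e"
  proof (intro exI conjI allI impI)
    show "0 < min d 1" using d(1) by simp
    fix w assume "dist w v < min d 1"
    then have w: "norm (w - v) \<le> d" "norm (w - v) \<le> 1" by (auto simp: dist_norm)
    have "norm (integral (cbox w (w + h *\<^sub>R One)) f - integral (cbox v (v + h *\<^sub>R One)) f) < e"
      by (rule d(2)) (use mem[OF w(2)] w in auto)
    then show "dist (integral (cbox w (w + h *\<^sub>R One)) f) (integral (cbox v (v + h *\<^sub>R One)) f) < e"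
      by (simp add: dist_norm)
  qed
qed

section \<open>Local boundedness and box averages\<close>

locale AE_rectangle_function =
  fixes G :: "'a::euclidean_space set" and \<phi> :: "'a \<Rightarrow> real"
  assumes dim: "2 \<le> DIM('a)"
    and G: "dense_directions G"
    and \<phi>[measurable]: "\<phi> \<in> borel_measurable borel"
    and ae: "\<And>s. s \<in> G \<Longrightarrow> AE v in lborel. AE u in lborel. \<phi> v + \<phi> (v + u) = \<phi> (v + rx s u) + \<phi> (v + rx (- s) u)"
begin

text \<open>Needed for averages to exist, since \<open>\<phi>\<close> is only known to be
  measurable. For large \<open>k\<close> the set where \<open>\<bar>\<phi>\<bar>\<close> exceeds
  \<open>k\<close> is too small in a fixed ball to obstruct \<open>good_rectangles\<close>. So
  almost every \<open>v\<close> has a rectangle with values at most \<open>k\<close> in modulus at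
  the other three vertices, and \<open>\<phi> v\<close> is a signed sum of these.\<close>

lemma locally_bounded:
  assumes R: "0 < R"
  obtains K where "AE v in lborel. v \<in> ball p R \<longrightarrow> \<bar>\<phi> v\<bar> \<le> K"
proof -
  obtain s where s: "s \<in> G" using dense_directions_nonempty[OF G] .
  have ns: "norm s = 1" using dense_directions_norm[OF G s] .
  define N where "N k = {x. real k < \<bar>\<phi> x\<bar>} \<inter> ball p (2 * R)" for k :: nat
  have [measurable]: "N k \<in> sets borel" for k unfolding N_def by measurable
  have "(\<lambda>k. emeasure lborel (N k)) \<longlonglongrightarrow> emeasure lborel (\<Inter>k. N k)"
  proof (rule Lim_emeasure_decseq)
    show "decseq N" unfolding decseq_def N_def by force
    show "emeasure lborel (N k) \<noteq> \<infinity>" for k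
    proof -
      have "emeasure lborel (N k) \<le> emeasure lborel (ball p (2 * R))" by (intro emeasure_mono) (auto simp: N_def)
      also have "\<dots> < \<infinity>" by (rule emeasure_lborel_ball_finite)
      finally show ?thesis by simp
    qed
  qed auto
  moreover have "(\<Inter>k. N k) = {}"
  proof -
    have False if "x \<in> (\<Inter>k. N k)" for x
    proof -
      obtain k :: nat where "\<bar>\<phi> x\<bar> < real k" using reals_Archimedean2 by blast
      moreover have "x \<in> N k" using that by blast
      ultimately show False by (simp add: N_def)
    qed
    then show ?thesis by blast
  qed
  ultimately have "(\<lambda>k. emeasure lborel (N k)) \<longlonglongrightarrow> 0" by simp
  moreover have "0 < ennreal (good_density s * R ^ DIM('a))"
    using equator_vol_pos[OF dim, of s] R by (simp add: good_density_def)
  ultimately have "\<forall>\<^sub>F k in sequentially. emeasure lborel (N k) < ennreal (good_density s * R ^ DIM('a))"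
    by (rule order_tendstoD(2))
  then obtain k where k: "emeasure lborel (N k) < ennreal (good_density s * R ^ DIM('a))"
    by (auto simp: eventually_sequentially)
  have "AE v in lborel. v \<in> ball p R \<longrightarrow> \<bar>\<phi> v\<bar> \<le> 3 * real k"
    using ae[OF s]
  proof eventually_elim
    case (elim v)
    show ?case
    proof
      assume v: "v \<in> ball p R"
      let ?S = "{x. real k < \<bar>\<phi> x\<bar>}"
      have S[measurable]: "?S \<in> sets borel" by measurable
      have "x \<in> ball p (2 * R)" if "x \<in> ball v R" for x
        using v that dist_triangle[of p x v] by simp
      then have "?S \<inter> ball v R \<subseteq> N k" by (auto simp: N_def)
      then have "emeasure lborel (?S \<inter> ball v R) \<le> emeasure lborel (N k)" by (intro emeasure_mono) auto
      then have "emeasure lborel (?S \<inter> ball v R) < ennreal (good_density s * R ^ DIM('a))" using k by (rule le_less_trans)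
      from good_rectangles[OF dim ns R S this]
      have "emeasure lborel {u\<in>equator s \<inter> ball 0 R. v + rx s u \<notin> ?S \<and> v + rx (- s) u \<notin> ?S \<and> v + u \<notin> ?S} \<noteq> 0"
        (is "emeasure lborel ?E \<noteq> 0") by simp
      moreover have "?E \<in> sets lborel" by simp
      ultimately obtain u where u: "u \<in> ?E" "\<phi> v + \<phi> (v + u) = \<phi> (v + rx s u) + \<phi> (v + rx (- s) u)"
        using AE_imp_ex[OF elim] by blast
      then show "\<bar>\<phi> v\<bar> \<le> 3 * real k" by auto
    qed
  qed
  then show thesis by (rule that)
qed

lemma integrable_on_cbox: "\<phi> integrable_on cbox a b"
proof -
  obtain R where R: "0 < R" "cbox a b \<subseteq> ball 0 R" using bounded_subset_ballD[OF bounded_cbox, of a b 0] by blast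
  obtain K where K: "AE v in lborel. v \<in> ball 0 R \<longrightarrow> \<bar>\<phi> v\<bar> \<le> K" using locally_bounded[OF R(1)] .
  have "integrable lborel (\<lambda>x. indicator (cbox a b) x *\<^sub>R \<phi> x)"
  proof (rule integrableI_bounded_set[where A = "cbox a b" and B = K])
    show "AE x in lborel. x \<in> cbox a b \<longrightarrow> norm (indicator (cbox a b) x *\<^sub>R \<phi> x) \<le> K"
      using K by eventually_elim (use R in auto)
    show "emeasure lborel (cbox a b) < \<infinity>" by (rule emeasure_bounded_finite[OF bounded_cbox])
  qed auto
  then have "set_integrable lborel (cbox a b) \<phi>" by (simp add: set_integrable_def)
  then show ?thesis by (rule set_borel_integral_eq_integral(1))
qed

lemma borel_defect: "{v. \<phi> v + \<phi> (v + u) \<noteq> \<phi> (v + a) + \<phi> (v + b)} \<in> sets borel"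
  by measurable

lemma borel_defect_pair:
  assumes [measurable]: "h \<in> borel_measurable borel" "k \<in> borel_measurable borel"
  shows "Measurable.pred (borel \<Otimes>\<^sub>M borel)
    (\<lambda>p. \<phi> (fst p) + \<phi> (fst p + snd p) = \<phi> (fst p + h (snd p)) + \<phi> (fst p + k (snd p)))"
  by measurable

text \<open>Integration over the base point removes the exceptional null set in \<open>v\<close>,
  continuity of \<open>F\<close> that in \<open>u\<close>, and density of \<open>G\<close> the
  restriction on the direction.\<close>

lemma box_integral_rectangle:
  assumes h: "0 \<le> h" and xy: "x \<bullet> y = 0"
  defines "F \<equiv> \<lambda>v. integral (cbox v (v + h *\<^sub>R One)) \<phi>"
  shows "F p + F (p + x + y) = F (p + x) + F (p + y)"
proof -
  have cF: "continuous_on UNIV F" unfolding F_def by (rule continuous_on_box_integral[OF integrable_on_cbox h])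
  have [continuous_intros]: "continuous_on A g \<Longrightarrow> continuous_on A (\<lambda>z. F (g z))" for A and g :: "'a \<Rightarrow> 'a"
    by (rule continuous_on_compose2[OF cF]) auto
  have G_eq: "F p + F (p + u) = F (p + rx s u) + F (p + rx (- s) u)" if s: "s \<in> G" for s u p
  proof -
    have "AE u in lborel. AE v in lborel. \<phi> v + \<phi> (v + u) = \<phi> (v + rx s u) + \<phi> (v + rx (- s) u)"
    proof -
      let ?P = "\<lambda>v u. \<phi> v + \<phi> (v + u) = \<phi> (v + rx s u) + \<phi> (v + rx (- s) u)"
      have "Measurable.pred (borel \<Otimes>\<^sub>M borel) (\<lambda>p. ?P (fst p) (snd p))"
        by (rule borel_defect_pair) measurable
      from AE_lborel_commute[of ?P, OF this] ae[OF s] show ?thesis by (rule iffD1)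
    qed
    then have "AE u in lborel. F p + F (p + u) - (F (p + rx s u) + F (p + rx (- s) u)) = 0"
    proof eventually_elim
      case (elim u)
      let ?B = "cbox p (p + h *\<^sub>R One)"
      have sh: "integral ?B (\<lambda>v. \<phi> (v + c)) = F (p + c)" "(\<lambda>v. \<phi> (v + c)) integrable_on ?B" for c
      proof -
        show "integral ?B (\<lambda>v. \<phi> (v + c)) = F (p + c)"
          using integral_shift_cbox_plus[of p "p + h *\<^sub>R One" \<phi> c] by (simp add: F_def o_def add_ac)
        show "(\<lambda>v. \<phi> (v + c)) integrable_on ?B"
          using integrable_on_shift_cbox[of \<phi> c p "p + h *\<^sub>R One"] integrable_on_cbox by (simp add: o_def add_ac)
      qed
      have m: "{v. \<phi> v + \<phi> (v + u) \<noteq> \<phi> (v + rx s u) + \<phi> (v + rx (- s) u)} \<in> sets borel"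
        by (rule borel_defect)
      have neg: "negligible {v. \<phi> v + \<phi> (v + u) \<noteq> \<phi> (v + rx s u) + \<phi> (v + rx (- s) u)}"
        by (rule AE_negligible[OF m elim])
      have i1: "\<phi> integrable_on ?B" by (rule integrable_on_cbox)
      have i2: "(\<lambda>v. \<phi> (v + u)) integrable_on ?B" by (rule sh(2))
      have i3: "(\<lambda>v. \<phi> (v + rx s u)) integrable_on ?B" by (rule sh(2))
      have i4: "(\<lambda>v. \<phi> (v + rx (- s) u)) integrable_on ?B" by (rule sh(2))
      have "F p + F (p + u) = integral ?B \<phi> + integral ?B (\<lambda>v. \<phi> (v + u))" unfolding sh(1) F_def ..
      also have "\<dots> = integral ?B (\<lambda>v. \<phi> v + \<phi> (v + u))"
        by (rule integral_add[OF i1 i2, symmetric])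
      also have "\<dots> = integral ?B (\<lambda>v. \<phi> (v + rx s u) + \<phi> (v + rx (- s) u))"
      proof (rule integral_spike[OF neg])
        fix v assume "v \<in> ?B - {v. \<phi> v + \<phi> (v + u) \<noteq> \<phi> (v + rx s u) + \<phi> (v + rx (- s) u)}"
        then show "\<phi> (v + rx s u) + \<phi> (v + rx (- s) u) = \<phi> v + \<phi> (v + u)" by simp
      qed
      also have "\<dots> = F (p + rx s u) + F (p + rx (- s) u)"
        unfolding integral_add[OF i3 i4] sh(1) ..
      finally show ?case by simp
    qed
    moreover have "continuous_on UNIV (\<lambda>u. F p + F (p + u) - (F (p + rx s u) + F (p + rx (- s) u)))"
      by (intro continuous_intros)
    ultimately have "F p + F (p + u) - (F (p + rx s u) + F (p + rx (- s) u)) = 0"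
      using continuous_AE_zero[of "\<lambda>u. F p + F (p + u) - (F (p + rx s u) + F (p + rx (- s) u))" u] by blast
    then show ?thesis by linarith
  qed
  obtain s where s: "norm s = 1" "rx s (x + y) = x" "rx (- s) (x + y) = y" using rectangle_direction[OF xy] .
  let ?T = "{s. F p + F (p + (x + y)) = F (p + rx s (x + y)) + F (p + rx (- s) (x + y))}"
  have "closed ?T" by (intro closed_Collect_eq continuous_intros)
  moreover have "G \<subseteq> ?T" using G_eq by blast
  ultimately have "closure G \<subseteq> ?T" by (rule closure_minimal[rotated])
  moreover have "\<forall>e>0. \<exists>s'\<in>G. dist s s' < e" using G s(1) unfolding dense_directions_def by blast
  then have "s \<in> closure G" unfolding closure_approachable dist_commute[of _ s] .
  ultimately have "F p + F (p + (x + y)) = F (p + rx s (x + y)) + F (p + rx (- s) (x + y))" by blast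
  then show ?thesis using s by (simp add: add.assoc)
qed

lemma AE_quadratic:
  obtains a b c where "AE v in lborel. \<phi> v = a + b \<bullet> v + c * (norm v)\<^sup>2"
proof -
  obtain N where N: "negligible N" "\<And>x e. x \<notin> N \<Longrightarrow> 0 < e \<Longrightarrow> \<exists>d>0. \<forall>h. 0 < h \<and> h < d \<longrightarrow>
      norm (integral (cbox x (x + h *\<^sub>R One)) \<phi> /\<^sub>R h ^ DIM('a) - \<phi> x) < e"
    using integrable_ccontinuous_explicit[OF integrable_on_cbox] by blast
  define h where "h k = 1 / (real k + 1)" for k :: nat
  have h: "0 < h k" for k by (simp add: h_def)
  define A where "A k v = integral (cbox v (v + h k *\<^sub>R One)) \<phi> / h k ^ DIM('a)" for k v
  have lim: "(\<lambda>k. A k v) \<longlonglongrightarrow> \<phi> v" if v: "v \<notin> N" for v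
  proof (rule LIMSEQ_I)
    fix e :: real assume "0 < e"
    from N(2)[OF v this] obtain d where d: "0 < d" "\<forall>h. 0 < h \<and> h < d \<longrightarrow>
      norm (integral (cbox v (v + h *\<^sub>R One)) \<phi> /\<^sub>R h ^ DIM('a) - \<phi> v) < e" by blast
    obtain m :: nat where m: "1 / d < real m" using reals_Archimedean2 by blast
    have "h k < d" if "m \<le> k" for k
    proof -
      have "1 / d < real k + 1" using m that by linarith
      then show ?thesis using d(1) by (simp add: h_def field_simps)
    qed
    then show "\<exists>no. \<forall>k\<ge>no. norm (A k v - \<phi> v) < e"
      using d(2) h by (auto simp: A_def divide_inverse mult.commute intro!: exI[of _ m])
  qed
  have rect: "A k p + A k (p + x + y) = A k (p + x) + A k (p + y)" if "x \<bullet> y = 0" for k p x y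
    using box_integral_rectangle[OF less_imp_le[OF h[of k]] that, of p]
    unfolding A_def by (simp add: add_divide_distrib[symmetric])
  have cont: "continuous_on UNIV (A k)" for k
    unfolding A_def using h[of k] continuous_on_box_integral[OF integrable_on_cbox less_imp_le[OF h], of k]
    by (intro continuous_intros) auto
  have "\<exists>b c. \<forall>v. A k v = A k 0 + b \<bullet> v + c * (norm v)\<^sup>2" for k
  proof -
    have "A k 0 + A k (x + y) = A k x + A k y" if "x \<bullet> y = 0" for x y using rect[OF that, of k 0] by simp
    from rectangle_function_quadratic[OF dim cont this] show ?thesis by metis
  qed
  then obtain b c where bc: "\<And>k v. A k v = A k 0 + b k \<bullet> v + c k * (norm v)\<^sup>2" by metis
  obtain N' where N': "N \<subseteq> N'" "N' \<in> null_sets lborel"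
    using N(1) unfolding negligible_iff_null_sets null_sets_completion_iff2 by blast
  have N'm: "N' \<in> sets borel" "emeasure lborel N' = 0" using N'(2) by (auto simp: null_sets_def)
  \<comment> \<open>Lebesgue differentiation gives convergence only off a null set. Any
    \<open>v\<close> can be completed to a rectangle whose other three vertices avoid it, and the
    exact identity for \<open>A k\<close> carries convergence over to \<open>v\<close>.\<close>
  have conv: "convergent (\<lambda>k. A k v)" for v
  proof -
    obtain s where s: "s \<in> G" using dense_directions_nonempty[OF G] .
    have ns: "norm s = 1" using dense_directions_norm[OF G s] .
    have "emeasure lborel (N' \<inter> ball v 1) \<le> emeasure lborel N'" using N'm by (intro emeasure_mono) auto
    then have "emeasure lborel (N' \<inter> ball v 1) < ennreal (good_density s * 1 ^ DIM('a))"
      using equator_vol_pos[OF dim, of s] N'm(2) by (simp add: good_density_def)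
    from good_rectangles[OF dim ns zero_less_one N'm(1) this]
    have "{u \<in> equator s \<inter> ball 0 1. v + rx s u \<notin> N' \<and> v + rx (- s) u \<notin> N' \<and> v + u \<notin> N'} \<noteq> {}"
      by (metis emeasure_empty less_irrefl)
    then obtain u where u: "v + rx s u \<notin> N'" "v + rx (- s) u \<notin> N'" "v + u \<notin> N'" by blast
    have "A k v = A k (v + rx s u) + A k (v + rx (- s) u) - A k (v + u)" for k
      using rect[OF rx_orth[OF ns], of k v u] rx_add_minus[of s u] by (simp add: add.assoc)
    moreover have "convergent (\<lambda>k. A k (v + rx s u) + A k (v + rx (- s) u) - A k (v + u))"
      using u N'(1) lim by (intro convergent_add convergent_diff) (auto simp: convergent_def)
    ultimately show ?thesis by simp
  qed
  define q where "q v = lim (\<lambda>k. A k v)" for v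
  have q: "(\<lambda>k. A k v) \<longlonglongrightarrow> q v" for v using conv[of v] by (simp add: q_def convergent_LIMSEQ_iff)
  define \<beta> where "\<beta> i = (q i - q (- i)) / 2" for i
  obtain e :: 'a where e: "norm e = 1" using vector_choose_size[of 1] by auto
  define \<gamma> where "\<gamma> = (q e + q (- e)) / 2 - q 0"
  \<comment> \<open>The coefficients are combinations of finitely many values of \<open>A k\<close>,
    so they converge too, and the limit is quadratic everywhere.\<close>
  have "(\<lambda>k. b k \<bullet> i) = (\<lambda>k. (A k i - A k (- i)) / 2)" for i
  proof
    show "b k \<bullet> i = (A k i - A k (- i)) / 2" for k using bc[of k i] bc[of k "- i"] by (simp add: field_simps)
  qed
  then have b: "(\<lambda>k. b k \<bullet> i) \<longlonglongrightarrow> \<beta> i" for i unfolding \<beta>_def by (simp only:) (intro tendsto_intros q zero_neq_numeral[symmetric])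
  have "c = (\<lambda>k. (A k e + A k (- e)) / 2 - A k 0)"
  proof
    show "c k = (A k e + A k (- e)) / 2 - A k 0" for k using bc[of k e] bc[of k "- e"] e by (simp add: field_simps)
  qed
  then have c: "c \<longlonglongrightarrow> \<gamma>" unfolding \<gamma>_def by (simp only:) (intro tendsto_intros q zero_neq_numeral[symmetric])
  have qv: "q v = q 0 + (\<Sum>i\<in>Basis. \<beta> i *\<^sub>R i) \<bullet> v + \<gamma> * (norm v)\<^sup>2" for v
  proof (rule LIMSEQ_unique[OF q])
    have "b k \<bullet> v = (\<Sum>i\<in>Basis. (b k \<bullet> i) * (v \<bullet> i))" for k by (rule euclidean_inner)
    then have "(\<lambda>k. b k \<bullet> v) \<longlonglongrightarrow> (\<Sum>i\<in>Basis. \<beta> i * (v \<bullet> i))" by (auto intro!: tendsto_intros b)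
    then have "(\<lambda>k. A k 0 + b k \<bullet> v + c k * (norm v)\<^sup>2) \<longlonglongrightarrow> q 0 + (\<Sum>i\<in>Basis. \<beta> i * (v \<bullet> i)) + \<gamma> * (norm v)\<^sup>2"
      by (intro tendsto_intros q c)
    moreover have "(\<lambda>k. A k v) = (\<lambda>k. A k 0 + b k \<bullet> v + c k * (norm v)\<^sup>2)" by (intro ext) (rule bc)
    moreover have "(\<Sum>i\<in>Basis. \<beta> i *\<^sub>R i) \<bullet> v = (\<Sum>i\<in>Basis. \<beta> i * (v \<bullet> i))"
      unfolding inner_sum_left by (simp add: inner_commute)
    ultimately show "(\<lambda>k. A k v) \<longlonglongrightarrow> q 0 + (\<Sum>i\<in>Basis. \<beta> i *\<^sub>R i) \<bullet> v + \<gamma> * (norm v)\<^sup>2"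
      by (simp only:)
  qed
  have "AE v in lborel. \<phi> v = q 0 + (\<Sum>i\<in>Basis. \<beta> i *\<^sub>R i) \<bullet> v + \<gamma> * (norm v)\<^sup>2"
    using AE_not_in[OF N'(2)]
  proof eventually_elim
    case (elim v)
    then have "v \<notin> N" using N'(1) by blast
    from LIMSEQ_unique[OF lim[OF this] q[of v]] qv[of v] show ?case by (rule trans)
  qed
  then show thesis by (rule that)
qed

end

subsection \<open>Equilibria\<close>

lemma lborel_reflect: "(lborel :: 'a::euclidean_space measure) = distr lborel borel (\<lambda>x. p - x)"
  using lborel_affine[of "- 1 :: real" p] by (simp add: density_1)

lemma integrable_reflect:
  fixes g :: "'a::euclidean_space \<Rightarrow> 'b::{banach,second_countable_topology}"
  assumes g: "integrable lborel g"
  shows "integrable lborel (\<lambda>v. g (p - v))"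
proof -
  have [measurable]: "g \<in> borel_measurable borel" using borel_measurable_integrable[OF g] by simp
  have "integrable (distr lborel borel (\<lambda>x. p - x)) g" using g lborel_reflect[of p] by metis
  then show ?thesis by (simp add: integrable_distr_eq)
qed

lemma integral_reflect_lborel:
  fixes g :: "'a::euclidean_space \<Rightarrow> 'b::{banach,second_countable_topology}"
  assumes [measurable]: "g \<in> borel_measurable borel"
  shows "(LINT v|lborel. g (p - v)) = (LINT v|lborel. g v)"
proof -
  have "(LINT v|lborel. g v) = (LINT v|distr lborel borel (\<lambda>x. p - x). g v)" using lborel_reflect[of p] by metis
  also have "\<dots> = (LINT v|lborel. g (p - v))" by (rule integral_distr) measurable
  finally show ?thesis ..
qed

lemma AE_eq_reflect:
  fixes f F :: "'a::euclidean_space \<Rightarrow> real"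
  assumes [measurable]: "f \<in> borel_measurable borel" "F \<in> borel_measurable borel" and ae: "AE v in lborel. f v = F v"
  shows "AE v in lborel. f (p - v) = F (p - v)"
proof -
  have "Measurable.pred borel (\<lambda>v. f v = F v)" by measurable
  from AE_lborel_affine[of "- 1", OF _ this ae, of p] show ?thesis by simp
qed

text \<open>\<open>f\<close> is almost everywhere invariant under the point reflection at
  \<open>p\<close>, so the first moment equals \<open>2 * mass f\<close> times \<open>p\<close>
  minus itself.\<close>

lemma mean_velocity_radial:
  fixes f :: "'a::euclidean_space \<Rightarrow> real"
  assumes f: "integrable lborel f" and fv: "integrable lborel (\<lambda>v. f v *\<^sub>R v)" and m: "mass f \<noteq> 0"
    and H[measurable]: "H \<in> borel_measurable borel" and eq: "AE v in lborel. f v = H (norm (v - p))"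
  shows "mean_velocity f = p"
proof -
  have [measurable]: "f \<in> borel_measurable borel" using borel_measurable_integrable[OF f] by simp
  have "AE v in lborel. f (2 *\<^sub>R p - v) = H (norm (2 *\<^sub>R p - v - p))"
    by (rule AE_eq_reflect[OF _ _ eq]) measurable
  moreover have "norm (2 *\<^sub>R p - v - p) = norm (v - p)" for v
    by (simp add: scaleR_2 algebra_simps norm_minus_commute)
  ultimately have sym: "AE v in lborel. f (2 *\<^sub>R p - v) = f v" using eq by (auto elim: eventually_elim2)
  let ?I = "LINT v|lborel. f v *\<^sub>R v"
  have "?I = (LINT v|lborel. f (2 *\<^sub>R p - v) *\<^sub>R (2 *\<^sub>R p - v))"
    by (rule integral_reflect_lborel[symmetric]) measurable
  also have "\<dots> = (LINT v|lborel. f v *\<^sub>R (2 *\<^sub>R p) - f v *\<^sub>R v)"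
    using sym by (intro integral_cong_AE) (auto elim: eventually_mono simp: algebra_simps)
  also have "\<dots> = mass f *\<^sub>R (2 *\<^sub>R p) - ?I"
    unfolding mass_def using f fv by (subst Bochner_Integration.integral_diff) (auto simp del: scaleR_scaleR)
  finally have "?I + ?I = mass f *\<^sub>R (2 *\<^sub>R p)" by (simp only: eq_diff_eq)
  then have "2 *\<^sub>R ?I = 2 *\<^sub>R (mass f *\<^sub>R p)" unfolding scaleR_2 scaleR_add_right .
  then have "?I = mass f *\<^sub>R p" by (simp only: scaleR_cancel_left) simp
  then show ?thesis using m by (simp add: mean_velocity_def)
qed

section \<open>The two alternatives for an equilibrium\<close>

locale collision_equilibrium =
  fixes G :: "'a::euclidean_space set" and f :: "'a \<Rightarrow> real"
  assumes dim: "2 \<le> DIM('a)"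
    and G: "dense_directions G"
    and f_int: "integrable lborel f"
    and bounds: "\<And>v. 0 \<le> f v" "\<And>v. f v \<le> 1"
    and balance: "\<And>s. s \<in> G \<Longrightarrow> AE v in lborel. AE u in lborel.
      f (v + rx s u) * f (v + rx (- s) u) * (1 - f v) * (1 - f (v + u))
        = f v * f (v + u) * (1 - f (v + rx s u)) * (1 - f (v + rx (- s) u))"
begin

lemma f_borel[measurable]: "f \<in> borel_measurable borel"
  using borel_measurable_integrable[OF f_int] by simp

definition M :: "'a set" where "M = {v. 0 < f v \<and> f v < 1}"

lemma M_borel[measurable]: "M \<in> sets borel"
  unfolding M_def by measurable

text \<open>When all four values are 0 or 1, a side of the balance is nonzero exactly if one
  diagonal is in \<open>S\<close> and the other outside; the other side then vanishes. So the
  balance excludes these rectangles.\<close>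

lemma saturated_ball:
  assumes null: "emeasure lborel M = 0" and mass: "mass f \<noteq> 0"
  obtains c R where "0 < R" "AE v in lborel. f v = indicator (cball c R) v"
proof -
  define S where "S = {v. f v = 1}"
  have S[measurable]: "S \<in> sets borel" unfolding S_def by measurable
  have M0: "M \<in> null_sets lborel" using null by (auto simp: null_sets_def)
  have ind: "AE v in lborel. f v = indicator S v"
    using AE_not_in[OF M0]
  proof eventually_elim
    case (elim v)
    then show ?case using bounds[of v] by (auto simp: M_def S_def indicator_def)
  qed
  interpret collision_set G S
  proof (rule collision_set.intro[OF dim G S])
    fix s assume s: "s \<in> G"
    note sh = AE_shift_notin_null_set[OF M_borel null]
    have "AE v in lborel. AE u in lborel. v + rx s u \<notin> M" by (rule sh) measurable
    moreover have "AE v in lborel. AE u in lborel. v + rx (- s) u \<notin> M" by (rule sh) measurable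
    moreover have "AE v in lborel. AE u in lborel. v + u \<notin> M" by (rule sh) measurable
    moreover note AE_not_in[OF M0] balance[OF s]
    ultimately show "AE v in lborel. AE u in lborel.
      \<not> (v \<in> S \<and> v + u \<in> S \<and> v + rx s u \<notin> S \<and> v + rx (- s) u \<notin> S) \<and>
      \<not> (v \<notin> S \<and> v + u \<notin> S \<and> v + rx s u \<in> S \<and> v + rx (- s) u \<in> S)"
    proof eventually_elim
      case (elim v)
      have 01: "f w = 0 \<or> f w = 1" if "w \<notin> M" for w using that bounds[of w] by (auto simp: M_def)
      from elim(1,2,3,5) show ?case
      proof eventually_elim
        case (elim u)
        then show ?case using 01[OF \<open>v \<notin> M\<close>] 01[OF elim(1)] 01[OF elim(2)] 01[OF elim(3)] by (auto simp: S_def)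
      qed
    qed
  qed
  have "emeasure lborel S = (\<integral>\<^sup>+v. indicator S v \<partial>lborel)" by simp
  also have "\<dots> \<le> (\<integral>\<^sup>+v. ennreal (norm (f v)) \<partial>lborel)"
    by (intro nn_integral_mono) (auto simp: S_def indicator_def)
  also have "\<dots> < \<infinity>" using f_int by (simp add: integrable_iff_bounded)
  finally have fin: "emeasure lborel S < \<infinity>" .
  have pos: "0 < emeasure lborel S"
  proof (rule ccontr)
    assume "\<not> 0 < emeasure lborel S"
    then have "S \<in> null_sets lborel" by (auto simp: null_sets_def zero_less_iff_neq_zero)
    from AE_not_in[OF this] ind have "AE v in lborel. f v = 0" by eventually_elim simp
    then have "mass f = 0" unfolding mass_def by (rule integral_eq_zero_AE)
    then show False using mass by simp
  qed
  obtain c R where cR: "0 < R" "AE v in lborel. v \<in> S \<longleftrightarrow> v \<in> cball c R" using ball_AE[OF pos fin] .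
  have "AE v in lborel. f v = indicator (cball c R) v"
    using cR(2) ind by eventually_elim (auto simp: indicator_def)
  then show thesis using that cR(1) by blast
qed

text \<open>With the other values strictly between 0 and 1, \<open>f v = 0\<close> would annihilate
  only the right side of the balance and \<open>f v = 1\<close> only the left side.\<close>

lemma M_fourth_vertex:
  assumes s: "s \<in> G"
  shows "AE v in lborel. AE u in lborel. v + rx s u \<in> M \<longrightarrow> v + rx (- s) u \<in> M \<longrightarrow> v + u \<in> M \<longrightarrow> v \<in> M"
  using balance[OF s]
proof eventually_elim
  case (elim v)
  then show ?case
  proof eventually_elim
    case (elim u)
    then have "f v \<noteq> 0 \<and> f v \<noteq> 1" if "v + rx s u \<in> M" "v + rx (- s) u \<in> M" "v + u \<in> M"
      using that by (auto simp: M_def)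
    then show ?case using bounds[of v] by (fastforce simp: M_def)
  qed
qed

lemma essint_M_fourth_vertex:
  assumes "x \<bullet> y = 0" "a + x \<in> essint M" "a + y \<in> essint M" "a + x + y \<in> essint M"
  shows "a \<in> essint M"
  by (rule essint_fourth_vertex[OF G M_borel M_borel M_borel M_borel M_fourth_vertex assms])

lemma AE_M:
  assumes pos: "0 < emeasure lborel M"
  shows "AE v in lborel. v \<in> M"
proof -
  obtain s where s: "s \<in> G" using dense_directions_nonempty[OF G] .
  have ns: "norm s = 1" using dense_directions_norm[OF G s] .
  \<comment> \<open>\<open>good_rectangles\<close> is used with radius \<open>r / 2\<close> around
    each point of the ball of radius \<open>r / 2\<close>; hence the power of 2.\<close>
  define e where "e = good_density s / 2 ^ DIM('a)"
  have e: "0 < e" using equator_vol_pos[OF dim, of s] by (simp add: e_def good_density_def)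
  have pos': "0 < emeasure lborel (M \<inter> UNIV)" using pos by simp
  obtain c r where cr: "0 < r" "ball c r \<subseteq> UNIV" "emeasure lborel (ball c r - M) < ennreal (e * r ^ DIM('a))"
    using exists_ball_of_large_density[OF M_borel open_UNIV pos' e] by blast
  have "c \<in> essint M"
  proof (rule essint_I)
    show "0 < r / 2" using cr(1) by simp
    show "AE v in lborel. v \<in> ball c (r / 2) \<longrightarrow> v \<in> M"
      using M_fourth_vertex[OF s]
    proof eventually_elim
      case (elim v)
      show ?case
      proof
        assume v: "v \<in> ball c (r / 2)"
        have "x \<in> ball c r" if "x \<in> ball v (r / 2)" for x
          using v that dist_triangle[of c x v] by simp
        then have "- M \<inter> ball v (r / 2) \<subseteq> ball c r - M" by auto
        then have "emeasure lborel (- M \<inter> ball v (r / 2)) \<le> emeasure lborel (ball c r - M)" by (intro emeasure_mono) auto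
        also have "\<dots> < ennreal (e * r ^ DIM('a))" by (rule cr(3))
        also have "e * r ^ DIM('a) = good_density s * (r / 2) ^ DIM('a)" by (simp add: e_def power_divide)
        finally have small: "emeasure lborel (- M \<inter> ball v (r / 2)) < ennreal (good_density s * (r / 2) ^ DIM('a))" .
        have "- M \<in> sets borel" by simp
        from good_rectangles[OF dim ns _ this small] cr(1)
        have "emeasure lborel {u\<in>equator s \<inter> ball 0 (r / 2). v + rx s u \<notin> - M \<and> v + rx (- s) u \<notin> - M \<and> v + u \<notin> - M} \<noteq> 0"
          (is "emeasure lborel ?E \<noteq> 0") by simp
        moreover have "?E \<in> sets lborel" by simp
        ultimately obtain u where "u \<in> ?E" "v + rx s u \<in> M \<longrightarrow> v + rx (- s) u \<in> M \<longrightarrow> v + u \<in> M \<longrightarrow> v \<in> M"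
          using AE_imp_ex[OF elim] by blast
        then show "v \<in> M" by auto
      qed
    qed
  qed auto
  then obtain \<rho> where \<rho>: "0 < \<rho>" "ball c \<rho> \<subseteq> essint M"
    using open_essint[OF M_borel] open_contains_ball by blast
  \<comment> \<open>\<open>q\<close> and \<open>c\<close> become opposite corners of a square. Its
    other two corners have distance \<open>norm w / sqrt 2\<close> from \<open>c\<close>, which is
    less than \<open>t\<close>.\<close>
  have grow: "ball c (sqrt 2 * t) \<subseteq> essint M" if t: "ball c t \<subseteq> essint M" for t
  proof
    fix q assume q: "q \<in> ball c (sqrt 2 * t)"
    define w where "w = q - c"
    obtain d where d: "norm d = 1" "d \<bullet> w = 0" using exists_orthogonal_unit[OF dim] .
    define x where "x = - (1/2) *\<^sub>R w + (norm w / 2) *\<^sub>R d"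
    define y where "y = - (1/2) *\<^sub>R w - (norm w / 2) *\<^sub>R d"
    have dd: "d \<bullet> d = 1" "w \<bullet> d = 0" using d by (auto simp: norm_eq_1 inner_commute)
    have ww: "norm w < sqrt 2 * t" using q by (simp add: w_def dist_norm norm_minus_commute)
    have half: "norm ((1/2) *\<^sub>R w + (k * norm w / 2) *\<^sub>R d) < t" if "k * k = 1" for k
    proof -
      have "(norm ((1/2) *\<^sub>R w + (k * norm w / 2) *\<^sub>R d))\<^sup>2 = (1/4) * (w \<bullet> w) + (k * k) * (norm w)\<^sup>2 / 4"
        unfolding power2_norm_eq_inner inner_add_left inner_add_right inner_scaleR_left inner_scaleR_right dd d(2)
        by (simp add: power2_norm_eq_inner[symmetric] power2_eq_square)
      also have "\<dots> = (norm w)\<^sup>2 / 2" using that by (simp add: power2_norm_eq_inner)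
      also have "\<dots> < (sqrt 2 * t)\<^sup>2 / 2" using ww by (intro divide_strict_right_mono power_strict_mono) auto
      also have "\<dots> = t\<^sup>2" by (simp add: power_mult_distrib)
      finally have "(norm ((1/2) *\<^sub>R w + (k * norm w / 2) *\<^sub>R d))\<^sup>2 < t\<^sup>2" .
      moreover have "0 \<le> sqrt 2 * t" using ww norm_ge_zero[of w] by linarith
      then have "0 \<le> t" by (simp add: zero_le_mult_iff)
      ultimately show ?thesis by (rule power_less_imp_less_base)
    qed
    show "q \<in> essint M"
    proof (rule essint_M_fourth_vertex)
      show "x \<bullet> y = 0"
        unfolding x_def y_def inner_add_left inner_diff_right inner_scaleR_left inner_scaleR_right dd d(2)
        by (simp add: power2_norm_eq_inner[symmetric] power2_eq_square)
      have q: "q = c + ((1/2) *\<^sub>R w + (1/2) *\<^sub>R w)"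
        unfolding scaleR_half_double[symmetric] by (simp add: w_def scaleR_add_left[symmetric])
      have qx: "q + x = c + ((1/2) *\<^sub>R w + (1 * norm w / 2) *\<^sub>R d)" by (subst q) (simp add: x_def)
      have qy: "q + y = c + ((1/2) *\<^sub>R w + ((- 1) * norm w / 2) *\<^sub>R d)" by (subst q) (simp add: y_def)
      have qxy: "q + x + y = c" by (subst q) (simp add: x_def y_def)
      have dz: "dist c (c + z) = norm z" for z by (simp add: dist_norm)
      have "dist c (q + x) < t" unfolding qx dz by (rule half) simp
      moreover have "dist c (q + y) < t" unfolding qy dz by (rule half) simp
      moreover have "dist c (q + x + y) < t" unfolding qxy using half[of 1] norm_ge_zero by (simp add: le_less_trans[OF norm_ge_zero])
      ultimately have "q + x \<in> ball c t" "q + y \<in> ball c t" "q + x + y \<in> ball c t" by simp_all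
      then show "q + x \<in> essint M" "q + y \<in> essint M" "q + x + y \<in> essint M" using t by blast+
    qed
  qed
  have all: "ball c (sqrt 2 ^ k * \<rho>) \<subseteq> essint M" for k
  proof (induction k)
    case 0 then show ?case using \<rho> by simp
  next
    case (Suc k)
    from grow[OF this] show ?case by (simp add: mult.assoc)
  qed
  have "v \<in> essint M" for v
  proof -
    obtain k where "dist c v / \<rho> < sqrt 2 ^ k" using real_arch_pow[of "sqrt 2"] by auto
    then have "v \<in> ball c (sqrt 2 ^ k * \<rho>)" using \<rho>(1) by (simp add: field_simps)
    then show ?thesis using all by blast
  qed
  then have "essint M = UNIV" by blast
  then have "- M \<in> null_sets lborel" using emeasure_essint_diff[OF M_borel] by (auto simp: null_sets_def Compl_eq_Diff_UNIV)
  from AE_not_in[OF this] show ?thesis by simp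
qed

lemma AE_M_quadratic:
  assumes full: "AE v in lborel. v \<in> M"
  obtains a b c where "AE v in lborel. f v = exp (a + b \<bullet> v + c * (norm v)\<^sup>2) / (1 + exp (a + b \<bullet> v + c * (norm v)\<^sup>2))"
proof -
  define \<phi> where "\<phi> v = ln (f v / (1 - f v))" for v
  have null: "emeasure lborel (- M) = 0"
    using full AE_iff_null_sets[of "- M" lborel] by (auto simp: null_sets_def)
  interpret AE_rectangle_function G \<phi>
  proof
    show "\<phi> \<in> borel_measurable borel" unfolding \<phi>_def by measurable
    fix s assume s: "s \<in> G"
    have cM: "- M \<in> sets borel" by simp
    note sh = AE_shift_notin_null_set[OF cM null]
    have "AE v in lborel. AE u in lborel. v + rx s u \<notin> - M" by (rule sh) measurable
    moreover have "AE v in lborel. AE u in lborel. v + rx (- s) u \<notin> - M" by (rule sh) measurable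
    moreover have "AE v in lborel. AE u in lborel. v + u \<notin> - M" by (rule sh) measurable
    moreover note full balance[OF s]
    ultimately show "AE v in lborel. AE u in lborel. \<phi> v + \<phi> (v + u) = \<phi> (v + rx s u) + \<phi> (v + rx (- s) u)"
    proof eventually_elim
      case (elim v)
      from elim(1,2,3,5) show ?case
      proof eventually_elim
        case (elim u)
        define w where "w = v + u"
        define x where "x = v + rx s u"
        define y where "y = v + rx (- s) u"
        have p: "0 < f v" "f v < 1" "0 < f w" "f w < 1" "0 < f x" "f x < 1" "0 < f y" "f y < 1"
          using \<open>v \<in> M\<close> elim(1-3) by (auto simp: M_def w_def x_def y_def)
        have "f x * f y * (1 - f v) * (1 - f w) = f v * f w * (1 - f x) * (1 - f y)"
          using elim(4) by (simp add: w_def x_def y_def)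
        then have "f v / (1 - f v) * (f w / (1 - f w)) = f x / (1 - f x) * (f y / (1 - f y))"
          unfolding times_divide_times_eq using p by (subst frac_eq_eq) (simp_all add: mult_ac)
        then have "ln (f v / (1 - f v) * (f w / (1 - f w))) = ln (f x / (1 - f x) * (f y / (1 - f y)))" by simp
        moreover have "0 < f v / (1 - f v)" "0 < f w / (1 - f w)" "0 < f x / (1 - f x)" "0 < f y / (1 - f y)"
          using p by simp_all
        ultimately have "\<phi> v + \<phi> w = \<phi> x + \<phi> y" unfolding \<phi>_def by (simp only: ln_mult_pos)
        then show ?case by (simp add: w_def x_def y_def)
      qed
    qed
  qed (rule dim, rule G)
  obtain a b c where abc: "AE v in lborel. \<phi> v = a + b \<bullet> v + c * (norm v)\<^sup>2" using AE_quadratic by blast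
  have "AE v in lborel. f v = exp (a + b \<bullet> v + c * (norm v)\<^sup>2) / (1 + exp (a + b \<bullet> v + c * (norm v)\<^sup>2))"
    using abc full
  proof eventually_elim
    case (elim v)
    then have p: "0 < f v" "f v < 1" by (auto simp: M_def)
    have E: "exp (a + b \<bullet> v + c * (norm v)\<^sup>2) = f v / (1 - f v)"
      unfolding elim(1)[symmetric] \<phi>_def using p by simp
    have "1 + f v / (1 - f v) = 1 / (1 - f v)" using p by (simp add: field_simps)
    then show ?case unfolding E using p by simp
  qed
  then show thesis by (rule that)
qed

lemma fermi_dirac:
  assumes pos: "0 < emeasure lborel M"
  obtains a b p where "0 < a" "0 < b"
    "AE v in lborel. f v = a * exp (- b * (norm (v - p))\<^sup>2) / (1 + a * exp (- b * (norm (v - p))\<^sup>2))"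
proof -
  obtain a b c where abc: "AE v in lborel. f v = exp (a + b \<bullet> v + c * (norm v)\<^sup>2) / (1 + exp (a + b \<bullet> v + c * (norm v)\<^sup>2))"
    using AE_M_quadratic[OF AE_M[OF pos]] .
  have mono: "exp a / (1 + exp a) \<le> exp t / (1 + exp t)" if "a \<le> t" for t
    using that by (simp add: field_simps add_pos_pos)
  \<comment> \<open>For \<open>c \<ge> 0\<close> the exponent is at least \<open>a\<close> at one of
    \<open>v\<close> and \<open>- v\<close>. Then the integrable function
    \<open>f v + f (- v)\<close> would be bounded below by a positive constant.\<close>
  have "c < 0"
  proof (rule ccontr)
    assume "\<not> c < 0"
    then have c: "0 \<le> c" by simp
    define k where "k = exp a / (1 + exp a)"
    have k: "0 < k" by (simp add: k_def add_pos_pos)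
    define F where "F v = exp (a + b \<bullet> v + c * (norm v)\<^sup>2) / (1 + exp (a + b \<bullet> v + c * (norm v)\<^sup>2))" for v
    have F[measurable]: "F \<in> borel_measurable borel" unfolding F_def by measurable
    have abc': "AE v in lborel. f v = F v" using abc by (simp only: F_def)
    have ref: "AE v in lborel. f (0 - v) = F (0 - v)" by (rule AE_eq_reflect[OF f_borel F abc'])
    have "AE v in lborel. k \<le> f v + f (0 - v)"
      using abc' ref
    proof eventually_elim
      case (elim v)
      have cv: "0 \<le> c * (norm v)\<^sup>2" using c by simp
      show ?case
      proof (cases "0 \<le> b \<bullet> v")
        case True
        then have "k \<le> f v" unfolding elim(1) F_def using cv unfolding k_def by (intro mono) simp
        then show ?thesis using bounds(1)[of "0 - v"] by linarith
      next
        case False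
        then have "k \<le> f (0 - v)" unfolding elim(2) F_def using cv unfolding k_def by (intro mono) simp
        then show ?thesis using bounds(1)[of v] by linarith
      qed
    qed
    then have "AE v in lborel. norm k \<le> norm (f v + f (0 - v))" using k by (auto elim!: eventually_mono)
    then have "integrable lborel (\<lambda>v::'a. k)"
      by (intro Bochner_Integration.integrable_bound[OF Bochner_Integration.integrable_add[OF f_int integrable_reflect[OF f_int, of 0]]]) auto
    then have "nn_integral lborel (\<lambda>v::'a. ennreal (norm k)) < \<infinity>" unfolding integrable_iff_bounded by blast
    then have "ennreal k * emeasure lborel (UNIV :: 'a set) < \<infinity>" using k by simp
    then show False using k by (simp add: ennreal_mult_top)
  qed
  define B where "B = - c"
  \<comment> \<open>The centre obtained by completing the square in the exponent.\<close>
  define p where "p = (1 / (2 * B)) *\<^sub>R b"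
  have B: "0 < B" using \<open>c < 0\<close> by (simp add: B_def)
  have bp: "b = (2 * B) *\<^sub>R p" using B by (simp add: p_def)
  have "a + b \<bullet> v + c * (norm v)\<^sup>2 = (a + B * (norm p)\<^sup>2) + (- B * (norm (v - p))\<^sup>2)" for v
  proof -
    have n: "(norm (v - p))\<^sup>2 = (norm v)\<^sup>2 - 2 * (p \<bullet> v) + (norm p)\<^sup>2"
      by (simp add: power2_norm_eq_inner inner_diff_left inner_diff_right inner_commute)
    have "c = - B" by (simp add: B_def)
    then show ?thesis unfolding bp inner_scaleR_left n by (simp add: algebra_simps)
  qed
  then have "exp (a + b \<bullet> v + c * (norm v)\<^sup>2) = exp (a + B * (norm p)\<^sup>2) * exp (- B * (norm (v - p))\<^sup>2)" for v
    by (simp only: exp_add)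
  then have "AE v in lborel. f v = exp (a + B * (norm p)\<^sup>2) * exp (- B * (norm (v - p))\<^sup>2) / (1 + exp (a + B * (norm p)\<^sup>2) * exp (- B * (norm (v - p))\<^sup>2))"
    using abc by (simp only:)
  then show thesis using that[of "exp (a + B * (norm p)\<^sup>2)" B p] B by simp
qed

end

section \<open>From the measure on the sphere to a dense set of directions\<close>

lemma finite_sphere_measure: "finite_measure (sphere_measure :: 'a::euclidean_space measure)"
proof
  have "sphere (0::'a) 1 \<in> sets sphere_measure" using sets.top[of "sphere_measure :: 'a measure"] by simp
  then have "emeasure sphere_measure (sphere (0::'a) 1)
      = ennreal (real DIM('a)) * emeasure lborel {r *\<^sub>R s | r s. 0 < r \<and> r \<le> 1 \<and> s \<in> sphere (0::'a) 1}"
    by (rule emeasure_sphere_measure)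
  also have "\<dots> \<le> ennreal (real DIM('a)) * emeasure lborel (cball (0::'a) 1)"
    by (intro mult_left_mono emeasure_mono) auto
  also have "\<dots> < \<infinity>" by (simp add: emeasure_cball ennreal_mult[symmetric])
  finally show "emeasure sphere_measure (space (sphere_measure :: 'a measure)) \<noteq> \<infinity>" by simp
qed

text \<open>The cone over the cap, whose volume defines the measure, contains a ball around
  \<open>(1/2) *\<^sub>R s\<close>.\<close>

lemma sphere_measure_cap_pos:
  fixes s :: "'a::euclidean_space"
  assumes s: "norm s = 1" and e: "0 < e"
  shows "sphere 0 1 \<inter> ball s e \<in> sets sphere_measure"
    and "0 < emeasure sphere_measure (sphere 0 1 \<inter> ball s e)"
proof -
  let ?A = "sphere 0 1 \<inter> ball s e"
  show A: "?A \<in> sets sphere_measure"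
    unfolding sets_sphere_measure by (auto simp: sets_restrict_space)
  \<comment> \<open>Points of the ball have norm above 1/4 because \<open>d \<le> 1/4\<close>;
    projected to the sphere they are within \<open>2 * d / norm x\<close>, hence within
    \<open>8 * d\<close>, of \<open>s\<close>.\<close>
  define d where "d = min (1/4) (e / 8)"
  have d: "0 < d" "d \<le> 1/4" "8 * d \<le> e" using e by (auto simp: d_def)
  let ?C = "{x. 0 < norm x \<and> norm x \<le> 1 \<and> norm (x /\<^sub>R norm x - s) < e}"
  have cone: "{r *\<^sub>R x | r x. 0 < r \<and> r \<le> 1 \<and> x \<in> ?A} = ?C"
  proof (intro equalityI subsetI)
    fix x assume "x \<in> ?C"
    then have x: "0 < norm x" "norm x \<le> 1" "norm (x /\<^sub>R norm x - s) < e" "x \<noteq> 0" by auto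
    have "x = norm x *\<^sub>R (x /\<^sub>R norm x)" using x(4) by simp
    moreover have "x /\<^sub>R norm x \<in> ?A" using x(3,4) by (auto simp: dist_norm norm_minus_commute)
    ultimately show "x \<in> {r *\<^sub>R x | r x. 0 < r \<and> r \<le> 1 \<and> x \<in> ?A}" using x(1,2) by blast
  next
    fix x assume "x \<in> {r *\<^sub>R x | r x. 0 < r \<and> r \<le> 1 \<and> x \<in> ?A}"
    then obtain r y where ry: "x = r *\<^sub>R y" "0 < r" "r \<le> 1" "norm y = 1" "dist s y < e" by auto
    have "norm x = r" using ry(1,2,4) by simp
    moreover from this have "x /\<^sub>R norm x = y" using ry(1,2) by simp
    then have "norm (x /\<^sub>R norm x - s) < e" using ry(5) by (simp only: dist_norm norm_minus_commute)
    ultimately show "x \<in> ?C" using ry(2,3) by blast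
  qed
  have sub: "ball ((1/2) *\<^sub>R s) d \<subseteq> ?C"
  proof
    fix x assume "x \<in> ball ((1/2) *\<^sub>R s) d"
    then have x: "norm (x - (1/2) *\<^sub>R s) < d" by (simp add: dist_norm norm_minus_commute)
    have half: "norm ((1/2) *\<^sub>R s) = 1/2" using s by simp
    then have nx: "\<bar>norm x - 1/2\<bar> < d" using norm_triangle_ineq3[of x "(1/2) *\<^sub>R s"] x by linarith
    then have px: "1/4 < norm x" "norm x \<le> 1" "0 < norm x" "norm x \<noteq> 0" using d by linarith+
    have "norm (x - norm x *\<^sub>R s) \<le> norm (x - (1/2) *\<^sub>R s) + norm ((1/2 - norm x) *\<^sub>R s)"
      by (rule order_trans[OF _ norm_triangle_ineq]) (simp add: algebra_simps)
    also have "norm ((1/2 - norm x) *\<^sub>R s) = \<bar>norm x - 1/2\<bar>" using s by simp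
    finally have "norm (x - norm x *\<^sub>R s) < 2 * d" using x nx by linarith
    also have "\<dots> \<le> norm x * (8 * d)" using px d by simp
    also have "\<dots> \<le> norm x * e" using px(3) d(3) by (intro mult_left_mono) auto
    also have "x - norm x *\<^sub>R s = norm x *\<^sub>R (x /\<^sub>R norm x - s)"
      using px(4) by (simp add: scaleR_diff_right)
    finally have "norm x * norm (x /\<^sub>R norm x - s) < norm x * e" by (simp only: norm_scaleR abs_norm_cancel)
    then have "norm (x /\<^sub>R norm x - s) < e" using px(3) by (simp only: mult_less_cancel_left_pos)
    then show "x \<in> ?C" using px by simp
  qed
  have "0 < emeasure lborel (ball ((1/2) *\<^sub>R s) d)" by (rule emeasure_ball_pos[OF d(1)])
  also have "\<dots> \<le> emeasure lborel ?C"
    using sub by (intro emeasure_mono) auto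
  finally show "0 < emeasure sphere_measure ?A"
    unfolding emeasure_sphere_measure[OF A] cone by (simp add: ennreal_zero_less_mult_iff)
qed

text \<open>Since caps have positive measure, the good directions meet every cap; separability of
  the set of good directions provides a countable choice.\<close>

lemma AE_sphere_dense_directions:
  fixes P :: "'a::euclidean_space \<Rightarrow> bool"
  assumes ae: "AE s in sphere_measure. P s"
  obtains G where "dense_directions G" "\<And>s. s \<in> G \<Longrightarrow> P s"
proof -
  obtain T where T: "countable T" "T \<subseteq> {s\<in>sphere 0 1. P s}" "{s\<in>sphere 0 1. P s} \<subseteq> closure T"
    using separable[of "{s\<in>sphere 0 1. P s}"] by blast
  have "\<exists>s'\<in>T. dist s s' < e" if s: "norm s = 1" and e: "0 < e" for s e
  proof -
    have "\<exists>x\<in>sphere 0 1 \<inter> ball s (e/2). P x"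
      using sphere_measure_cap_pos[OF s, of "e/2"] e by (intro AE_imp_ex[OF ae]) auto
    then obtain x where x: "x \<in> sphere 0 1" "P x" "dist s x < e/2" by auto
    then have "x \<in> closure T" using T(3) by blast
    then obtain y where y: "y \<in> T" "dist y x < e/2" using e closure_approachable[of x T] half_gt_zero by blast
    then have "dist s y < e" using x(3) dist_triangle2[of s y x] by simp
    then show ?thesis using y(1) by blast
  qed
  then have "dense_directions T" using T(1,2) unfolding dense_directions_def by force
  then show thesis using that T(2) by blast
qed

text \<open>The direction has to be quantified before \<open>v\<close> and \<open>w\<close>. The
  indicator \<open>i\<close> of failure has integral 0 when integrated over \<open>s\<close>
  innermost, and by Tonelli also with \<open>s\<close> outermost.\<close>

lemma AE_rotate:
  fixes M :: "'a measure" and N :: "'b measure" and K :: "'c measure" and Q :: "'a \<Rightarrow> 'b \<Rightarrow> 'c \<Rightarrow> bool"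
  assumes "sigma_finite_measure M" "sigma_finite_measure N" "sigma_finite_measure K"
    and Q[measurable]: "Measurable.pred (M \<Otimes>\<^sub>M (N \<Otimes>\<^sub>M K)) (\<lambda>p. Q (fst p) (fst (snd p)) (snd (snd p)))"
    and ae: "AE (v, w, s) in M \<Otimes>\<^sub>M (N \<Otimes>\<^sub>M K). Q v w s"
  shows "AE s in K. AE v in M. AE w in N. Q v w s"
proof -
  interpret M: sigma_finite_measure M by fact
  interpret N: sigma_finite_measure N by fact
  interpret K: sigma_finite_measure K by fact
  interpret NK: pair_sigma_finite N K ..
  interpret MK: pair_sigma_finite M K ..
  interpret NKs: sigma_finite_measure "N \<Otimes>\<^sub>M K" by (rule sigma_finite_pair_measure) fact+
  interpret MNK: pair_sigma_finite M "N \<Otimes>\<^sub>M K" ..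
  define i where "i v w s = (if Q v w s then 0 else 1 :: ennreal)" for v w s
  have i: "(\<lambda>p. i (fst p) (fst (snd p)) (snd (snd p))) \<in> borel_measurable (M \<Otimes>\<^sub>M (N \<Otimes>\<^sub>M K))"
    unfolding i_def by measurable
  have [measurable (raw)]: "(\<lambda>x. i (f x) (g x) (h x)) \<in> borel_measurable L"
    if [measurable]: "f \<in> measurable L M" "g \<in> measurable L N" "h \<in> measurable L K" for f g h and L :: "'d measure"
    using measurable_compose[OF _ i, of "\<lambda>x. (f x, (g x, h x))" L] by simp
  have 1: "AE v in M. AE w in N. AE s in K. i v w s = 0"
    using MNK.AE_pair[OF ae]
  proof eventually_elim
    case (elim v)
    from NK.AE_pair[OF elim] show ?case by (simp add: i_def)
  qed
  have "(\<integral>\<^sup>+s. (\<integral>\<^sup>+v. (\<integral>\<^sup>+w. i v w s \<partial>N) \<partial>M) \<partial>K) = (\<integral>\<^sup>+v. (\<integral>\<^sup>+s. (\<integral>\<^sup>+w. i v w s \<partial>N) \<partial>K) \<partial>M)"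
    by (rule MK.Fubini') measurable
  also have "\<dots> = (\<integral>\<^sup>+v. (\<integral>\<^sup>+w. (\<integral>\<^sup>+s. i v w s \<partial>K) \<partial>N) \<partial>M)"
    by (intro nn_integral_cong NK.Fubini') measurable
  also have "\<dots> = (\<integral>\<^sup>+v. (\<integral>\<^sup>+w. 0 \<partial>N) \<partial>M)"
  proof (rule nn_integral_cong_AE)
    show "AE v in M. (\<integral>\<^sup>+w. (\<integral>\<^sup>+s. i v w s \<partial>K) \<partial>N) = (\<integral>\<^sup>+w. 0 \<partial>N)"
      using 1
    proof eventually_elim
      case (elim v)
      have "AE w in N. (\<integral>\<^sup>+s. i v w s \<partial>K) = 0"
        using elim
      proof eventually_elim
        case (elim w)
        then have "(\<integral>\<^sup>+s. i v w s \<partial>K) = (\<integral>\<^sup>+s. 0 \<partial>K)" by (rule nn_integral_cong_AE)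
        then show ?case by simp
      qed
      then show ?case by (rule nn_integral_cong_AE)
    qed
  qed
  finally have "(\<integral>\<^sup>+s. (\<integral>\<^sup>+v. (\<integral>\<^sup>+w. i v w s \<partial>N) \<partial>M) \<partial>K) = 0" by simp
  then have "AE s in K. (\<integral>\<^sup>+v. (\<integral>\<^sup>+w. i v w s \<partial>N) \<partial>M) = 0"
    by (subst (asm) nn_integral_0_iff_AE) measurable
  with AE_space show ?thesis
  proof eventually_elim
    case (elim s)
    have [measurable]: "s \<in> space K" by (rule elim(1))
    have "AE v in M. (\<integral>\<^sup>+w. i v w s \<partial>N) = 0"
      using elim(2) by (subst (asm) nn_integral_0_iff_AE) measurable
    with AE_space show ?case
    proof eventually_elim
      case (elim v)
      have [measurable]: "v \<in> space M" by (rule elim(1))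
      have "AE w in N. i v w s = 0"
        using elim(2) by (subst (asm) nn_integral_0_iff_AE) measurable
      then show ?case by eventually_elim (simp add: i_def split: if_splits)
    qed
  qed
qed

lemma post_shift:
  "post_v v (v + u) s = v + rx s u" "post_w v (v + u) s = v + rx (- s) u"
proof -
  have "(v + (v + u)) /\<^sub>R 2 = (1/2) *\<^sub>R (v + v) + (1/2) *\<^sub>R u" by (simp add: algebra_simps)
  then have m: "(v + (v + u)) /\<^sub>R 2 = v + (1/2) *\<^sub>R u" by simp
  have n: "norm (v - (v + u)) = norm u" by simp
  show "post_v v (v + u) s = v + rx s u" unfolding post_v_def m n by (simp add: rx_def scaleR_add_right)
  show "post_w v (v + u) s = v + rx (- s) u" unfolding post_w_def m n by (simp add: rx_def scaleR_add_right algebra_simps)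
qed

subsection \<open>Moments and entropy\<close>

text \<open>\<open>R\<^sup>2 - (norm (v - p))\<^sup>2\<close> is the integral of
  \<open>2 * t\<close> from \<open>norm (v - p)\<close> to \<open>R\<close>. After exchanging the
  integrals the inner one is the volume of a ball of radius \<open>t\<close>.\<close>

lemma nn_integral_ball_defect:
  fixes p :: "'a::euclidean_space"
  assumes R: "0 < R"
  shows "(\<integral>\<^sup>+v. ennreal (indicator (cball p R) v * (R\<^sup>2 - (norm (v - p))\<^sup>2)) \<partial>lborel)
    = ennreal (2 * unit_ball_vol (real DIM('a)) * R ^ (DIM('a) + 2) / (real DIM('a) + 2))"
proof -
  let ?n = "DIM('a)" and ?w = "unit_ball_vol (real DIM('a))"
  have w: "0 \<le> ?w" by simp
  have inner: "ennreal (indicator (cball p R) v * (R\<^sup>2 - (norm (v - p))\<^sup>2))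
      = (\<integral>\<^sup>+t. ennreal (2 * t) * indicator {0..R} t * indicator (cball p t) v \<partial>lborel)" for v
  proof (cases "v \<in> cball p R")
    case True
    then have r: "norm (v - p) \<le> R" by (simp add: dist_norm norm_minus_commute)
    have "(\<integral>\<^sup>+t. ennreal (2 * t) * indicator {0..R} t * indicator (cball p t) v \<partial>lborel)
        = (\<integral>\<^sup>+t. ennreal (2 * t) * indicator {norm (v - p)..R} t \<partial>lborel)"
      by (intro nn_integral_cong) (auto simp: indicator_def dist_norm norm_minus_commute intro: order_trans[OF norm_ge_zero])
    also have "\<dots> = ennreal (R\<^sup>2 - (norm (v - p))\<^sup>2)"
    proof (rule nn_integral_FTC_Icc)
      show "((\<lambda>t. t\<^sup>2) has_real_derivative 2 * t) (at t)" for t :: real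
        by (auto intro!: derivative_eq_intros)
      show "0 \<le> 2 * t" if "t \<in> {norm (v - p)..R}" for t
        using that by (auto intro: order_trans[OF norm_ge_zero])
    qed (use r in auto)
    finally show ?thesis using True by simp
  next
    case False
    then have "(\<integral>\<^sup>+t. ennreal (2 * t) * indicator {0..R} t * indicator (cball p t) v \<partial>lborel) = (\<integral>\<^sup>+t. 0 \<partial>(lborel :: real measure))"
      by (intro nn_integral_cong) (auto simp: indicator_def)
    then show ?thesis using False by simp
  qed
  have m: "(\<lambda>(v, t). ennreal (2 * t) * indicator {0..R} t * indicator (cball p t) v) \<in> borel_measurable ((lborel :: 'a measure) \<Otimes>\<^sub>M (lborel :: real measure))"
  proof -
    have "(\<lambda>z. ennreal (2 * snd z) * indicator {0..R} (snd z) * (if dist p (fst z) \<le> snd z then 1 else 0))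
      \<in> borel_measurable ((lborel :: 'a measure) \<Otimes>\<^sub>M (lborel :: real measure))" by measurable
    moreover have "(\<lambda>(v, t). ennreal (2 * t) * indicator {0..R} t * indicator (cball p t) v)
      = (\<lambda>z. ennreal (2 * snd z) * indicator {0..R} (snd z) * (if dist p (fst z) \<le> snd z then 1 else 0))"
      by (auto simp: fun_eq_iff indicator_def)
    ultimately show ?thesis by simp
  qed
  have "(\<integral>\<^sup>+v. ennreal (indicator (cball p R) v * (R\<^sup>2 - (norm (v - p))\<^sup>2)) \<partial>lborel)
      = (\<integral>\<^sup>+v. (\<integral>\<^sup>+t. ennreal (2 * t) * indicator {0..R} t * indicator (cball p t) v \<partial>lborel) \<partial>lborel)"
    by (intro nn_integral_cong inner)
  also have "\<dots> = (\<integral>\<^sup>+t. (\<integral>\<^sup>+v. ennreal (2 * t) * indicator {0..R} t * indicator (cball p t) v \<partial>lborel) \<partial>lborel)"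
    by (rule lborel_pair.Fubini'[OF m, symmetric])
  also have "\<dots> = (\<integral>\<^sup>+t. ennreal (2 * ?w * t ^ (?n + 1)) * indicator {0..R} t \<partial>lborel)"
  proof (intro nn_integral_cong)
    fix t :: real
    have "(\<integral>\<^sup>+v. ennreal (2 * t) * indicator {0..R} t * indicator (cball p t) v \<partial>lborel)
      = ennreal (2 * t) * indicator {0..R} t * emeasure lborel (cball p t)"
      by (rule nn_integral_cmult_indicator) simp
    also have "\<dots> = ennreal (2 * ?w * t ^ (?n + 1)) * indicator {0..R} t"
    proof (cases "t \<in> {0..R}")
      case True
      then have "ennreal (2 * t) * emeasure lborel (cball p t) = ennreal (2 * t) * ennreal (?w * t ^ ?n)"
        by (simp add: emeasure_cball)
      also have "\<dots> = ennreal (2 * t * (?w * t ^ ?n))" using True by (intro ennreal_mult[symmetric]) auto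
      also have "2 * t * (?w * t ^ ?n) = 2 * ?w * t ^ (?n + 1)" by simp
      finally show ?thesis using True by simp
    qed simp
    finally show "(\<integral>\<^sup>+v. ennreal (2 * t) * indicator {0..R} t * indicator (cball p t) v \<partial>lborel)
      = ennreal (2 * ?w * t ^ (?n + 1)) * indicator {0..R} t" .
  qed
  also have "\<dots> = ennreal (2 * ?w * R ^ (?n + 2) / (real ?n + 2) - 2 * ?w * 0 ^ (?n + 2) / (real ?n + 2))"
  proof (rule nn_integral_FTC_Icc)
    show "((\<lambda>t. 2 * ?w * t ^ (?n + 2) / (real ?n + 2)) has_real_derivative 2 * ?w * t ^ (?n + 1)) (at t)" for t
    proof -
      have "((\<lambda>t. 2 * ?w / (real ?n + 2) * t ^ (?n + 2)) has_real_derivative 2 * ?w / (real ?n + 2) * (real (?n + 2) * t ^ (?n + 2 - Suc 0))) (at t)"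
        by (rule DERIV_cmult[OF DERIV_pow])
      moreover have "2 * ?w / (real ?n + 2) * (real (?n + 2) * t ^ (?n + 2 - Suc 0)) = 2 * ?w * t ^ (?n + 1)"
      proof -
        have "a / c * (c * x) = a * x" if "c \<noteq> 0" for a c x :: real using that by simp
        moreover have "?n + 2 - Suc 0 = ?n + 1" "real (?n + 2) = real ?n + 2" "real ?n + 2 \<noteq> 0" by simp_all
        ultimately show ?thesis by metis
      qed
      ultimately show ?thesis by simp
    qed
  qed (use R w in auto)
  finally show ?thesis by simp
qed

lemma integral_ball_defect:
  fixes p :: "'a::euclidean_space"
  assumes R: "0 < R"
  shows "has_bochner_integral lborel (\<lambda>v. indicator (cball p R) v * (R\<^sup>2 - (norm (v - p))\<^sup>2))
    (2 * unit_ball_vol (real DIM('a)) * R ^ (DIM('a) + 2) / (real DIM('a) + 2))"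
proof (rule has_bochner_integral_nn_integral)
  show "AE v in lborel. 0 \<le> indicator (cball p R) v * (R\<^sup>2 - (norm (v - p))\<^sup>2)"
    by (rule AE_I2) (auto simp: indicator_def dist_norm norm_minus_commute intro: power_mono)
  have [measurable]: "cball p R \<in> sets lborel" by simp
  show "(\<lambda>v. indicator (cball p R) v * (R\<^sup>2 - (norm (v - p))\<^sup>2)) \<in> borel_measurable lborel" by measurable
  show "(\<integral>\<^sup>+v. ennreal (indicator (cball p R) v * (R\<^sup>2 - (norm (v - p))\<^sup>2)) \<partial>lborel)
    = ennreal (2 * unit_ball_vol (real DIM('a)) * R ^ (DIM('a) + 2) / (real DIM('a) + 2))"
    by (rule nn_integral_ball_defect[OF R])
qed (use R in simp)

text \<open>Bathtub principle: \<open>f - indicator (cball p R)\<close> and \<open>|v - p|\<^sup>2 - R\<^sup>2\<close> have the same sign everywhere.\<close>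

lemma second_moment_ge_ball:
  fixes f :: "'a::euclidean_space \<Rightarrow> real"
  assumes f: "integrable lborel f" and f2: "integrable lborel (\<lambda>v. f v * (norm (v - p))\<^sup>2)"
    and bounds: "\<And>v. 0 \<le> f v" "\<And>v. f v \<le> 1"
    and R: "0 < R" and mass: "(LINT v|lborel. f v) = unit_ball_vol (real DIM('a)) * R ^ DIM('a)"
  defines "J \<equiv> real DIM('a) / (real DIM('a) + 2) * unit_ball_vol (real DIM('a)) * R ^ (DIM('a) + 2)"
  shows "J \<le> (LINT v|lborel. f v * (norm (v - p))\<^sup>2)"
    and "(LINT v|lborel. f v * (norm (v - p))\<^sup>2) = J \<longleftrightarrow> (AE v in lborel. f v = indicator (cball p R) v)"
proof -
  let ?n = "DIM('a)" and ?w = "unit_ball_vol (real DIM('a))"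
  let ?h = "\<lambda>v. (norm (v - p))\<^sup>2 - R\<^sup>2" and ?B = "\<lambda>v. indicator (cball p R) v * (R\<^sup>2 - (norm (v - p))\<^sup>2)"
  let ?D = "\<lambda>v. (f v - indicator (cball p R) v) * ?h v"
  have D: "?D v = f v * (norm (v - p))\<^sup>2 - R\<^sup>2 * f v + ?B v" for v by (simp add: algebra_simps)
  have intD: "integrable lborel ?D"
    unfolding D using f f2 integral_ball_defect[OF R, of p]
    by (intro Bochner_Integration.integrable_add Bochner_Integration.integrable_diff) (auto simp: has_bochner_integral_iff)
  have "(LINT v|lborel. ?D v) = (LINT v|lborel. f v * (norm (v - p))\<^sup>2) - R\<^sup>2 * (?w * R ^ ?n) + 2 * ?w * R ^ (?n + 2) / (real ?n + 2)"
    unfolding D using f f2 integral_ball_defect[OF R, of p] mass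
    by (simp add: has_bochner_integral_iff)
  \<comment> \<open>\<open>J\<close> is the second moment of the ball: \<open>R\<^sup>2\<close>
    times its mass minus the integral of the defect.\<close>
  also have "\<dots> = (LINT v|lborel. f v * (norm (v - p))\<^sup>2) - J"
    by (simp add: J_def power_add power2_eq_square field_simps)
  finally have eq: "(LINT v|lborel. ?D v) = (LINT v|lborel. f v * (norm (v - p))\<^sup>2) - J" .
  have nonneg: "0 \<le> ?D v" for v
  proof (cases "v \<in> cball p R")
    case True
    then have "norm (v - p) \<le> R" by (simp add: dist_norm norm_minus_commute)
    then have "(norm (v - p))\<^sup>2 \<le> R\<^sup>2" by (intro power_mono) auto
    then show ?thesis using True bounds(2)[of v] by (simp add: mult_nonpos_nonpos)
  next
    case False
    then have "R \<le> norm (v - p)" by (simp add: dist_norm norm_minus_commute)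
    then have "R\<^sup>2 \<le> (norm (v - p))\<^sup>2" using R by (intro power_mono) auto
    then show ?thesis using False bounds(1)[of v] by simp
  qed
  show "J \<le> (LINT v|lborel. f v * (norm (v - p))\<^sup>2)"
    using Bochner_Integration.integral_nonneg[of lborel ?D, OF nonneg] eq by simp
  have "(LINT v|lborel. f v * (norm (v - p))\<^sup>2) = J \<longleftrightarrow> (LINT v|lborel. ?D v) = 0" using eq by simp
  also have "\<dots> \<longleftrightarrow> (AE v in lborel. ?D v = 0)"
    by (rule integral_nonneg_eq_0_iff_AE[OF intD]) (use nonneg in auto)
  also have "\<dots> \<longleftrightarrow> (AE v in lborel. f v = indicator (cball p R) v)"
  proof
    assume "AE v in lborel. ?D v = 0"
    then show "AE v in lborel. f v = indicator (cball p R) v"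
      using AE_not_in[OF sphere_null_set[of p R]]
    proof eventually_elim
      case (elim v)
      then have "norm (v - p) \<noteq> R" by (simp add: dist_norm norm_minus_commute)
      then have "(norm (v - p))\<^sup>2 \<noteq> R\<^sup>2" using R by (simp add: power2_eq_iff_nonneg)
      then show ?case using elim(1) by simp
    qed
  next
    assume "AE v in lborel. f v = indicator (cball p R) v"
    then show "AE v in lborel. ?D v = 0" by eventually_elim simp
  qed
  finally show "(LINT v|lborel. f v * (norm (v - p))\<^sup>2) = J \<longleftrightarrow> (AE v in lborel. f v = indicator (cball p R) v)" .
qed

text \<open>The integrand is nonnegative and vanishes exactly at the values 0 and 1.\<close>

lemma entropy_zero_iff:
  fixes f :: "'a::euclidean_space \<Rightarrow> real"
  assumes f: "f \<in> L12" and bounds: "\<forall>v. 0 \<le> f v \<and> f v \<le> 1"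
  shows "entropy f = 0 \<longleftrightarrow> emeasure lborel {v. 0 < f v \<and> f v < 1} = 0"
proof -
  have [measurable]: "f \<in> borel_measurable borel" using f by (auto simp: L12_def dest: borel_measurable_integrable)
  let ?e = "\<lambda>v. - (1 - f v) * ln (1 - f v) - f v * ln (f v)"
  have neg: "y * ln y < 0" if "0 < y" "y < 1" for y :: real
    using that by (intro mult_pos_neg) auto
  have e: "0 \<le> ?e v \<and> (?e v = 0 \<longleftrightarrow> \<not> (0 < f v \<and> f v < 1))" for v
  proof (cases "0 < f v \<and> f v < 1")
    case True
    then have "f v * ln (f v) < 0" "(1 - f v) * ln (1 - f v) < 0" by (auto intro!: neg)
    then have "0 < ?e v" unfolding mult_minus_left by linarith
    then show ?thesis using True less_imp_le less_irrefl by metis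
  next
    case False
    then have "f v = 0 \<or> f v = 1" using bounds[rule_format, of v] by linarith
    then show ?thesis by auto
  qed
  have "entropy f = 0 \<longleftrightarrow> (AE v in lborel. ?e v = 0)"
    unfolding entropy_def using e by (intro integral_nonneg_eq_0_iff_AE entropy_integrable(1)[OF f bounds]) auto
  also have "\<dots> \<longleftrightarrow> (AE v in lborel. \<not> (0 < f v \<and> f v < 1))" using e by simp
  also have "\<dots> \<longleftrightarrow> {v. 0 < f v \<and> f v < 1} \<in> null_sets lborel"
    using AE_iff_null_sets[of "{v. 0 < f v \<and> f v < 1}" lborel] by simp
  also have "\<dots> \<longleftrightarrow> emeasure lborel {v. 0 < f v \<and> f v < 1} = 0" by (simp add: null_sets_def)
  finally show ?thesis .
qed

lemma exists_collision_equilibrium: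
  fixes f :: "'a::euclidean_space \<Rightarrow> real"
  assumes dim: "2 \<le> DIM('a)" and int: "integrable lborel f"
    and bounds: "\<forall>v. 0 \<le> f v \<and> f v \<le> 1"
    and ae: "AE (v, w, s) in lborel \<Otimes>\<^sub>M (lborel \<Otimes>\<^sub>M sphere_measure).
           f (post_v v w s) * f (post_w v w s) * (1 - f v) * (1 - f w)
             = f v * f w * (1 - f (post_v v w s)) * (1 - f (post_w v w s))"
  obtains G where "collision_equilibrium G f"
proof -
  have f[measurable]: "f \<in> borel_measurable borel" using borel_measurable_integrable[OF int] by simp
  define Q where "Q v w s \<longleftrightarrow> f (post_v v w s) * f (post_w v w s) * (1 - f v) * (1 - f w)
             = f v * f w * (1 - f (post_v v w s)) * (1 - f (post_w v w s))" for v w s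
  have Q: "Measurable.pred L (\<lambda>p. Q (a p) (b p) (c p))"
    if [measurable]: "a \<in> borel_measurable L" "b \<in> borel_measurable L" "c \<in> borel_measurable L" for a b c and L :: "'b measure"
  proof -
    have pv: "(\<lambda>p. post_v (a p) (b p) (c p)) \<in> borel_measurable L" unfolding post_v_def by measurable
    have pw: "(\<lambda>p. post_w (a p) (b p) (c p)) \<in> borel_measurable L" unfolding post_w_def by measurable
    have 1: "(\<lambda>p. f (post_v (a p) (b p) (c p))) \<in> borel_measurable L" by (rule measurable_compose[OF pv f])
    have 2: "(\<lambda>p. f (post_w (a p) (b p) (c p))) \<in> borel_measurable L" by (rule measurable_compose[OF pw f])
    have 3: "(\<lambda>p. f (a p)) \<in> borel_measurable L" "(\<lambda>p. f (b p)) \<in> borel_measurable L" by measurable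
    have "Measurable.pred L (\<lambda>p. g p * h p * (1 - k p) * (1 - l p) = k p * l p * (1 - g p) * (1 - h p))"
      if [measurable]: "g \<in> borel_measurable L" "h \<in> borel_measurable L" "k \<in> borel_measurable L" "l \<in> borel_measurable L"
      for g h k l :: "'b \<Rightarrow> real" by measurable
    from this[OF 1 2 3] show ?thesis unfolding Q_def .
  qed
  have "AE s in sphere_measure. AE v in lborel. AE w in lborel. Q v w s"
  proof (rule AE_rotate)
    show "sigma_finite_measure (sphere_measure :: 'a measure)"
      by (rule finite_measure.axioms(1)[OF finite_sphere_measure])
    have "(\<lambda>s::'a. s) \<in> borel_measurable (restrict_space borel (sphere 0 1))" by (rule measurable_restrict_space1) simp
    then have [measurable]: "(\<lambda>s::'a. s) \<in> borel_measurable sphere_measure"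
      using measurable_cong_sets[OF sets_sphere_measure refl] by blast
    have "(\<lambda>p. snd (snd p)) \<in> borel_measurable ((lborel :: 'a measure) \<Otimes>\<^sub>M ((lborel :: 'a measure) \<Otimes>\<^sub>M (sphere_measure :: 'a measure)))"
      by (rule measurable_compose[of "\<lambda>p. snd (snd p)" _ sphere_measure "\<lambda>s. s"]) measurable
    then show "Measurable.pred ((lborel :: 'a measure) \<Otimes>\<^sub>M ((lborel :: 'a measure) \<Otimes>\<^sub>M (sphere_measure :: 'a measure))) (\<lambda>p. Q (fst p) (fst (snd p)) (snd (snd p)))"
      by (intro Q) measurable
    show "AE (v, w, s) in lborel \<Otimes>\<^sub>M (lborel \<Otimes>\<^sub>M sphere_measure). Q v w s" using ae unfolding Q_def .
  qed (rule lborel.sigma_finite_measure_axioms)+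
  then obtain G where G: "dense_directions G" "\<And>s. s \<in> G \<Longrightarrow> AE v in lborel. AE w in lborel. Q v w s"
    using AE_sphere_dense_directions by blast
  have "collision_equilibrium G f"
  proof
    show "AE v in lborel. AE u in lborel.
      f (v + rx s u) * f (v + rx (- s) u) * (1 - f v) * (1 - f (v + u))
        = f v * f (v + u) * (1 - f (v + rx s u)) * (1 - f (v + rx (- s) u))" if "s \<in> G" for s
      using G(2)[OF that]
    proof eventually_elim
      case (elim v)
      have "Measurable.pred borel (\<lambda>w. Q v w s)" by (intro Q) measurable
      from AE_lborel_affine[OF one_neq_zero this elim, of v] show ?case by (simp add: Q_def post_shift)
    qed
  qed (use dim int bounds G(1) in auto)
  then show thesis by (rule that)
qed

lemma L12_integrable:
  fixes f :: "'a::euclidean_space \<Rightarrow> real"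
  assumes "f \<in> L12"
  shows "integrable lborel f" "integrable lborel (\<lambda>v. f v *\<^sub>R v)" "integrable lborel (\<lambda>v. f v * (norm (v - p))\<^sup>2)"
proof -
  show int: "integrable lborel f" using assms by (simp add: L12_def)
  have [measurable]: "f \<in> borel_measurable borel" using borel_measurable_integrable[OF int] by simp
  have i: "integrable lborel (\<lambda>v. (1 + (norm v)\<^sup>2) * \<bar>f v\<bar>)" using assms by (simp add: L12_def)
  show "integrable lborel (\<lambda>v. f v *\<^sub>R v)"
  proof (rule Bochner_Integration.integrable_bound[OF i])
    have "norm (f v *\<^sub>R v) \<le> norm ((1 + (norm v)\<^sup>2) * \<bar>f v\<bar>)" for v
    proof -
      have "norm v \<le> 1 + (norm v)\<^sup>2" using sum_squares_bound[of "norm v" 1] by (simp add: power2_eq_square) (smt (verit) norm_ge_zero mult_nonneg_nonneg)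
      then have "\<bar>f v\<bar> * norm v \<le> \<bar>f v\<bar> * (1 + (norm v)\<^sup>2)" by (intro mult_left_mono) auto
      then show ?thesis by (simp add: abs_mult mult.commute)
    qed
    then show "AE v in lborel. norm (f v *\<^sub>R v) \<le> norm ((1 + (norm v)\<^sup>2) * \<bar>f v\<bar>)" by simp
  qed measurable
  show "integrable lborel (\<lambda>v. f v * (norm (v - p))\<^sup>2)"
  proof (rule Bochner_Integration.integrable_bound[OF integrable_mult_right[OF i, of "2 + 2 * (norm p)\<^sup>2"]])
    have "norm (f v * (norm (v - p))\<^sup>2) \<le> norm ((2 + 2 * (norm p)\<^sup>2) * ((1 + (norm v)\<^sup>2) * \<bar>f v\<bar>))" for v
    proof -
      have "(norm (v - p))\<^sup>2 \<le> (norm v + norm p)\<^sup>2" by (intro power_mono norm_triangle_ineq4) simp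
      also have "\<dots> \<le> 2 * (norm v)\<^sup>2 + 2 * (norm p)\<^sup>2"
        using sum_squares_bound[of "norm v" "norm p"] by (simp add: power2_sum)
      also have "\<dots> \<le> (2 + 2 * (norm p)\<^sup>2) * (1 + (norm v)\<^sup>2)" by (simp add: algebra_simps)
      finally have "\<bar>f v\<bar> * (norm (v - p))\<^sup>2 \<le> \<bar>f v\<bar> * ((2 + 2 * (norm p)\<^sup>2) * (1 + (norm v)\<^sup>2))"
        by (intro mult_left_mono) auto
      moreover have "0 \<le> (2 + 2 * (norm p)\<^sup>2) * ((1 + (norm v)\<^sup>2) * \<bar>f v\<bar>)" by (intro mult_nonneg_nonneg) auto
      ultimately show ?thesis by (simp add: abs_mult mult_ac)
    qed
    then show "AE v in lborel. norm (f v * (norm (v - p))\<^sup>2) \<le> norm ((2 + 2 * (norm p)\<^sup>2) * ((1 + (norm v)\<^sup>2) * \<bar>f v\<bar>))" by simp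
  qed measurable
qed

lemma mass_pos:
  fixes f :: "'a::euclidean_space \<Rightarrow> real"
  assumes f: "f \<in> L12" and nz: "L12_norm f \<noteq> 0" and bounds: "\<forall>v. 0 \<le> f v \<and> f v \<le> 1"
  shows "0 < mass f"
proof -
  have "0 \<le> mass f" unfolding mass_def using bounds by (intro Bochner_Integration.integral_nonneg) auto
  moreover have "mass f \<noteq> 0"
  proof
    assume "mass f = 0"
    then have "AE v in lborel. f v = 0"
      unfolding mass_def using integral_nonneg_eq_0_iff_AE[OF L12_integrable(1)[OF f]] bounds by auto
    then have "L12_norm f = 0" unfolding L12_norm_def by (intro integral_eq_zero_AE) (auto elim: eventually_mono)
    then show False using nz by simp
  qed
  ultimately show ?thesis by simp
qed

lemma mass_cball:
  fixes p :: "'a::euclidean_space"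
  assumes "0 < R" "f \<in> borel_measurable borel" and "AE v in lborel. f v = indicator (cball p R) v"
  shows "mass f = unit_ball_vol (real DIM('a)) * R ^ DIM('a)"
proof -
  have "mass f = (LINT v|lborel. indicator (cball p R) v)"
    unfolding mass_def
  proof (rule integral_cong_AE)
    show "f \<in> borel_measurable lborel" using assms(2) by simp
    show "indicator (cball p R) \<in> borel_measurable (lborel :: 'a measure)" by (rule borel_measurable_indicator) simp
  qed (rule assms(3))
  also have "\<dots> = measure lborel (cball p R)" by simp
  also have "\<dots> = unit_ball_vol (real DIM('a)) * R ^ DIM('a)"
    using assms(1) by (simp add: measure_def emeasure_cball)
  finally show ?thesis .
qed

text \<open>Second moment and power of the mass both scale like \<open>R ^ (k + 2)\<close>, so the
  radius cancels. With \<open>w\<close> the volume of the unit ball, \<open>n * w\<close> is the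
  area of the unit sphere.\<close>

lemma ball_moment_ratio:
  fixes w R n :: real
  assumes w: "0 < w" and R: "0 < R" and n: "0 < n" and k: "n = real k"
  shows "n / (n + 2) * w * R ^ (k + 2) / (w * R ^ k) powr ((n + 2) / n) = n / (n + 2) * (n / (n * w)) powr (2 / n)"
proof -
  have "(w * R ^ k) powr ((n + 2) / n) = w powr ((n + 2) / n) * (R ^ k) powr ((n + 2) / n)"
    using w R by (simp add: powr_mult)
  also have "(R ^ k) powr ((n + 2) / n) = R powr (n + 2)"
    using R n k by (simp add: powr_realpow[symmetric] powr_powr)
  also have "\<dots> = R ^ (k + 2)"
  proof -
    have "n + 2 = real (k + 2)" using k by simp
    then show ?thesis using powr_realpow[OF R, of "k + 2"] by (simp only:)
  qed
  also have "w powr ((n + 2) / n) = w * w powr (2 / n)"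
    using w n by (simp add: add_divide_distrib powr_add)
  finally have 1: "(w * R ^ k) powr ((n + 2) / n) = w * w powr (2 / n) * R ^ (k + 2)" .
  have "(n / (n * w)) powr (2 / n) = 1 / w powr (2 / n)" using n w by (simp add: powr_divide)
  then show ?thesis unfolding 1 using w R by simp
qed

theorem theorem1p1:
  fixes f :: "real ^ 'n \<Rightarrow> real"
  assumes "CARD('n) \<ge> 2"
    and "f \<in> L12"
    and "L12_norm f \<noteq> 0"
    and "\<forall>v. 0 \<le> f v \<and> f v \<le> 1"
    and "AE (v, w, s) in lborel \<Otimes>\<^sub>M (lborel \<Otimes>\<^sub>M sphere_measure).
           f (post_v v w s) * f (post_w v w s) * (1 - f v) * (1 - f w)
             = f v * f w * (1 - f (post_v v w s)) * (1 - f (post_w v w s))"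
  shows "let n = real CARD('n);
             M0 = mass f; v0 = mean_velocity f; M2 = second_moment f;
             ratio = M2 / M0 powr ((n + 2) / n);
             crit = n / (n + 2) * (n / sphere_area TYPE(real ^ 'n)) powr (2 / n);
             I1 = (entropy f > 0);
             I2 = (ratio > crit);
             I3 = (\<exists>a b. 0 < a \<and> 0 < b \<and>
                    (AE v in lborel. f v = a * exp (- b * (norm (v - v0))\<^sup>2)
                                          / (1 + a * exp (- b * (norm (v - v0))\<^sup>2))));
             II1 = (entropy f = 0);
             II2 = (ratio = crit);
             II3 = (\<exists>R. 0 < R \<and>
                    (AE v in lborel. f v = indicator {u. norm (u - v0) \<le> R} v))
         in ((I1 \<or> I2 \<or> I3) \<or> (II1 \<or> II2 \<or> II3)) \<and>
            (I1 \<longleftrightarrow> emeasure lborel {v. 0 < f v \<and> f v < 1} > 0) \<and>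
            (I1 \<longleftrightarrow> I2) \<and> (I2 \<longleftrightarrow> I3) \<and>
            (II1 \<longleftrightarrow> emeasure lborel {v. 0 < f v \<and> f v < 1} = 0) \<and>
            (II1 \<longleftrightarrow> II2) \<and> (II2 \<longleftrightarrow> II3)"
proof -
  let ?n = "real CARD('n)" and ?M = "{v. 0 < f v \<and> f v < 1}" and ?p = "mean_velocity f"
  let ?w = "unit_ball_vol ?n"
  let ?ratio = "second_moment f / mass f powr ((?n + 2) / ?n)"
  let ?crit = "?n / (?n + 2) * (?n / sphere_area TYPE(real ^ 'n)) powr (2 / ?n)"
  let ?I3 = "\<exists>a b. 0 < a \<and> 0 < b \<and> (AE v in lborel. f v = a * exp (- b * (norm (v - ?p))\<^sup>2) / (1 + a * exp (- b * (norm (v - ?p))\<^sup>2)))"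
  let ?II3 = "\<exists>R. 0 < R \<and> (AE v in lborel. f v = indicator {u. norm (u - ?p) \<le> R} v)"
  have D: "DIM(real ^ 'n) = CARD('n)" by simp
  have dim: "2 \<le> DIM(real ^ 'n)" and N: "0 < CARD('n)" and n: "0 < ?n" using assms(1) by simp_all
  note int = L12_integrable[OF assms(2)]
  have f[measurable]: "f \<in> borel_measurable borel" using borel_measurable_integrable[OF int(1)] by simp
  have m: "0 < mass f" by (rule mass_pos[OF assms(2-4)])
  obtain G where "collision_equilibrium G f"
    using exists_collision_equilibrium[OF dim int(1) assms(4,5)] .
  then interpret collision_equilibrium G f .
  have ball_eq: "{u. norm (u - ?p) \<le> R} = cball ?p R" for R by (auto simp: dist_norm norm_minus_commute)
  have w: "0 < ?w" by simp
  have II1: "entropy f = 0 \<longleftrightarrow> emeasure lborel ?M = 0" by (rule entropy_zero_iff[OF assms(2,4)])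
  have I1: "entropy f > 0 \<longleftrightarrow> emeasure lborel ?M > 0"
    using II1 entropy_integrable(2)[OF assms(2,4)] by (auto simp: zero_less_iff_neq_zero)
  have I3: "?I3" if pos: "emeasure lborel ?M > 0"
  proof -
    obtain a b p where ab: "0 < a" "0 < b"
      "AE v in lborel. f v = a * exp (- b * (norm (v - p))\<^sup>2) / (1 + a * exp (- b * (norm (v - p))\<^sup>2))"
      using fermi_dirac[unfolded M_def, OF pos] .
    have "?p = p"
      by (rule mean_velocity_radial[OF int(1,2) _ _ ab(3)[THEN eventually_mono], of "\<lambda>r. a * exp (- b * r\<^sup>2) / (1 + a * exp (- b * r\<^sup>2))"])
        (use m in auto)
    then show ?thesis using ab by blast
  qed
  have I3_pos: "emeasure lborel ?M > 0" if I3: ?I3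
  proof -
    obtain a b where ab: "0 < a" "0 < b"
      "AE v in lborel. f v = a * exp (- b * (norm (v - ?p))\<^sup>2) / (1 + a * exp (- b * (norm (v - ?p))\<^sup>2))"
      using I3 by blast
    have "AE v in lborel. v \<in> ?M"
      using ab(3)
    proof eventually_elim
      case (elim v)
      have "0 < a * exp (- b * (norm (v - ?p))\<^sup>2)" using ab(1) by simp
      then show ?case unfolding mem_Collect_eq elim by (simp add: add_pos_pos)
    qed
    then have "\<not> (AE v in lborel. v \<notin> ?M)"
      using AE_imp_ex[of "\<lambda>v. v \<in> ?M \<and> v \<notin> ?M" lborel UNIV] by (auto simp: AE_conj_iff)
    then show ?thesis using AE_iff_null_sets[of ?M lborel] by (auto simp: null_sets_def zero_less_iff_neq_zero)
  qed
  have II3: "?II3" if null: "emeasure lborel ?M = 0"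
  proof -
    have "mass f \<noteq> 0" using m by simp
    obtain c R where cR: "0 < R" "AE v in lborel. f v = indicator (cball c R) v"
      using saturated_ball[unfolded M_def, OF null \<open>mass f \<noteq> 0\<close>] .
    have "?p = c"
      by (rule mean_velocity_radial[OF int(1,2) _ _ cR(2)[THEN eventually_mono], of "\<lambda>r. indicator {..R} r"])
        (use m in \<open>auto simp: indicator_def dist_norm norm_minus_commute\<close>)
    then show ?thesis using cR unfolding ball_eq by blast
  qed
  \<comment> \<open>The radius of the ball with the same mass as \<open>f\<close>; the critical
    value is the ratio of moments of this ball.\<close>
  define R where "R = root CARD('n) (mass f / ?w)"
  have R: "0 < R" using m w unfolding R_def by (intro real_root_gt_zero N divide_pos_pos)
  have "R ^ CARD('n) = mass f / ?w" using m w unfolding R_def by (intro real_root_pow_pos2 N) simp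
  then have Rn: "mass f = ?w * R ^ CARD('n)"
    using w by (metis less_irrefl nonzero_mult_div_cancel_left times_divide_eq_right)
  have bnd: "0 \<le> f v" "f v \<le> 1" for v using assms(4) by auto
  note bathtub = second_moment_ge_ball[OF int(1) int(3)[of ?p] bnd R Rn[folded D, unfolded mass_def],
      folded second_moment_def, unfolded D]
  have crit: "?crit = ?n / (?n + 2) * ?w * R ^ (CARD('n) + 2) / mass f powr ((?n + 2) / ?n)"
    unfolding Rn sphere_area_eq D using ball_moment_ratio[OF w R n, of "CARD('n)"] by simp
  have ge: "?crit \<le> ?ratio"
    unfolding crit using bathtub(1) m by (intro divide_right_mono) auto
  have II2: "?ratio = ?crit \<longleftrightarrow> (AE v in lborel. f v = indicator (cball ?p R) v)"
  proof -
    have "mass f powr ((?n + 2) / ?n) \<noteq> 0" using m by simp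
    then show ?thesis unfolding crit divide_cancel_right using bathtub(2) by blast
  qed
  have II23: "?ratio = ?crit \<longleftrightarrow> ?II3"
  proof
    \<comment> \<open>The radius in \<open>?II3\<close> is arbitrary, but comparison of masses
      forces it to be \<open>R\<close>.\<close>
    assume ?II3
    then obtain r where r: "0 < r" "AE v in lborel. f v = indicator (cball ?p r) v" unfolding ball_eq by blast
    have "?w * r ^ CARD('n) = ?w * R ^ CARD('n)" using mass_cball[OF r(1) f r(2), unfolded D] Rn by (rule trans[OF sym])
    then have "r ^ CARD('n) = R ^ CARD('n)" using w by simp
    then have "r = R" by (rule power_eq_imp_eq_base) (use r(1) R N in auto)
    then show "?ratio = ?crit" using r(2) II2 by simp
  qed (use II2 R in \<open>auto simp: ball_eq\<close>)
  have II31: "emeasure lborel ?M = 0" if II3: ?II3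
  proof -
    obtain r where r: "0 < r" "AE v in lborel. f v = indicator (cball ?p r) v" using II3 unfolding ball_eq by blast
    from r(2) have "AE v in lborel. v \<notin> ?M" by eventually_elim (auto simp: indicator_def)
    then show ?thesis using AE_iff_null_sets[of ?M lborel] by (auto simp: null_sets_def)
  qed
  have II12: "entropy f = 0 \<longleftrightarrow> ?ratio = ?crit" using II1 II3 II31 II23 by blast
  \<comment> \<open>Entropy is never negative and the ratio never below the critical value, so
    equivalence of the two equalities gives that of the strict inequalities.\<close>
  have I12: "entropy f > 0 \<longleftrightarrow> ?ratio > ?crit"
    using II12 ge entropy_integrable(2)[OF assms(2,4)] by linarith
  have I23: "?ratio > ?crit \<longleftrightarrow> ?I3" using I1 I12 I3 I3_pos by blast
  have "entropy f > 0 \<or> entropy f = 0" using entropy_integrable(2)[OF assms(2,4)] by linarith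
  then show ?thesis
    unfolding Let_def using I1 I12 I23 II1 II12 II23 by blast
qed

end
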